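(* Let $C\subseteq\{N,H,R,L,Fa,Fu\}$. For a distributive $\nabla$-algebra $\mathcal{A}$ let $\mathfrak{S}'(\mathcal{A})=(\mathcal{F}_p(\mathsf{A}),R)$. Here $\mathcal{F}_p(\mathsf{A})$ is the set of prime filters with the topology generated by the basis $\{P\mid a\in P\}$ ($a\in A$), and $(P,Q)\in R$ iff $\nabla[P]\subseteq Q$. For a $\nabla$-algebra morphism $f$ let $\mathfrak{S}'(f)=f^{-1}$. For a $\nabla$-spectral space $(X,R)$ let $\mathfrak{A}'(X,R)=(CO(X),\nabla_R,\to_R)$. Here $CO(X)$ is the lattice (under $\subseteq$) of compact open subsets, $\nabla_R(U)=\{x\mid\exists y\in U,\ (y,x)\in R\}$ and $U\to_RV=\{x\mid R[x]\cap U\subseteq V\}$. For a $\nabla$-spectral map $f$ let $\mathfrak{A}'(f)=f^{-1}$. Then $\mathfrak{S}'$ and $\mathfrak{A}'$ together with the natural isomorphisms $\alpha'(a)=\{P\in\mathcal{F}_p(\mathsf{A})\mid a\in P\}$ and $\beta'(x)=\{U\in CO(X)\mid x\in U\}$ establish an equivalence between $\mathbf{Alg}_\nabla(D,C)$ and $[\mathbf{Spec}_\nabla(C)]^{op}$. The same holds for $\mathbf{Alg}^H_\nabla(D,C)$ and $[\mathbf{Spec}^H_\nabla(C)]^{op}$.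
   Context: \textbf{$\nabla$-algebras.} A $\nabla$-algebra is $(\mathsf{A},\nabla,\to)$ with $\mathsf{A}$ a bounded lattice and $\nabla c\wedge a\le b$ iff $c\le a\to b$. Write $\Box a=1\to a$. Properties: - (D): $\mathsf{A}$ distributive. - (H): $\mathsf{A}$ a Heyting algebra. - (N): $\nabla1=1$, $\nabla(a\wedge b)=\nabla a\wedge\nabla b$. - (R): $a\le\nabla a$. - (L): $\nabla a\le a$. - (Fa): $\nabla$ surjective. - (Fu): $\Box$ surjective (equivalently $\nabla$ injective). Morphisms are bounded lattice homomorphisms preserving $\nabla,\to$. $\mathbf{Alg}_\nabla(D,C)$ is the category of distributive $\nabla$-algebras satisfying $C$. $\mathbf{Alg}^H_\nabla(D,C)$ is the category of explicitly Heyting $\nabla$-algebras $(\mathsf{A},\nabla,\to,\supset)$ ($\supset$ the Heyting implication, in the signature) satisfying $C$, with morphisms also preserving $\supset$. \textbf{Spectral spaces.} A space is spectral if it is sober (every irreducible closed set is the closure of a unique point), compact, and its compact opens form a basis. A spectral map is a continuous map between spectral spaces pulling compact opens back to compact opens. A subset $Y\subseteq X$ is: - spectral if it is a spectral space in the subspace topology and the inclusion is a spectral map; - doubly spectral if $Y$ and $X\setminus Y$ are spectral; - saturated if it is an intersection of opens; - co-saturated if it is a union of closed sets. $Cl$ denotes closure and $Sat_X(x)$ is the intersection of all opens containing $x$. A spectral space is Heyting if $Cl(Y)$ is doubly spectral for every doubly spectral $Y$. A spectral map $f$ between Heyting spectral spaces is Heyting if $f[Sat_X(x)]=Sat_Y(f(x))$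 for all $x$. \textbf{$\nabla$-spectral spaces.} A $\nabla$-spectral space is $(X,R)$ with $X$ spectral and $R\subseteq X^2$ such that: - $R[x]=\{y\mid(x,y)\in R\}$ is compact and saturated; - $R^{-1}[y]=\{x\mid(x,y)\in R\}$ is co-saturated; - $\lozenge_R(Y)=\{x\mid\exists y\in Y,(x,y)\in R\}$ is doubly spectral for every doubly spectral $Y$; - $\nabla_R(V)$ is compact open for every compact open $V$. Conditions on a $\nabla$-spectral space: - (N): there is a continuous $\pi:X\to X$ with $(x,y)\in R$ iff $x\in Cl(\{\pi(y)\})$. - (H): $X$ is a Heyting spectral space. - (R): $R$ is reflexive. - (L): $(x,y)\in R$ implies $x\in Cl(\{y\})$. - (Fa): for all $x$ there is $y$ with $(y,x)\in R$ such that $(y,z)\in R$ implies $x\in Cl(\{z\})$. - (Fu): for all $x$ there is $y$ with $(x,y)\in R$ such that $(z,y)\in R$ implies $z\in Cl(\{x\})$. A $\nabla$-spectral map $f:(X,R_X)\to(Y,R_Y)$ is a spectral map such that: - $(x,z)\in R_X$ implies $(f(x),f(z))\in R_Y$; - if $(f(x),y)\in R_Y$ there is $z$ with $(x,z)\in R_X$ and $f(z)=y$; - if $(y,f(x))\in R_Y$ there is $z$ with $(z,x)\in R_X$ and $y\in Cl_Y(\{f(z)\})$. It is Heyting if it is a Heyting spectral map. $\mathbf{Spec}_\nabla(C)$ is the category of $\nabla$-spectral spaces satisfying $C$ with $\nabla$-spectral maps. $\mathbf{Spec}^H_\nabla(C)$ is the category of Heyting ones satisfying $C$ with Heyting $\nabla$-spectral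 maps.
   Formalization: Spectral spaces are additionally required to have compact opens closed under binary intersections (the standard definition); without this CO(X) need not be a lattice, e.g. ℕ discrete plus two points with least neighbourhoods ℕ∪{p} and ℕ∪{q}, with R empty. *)

theory Defs
  imports "HOL-Analysis.Analysis" "HOL-Algebra.Lattice"
begin

section \<open>Nabla-algebras\<close>

record 'a nabla_alg = "'a gorder" +
  nab :: "'a \<Rightarrow> 'a"
  arr :: "'a \<Rightarrow> 'a \<Rightarrow> 'a"

record 'a heyting_nabla_alg = "'a nabla_alg" +
  himp :: "'a \<Rightarrow> 'a \<Rightarrow> 'a"

datatype nabla_cond = CN | CH | CR | CL | CFa | CFu

definition nabla_algebra :: "('a, 'm) nabla_alg_scheme \<Rightarrow> bool" where
  "nabla_algebra A \<longleftrightarrow>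
     Lattice.bounded_lattice A \<and>
     (\<forall>a\<in>carrier A. nab A a \<in> carrier A) \<and>
     (\<forall>a\<in>carrier A. \<forall>b\<in>carrier A. arr A a b \<in> carrier A) \<and>
     (\<forall>a\<in>carrier A. \<forall>b\<in>carrier A. \<forall>c\<in>carrier A.
        nab A c \<sqinter>\<^bsub>A\<^esub> a \<sqsubseteq>\<^bsub>A\<^esub> b \<longleftrightarrow> c \<sqsubseteq>\<^bsub>A\<^esub> arr A a b)"

definition box :: "('a, 'm) nabla_alg_scheme \<Rightarrow> 'a \<Rightarrow> 'a" where
  "box A a = arr A \<top>\<^bsub>A\<^esub> a"

definition distributive :: "('a, 'm) gorder_scheme \<Rightarrow> bool" where
  "distributive L \<longleftrightarrow>
     (\<forall>a\<in>carrier L. \<forall>b\<in>carrier L. \<forall>c\<in>carrier L.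
        a \<sqinter>\<^bsub>L\<^esub> (b \<squnion>\<^bsub>L\<^esub> c) = (a \<sqinter>\<^bsub>L\<^esub> b) \<squnion>\<^bsub>L\<^esub> (a \<sqinter>\<^bsub>L\<^esub> c))"

definition is_heyting_imp :: "('a, 'm) gorder_scheme \<Rightarrow> 'a \<Rightarrow> 'a \<Rightarrow> 'a \<Rightarrow> bool" where
  "is_heyting_imp L a b c \<longleftrightarrow>
     c \<in> carrier L \<and> (\<forall>x\<in>carrier L. x \<sqinter>\<^bsub>L\<^esub> a \<sqsubseteq>\<^bsub>L\<^esub> b \<longleftrightarrow> x \<sqsubseteq>\<^bsub>L\<^esub> c)"

definition heyting_algebra :: "('a, 'm) gorder_scheme \<Rightarrow> bool" where
  "heyting_algebra L \<longleftrightarrow>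
     Lattice.bounded_lattice L \<and>
     (\<forall>a\<in>carrier L. \<forall>b\<in>carrier L. \<exists>c. is_heyting_imp L a b c)"

definition heyting_imp :: "('a, 'm) gorder_scheme \<Rightarrow> 'a \<Rightarrow> 'a \<Rightarrow> 'a" where
  "heyting_imp L a b = (THE c. is_heyting_imp L a b c)"

fun alg_satisfies :: "('a, 'm) nabla_alg_scheme \<Rightarrow> nabla_cond \<Rightarrow> bool" where
  "alg_satisfies A CN \<longleftrightarrow>
     nab A \<top>\<^bsub>A\<^esub> = \<top>\<^bsub>A\<^esub> \<and>
     (\<forall>a\<in>carrier A. \<forall>b\<in>carrier A. nab A (a \<sqinter>\<^bsub>A\<^esub> b) = nab A a \<sqinter>\<^bsub>A\<^esub> nab A b)"
| "alg_satisfies A CH \<longleftrightarrow> heyting_algebra A"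
| "alg_satisfies A CR \<longleftrightarrow> (\<forall>a\<in>carrier A. a \<sqsubseteq>\<^bsub>A\<^esub> nab A a)"
| "alg_satisfies A CL \<longleftrightarrow> (\<forall>a\<in>carrier A. nab A a \<sqsubseteq>\<^bsub>A\<^esub> a)"
| "alg_satisfies A CFa \<longleftrightarrow> nab A ` carrier A = carrier A"
| "alg_satisfies A CFu \<longleftrightarrow> box A ` carrier A = carrier A"

definition Alg :: "nabla_cond set \<Rightarrow> 'a nabla_alg set" where
  "Alg C = {A. nabla_algebra A \<and> distributive A \<and> (\<forall>c\<in>C. alg_satisfies A c)}"

definition AlgH :: "nabla_cond set \<Rightarrow> 'a heyting_nabla_alg set" where
  "AlgH C = {A. nabla_algebra A \<and> distributive A \<and> (\<forall>c\<in>C. alg_satisfies A c) \<and>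
     (\<forall>a\<in>carrier A. \<forall>b\<in>carrier A. is_heyting_imp A a b (himp A a b))}"

text \<open>Arrows are extensional functions (\<open>undefined\<close> off the domain), so that HOL equality
  of arrows is equality of maps. Source and target may live over different types.\<close>

definition alg_hom ::
  "('a, 'm) nabla_alg_scheme \<Rightarrow> ('b, 'n) nabla_alg_scheme \<Rightarrow> ('a \<Rightarrow> 'b) set" where
  "alg_hom A B = {f \<in> carrier A \<rightarrow>\<^sub>E carrier B.
     f \<top>\<^bsub>A\<^esub> = \<top>\<^bsub>B\<^esub> \<and> f \<bottom>\<^bsub>A\<^esub> = \<bottom>\<^bsub>B\<^esub> \<and>
     (\<forall>a\<in>carrier A. f (nab A a) = nab B (f a)) \<and>
     (\<forall>a\<in>carrier A. \<forall>b\<in>carrier A.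
        f (a \<sqinter>\<^bsub>A\<^esub> b) = f a \<sqinter>\<^bsub>B\<^esub> f b \<and>
        f (a \<squnion>\<^bsub>A\<^esub> b) = f a \<squnion>\<^bsub>B\<^esub> f b \<and>
        f (arr A a b) = arr B (f a) (f b))}"

definition algH_hom ::
  "'a heyting_nabla_alg \<Rightarrow> 'b heyting_nabla_alg \<Rightarrow> ('a \<Rightarrow> 'b) set" where
  "algH_hom A B = {f \<in> alg_hom A B.
     \<forall>a\<in>carrier A. \<forall>b\<in>carrier A. f (himp A a b) = himp B (f a) (f b)}"

section \<open>Spectral spaces\<close>

definition CO :: "'x topology \<Rightarrow> 'x set set" where
  "CO X = {U. openin X U \<and> compactin X U}"

definition irreducible_closedin :: "'x topology \<Rightarrow> 'x set \<Rightarrow> bool" where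
  "irreducible_closedin X F \<longleftrightarrow> closedin X F \<and> F \<noteq> {} \<and>
     (\<forall>G H. closedin X G \<and> closedin X H \<and> F = G \<union> H \<longrightarrow> F = G \<or> F = H)"

definition sober_space :: "'x topology \<Rightarrow> bool" where
  "sober_space X \<longleftrightarrow>
     (\<forall>F. irreducible_closedin X F \<longrightarrow> (\<exists>!x. x \<in> topspace X \<and> F = X closure_of {x}))"

text \<open>As usual for spectral spaces, the basis of compact opens is required to be closed under
  binary intersections (the empty intersection is covered by compactness). Without this,
  \<open>CO X\<close> need not be a lattice: take the discrete space \<open>\<nat>\<close> with two
  additional points \<open>p\<close>, \<open>q\<close> whose least neighbourhoods are
  \<open>\<nat> \<union> {p}\<close> and \<open>\<nat> \<union> {q}\<close>.\<close>

definition spectral_space :: "'x topology \<Rightarrow> bool" where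
  "spectral_space X \<longleftrightarrow> sober_space X \<and> compact_space X \<and>
     (\<forall>U. openin X U \<longrightarrow> (\<exists>\<V>. \<V> \<subseteq> CO X \<and> U = \<Union>\<V>)) \<and>
     (\<forall>U\<in>CO X. \<forall>V\<in>CO X. U \<inter> V \<in> CO X)"

definition spectral_map :: "'x topology \<Rightarrow> 'y topology \<Rightarrow> ('x \<Rightarrow> 'y) \<Rightarrow> bool" where
  "spectral_map X Y f \<longleftrightarrow> spectral_space X \<and> spectral_space Y \<and> continuous_map X Y f \<and>
     (\<forall>V\<in>CO Y. {x \<in> topspace X. f x \<in> V} \<in> CO X)"

definition spectral_subset :: "'x topology \<Rightarrow> 'x set \<Rightarrow> bool" where
  "spectral_subset X Y \<longleftrightarrow> Y \<subseteq> topspace X \<and> spectral_map (subtopology X Y) X id"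

definition doubly_spectral :: "'x topology \<Rightarrow> 'x set \<Rightarrow> bool" where
  "doubly_spectral X Y \<longleftrightarrow> spectral_subset X Y \<and> spectral_subset X (topspace X - Y)"

definition saturated_in :: "'x topology \<Rightarrow> 'x set \<Rightarrow> bool" where
  "saturated_in X S \<longleftrightarrow> (\<exists>\<U>. (\<forall>U\<in>\<U>. openin X U) \<and> S = topspace X \<inter> \<Inter>\<U>)"

definition co_saturated_in :: "'x topology \<Rightarrow> 'x set \<Rightarrow> bool" where
  "co_saturated_in X S \<longleftrightarrow> (\<exists>\<F>. (\<forall>F\<in>\<F>. closedin X F) \<and> S = \<Union>\<F>)"

definition Sat :: "'x topology \<Rightarrow> 'x \<Rightarrow> 'x set" where
  "Sat X x = \<Inter>{U. openin X U \<and> x \<in> U}"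

definition heyting_spectral_space :: "'x topology \<Rightarrow> bool" where
  "heyting_spectral_space X \<longleftrightarrow> spectral_space X \<and>
     (\<forall>Y. doubly_spectral X Y \<longrightarrow> doubly_spectral X (X closure_of Y))"

definition heyting_spectral_map :: "'x topology \<Rightarrow> 'y topology \<Rightarrow> ('x \<Rightarrow> 'y) \<Rightarrow> bool" where
  "heyting_spectral_map X Y f \<longleftrightarrow>
     heyting_spectral_space X \<and> heyting_spectral_space Y \<and> spectral_map X Y f \<and>
     (\<forall>x\<in>topspace X. f ` Sat X x = Sat Y (f x))"

section \<open>Nabla-spectral spaces\<close>

record 'x nabla_space =
  Top :: "'x topology"
  Rel :: "('x \<times> 'x) set"

abbreviation pts :: "'x nabla_space \<Rightarrow> 'x set" where
  "pts S \<equiv> topspace (Top S)"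

definition lozenge_rel :: "('x \<times> 'x) set \<Rightarrow> 'x set \<Rightarrow> 'x set" where
  "lozenge_rel R Y = {x. \<exists>y\<in>Y. (x, y) \<in> R}"

definition nabla_rel :: "('x \<times> 'x) set \<Rightarrow> 'x set \<Rightarrow> 'x set" where
  "nabla_rel R U = {x. \<exists>y\<in>U. (y, x) \<in> R}"

definition arrow_rel :: "'x nabla_space \<Rightarrow> 'x set \<Rightarrow> 'x set \<Rightarrow> 'x set" where
  "arrow_rel S U V = {x \<in> pts S. {y. (x, y) \<in> Rel S} \<inter> U \<subseteq> V}"

definition nabla_spectral_space :: "'x nabla_space \<Rightarrow> bool" where
  "nabla_spectral_space S \<longleftrightarrow>
     spectral_space (Top S) \<and>
     Rel S \<subseteq> pts S \<times> pts S \<and>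
     (\<forall>x\<in>pts S. compactin (Top S) {y. (x, y) \<in> Rel S} \<and>
                 saturated_in (Top S) {y. (x, y) \<in> Rel S}) \<and>
     (\<forall>y\<in>pts S. co_saturated_in (Top S) {x. (x, y) \<in> Rel S}) \<and>
     (\<forall>Y. doubly_spectral (Top S) Y \<longrightarrow> doubly_spectral (Top S) (lozenge_rel (Rel S) Y)) \<and>
     (\<forall>V\<in>CO (Top S). nabla_rel (Rel S) V \<in> CO (Top S))"

fun space_satisfies :: "'x nabla_space \<Rightarrow> nabla_cond \<Rightarrow> bool" where
  "space_satisfies S CN \<longleftrightarrow>
     (\<exists>\<pi>. continuous_map (Top S) (Top S) \<pi> \<and>
        (\<forall>x\<in>pts S. \<forall>y\<in>pts S. (x, y) \<in> Rel S \<longleftrightarrow> x \<in> Top S closure_of {\<pi> y}))"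
| "space_satisfies S CH \<longleftrightarrow> heyting_spectral_space (Top S)"
| "space_satisfies S CR \<longleftrightarrow> (\<forall>x\<in>pts S. (x, x) \<in> Rel S)"
| "space_satisfies S CL \<longleftrightarrow> (\<forall>(x, y)\<in>Rel S. x \<in> Top S closure_of {y})"
| "space_satisfies S CFa \<longleftrightarrow>
     (\<forall>x\<in>pts S. \<exists>y. (y, x) \<in> Rel S \<and>
        (\<forall>z. (y, z) \<in> Rel S \<longrightarrow> x \<in> Top S closure_of {z}))"
| "space_satisfies S CFu \<longleftrightarrow>
     (\<forall>x\<in>pts S. \<exists>y. (x, y) \<in> Rel S \<and>
        (\<forall>z. (z, y) \<in> Rel S \<longrightarrow> z \<in> Top S closure_of {x}))"

definition Spec :: "nabla_cond set \<Rightarrow> 'x nabla_space set" where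
  "Spec C = {S. nabla_spectral_space S \<and> (\<forall>c\<in>C. space_satisfies S c)}"

definition SpecH :: "nabla_cond set \<Rightarrow> 'x nabla_space set" where
  "SpecH C = {S \<in> Spec C. heyting_spectral_space (Top S)}"

definition spec_hom :: "'x nabla_space \<Rightarrow> 'y nabla_space \<Rightarrow> ('x \<Rightarrow> 'y) set" where
  "spec_hom S T = {f \<in> pts S \<rightarrow>\<^sub>E pts T.
     spectral_map (Top S) (Top T) f \<and>
     (\<forall>x z. (x, z) \<in> Rel S \<longrightarrow> (f x, f z) \<in> Rel T) \<and>
     (\<forall>x\<in>pts S. \<forall>y. (f x, y) \<in> Rel T \<longrightarrow> (\<exists>z. (x, z) \<in> Rel S \<and> f z = y)) \<and>
     (\<forall>x\<in>pts S. \<forall>y. (y, f x) \<in> Rel T \<longrightarrow>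
        (\<exists>z. (z, x) \<in> Rel S \<and> y \<in> Top T closure_of {f z}))}"

definition specH_hom :: "'x nabla_space \<Rightarrow> 'y nabla_space \<Rightarrow> ('x \<Rightarrow> 'y) set" where
  "specH_hom S T = {f \<in> spec_hom S T. heyting_spectral_map (Top S) (Top T) f}"

section \<open>The functors and the natural isomorphisms\<close>

definition prime_filters :: "('a, 'm) gorder_scheme \<Rightarrow> 'a set set" where
  "prime_filters L = {P. P \<subseteq> carrier L \<and> \<top>\<^bsub>L\<^esub> \<in> P \<and> \<bottom>\<^bsub>L\<^esub> \<notin> P \<and>
     (\<forall>a\<in>P. \<forall>b\<in>carrier L. a \<sqsubseteq>\<^bsub>L\<^esub> b \<longrightarrow> b \<in> P) \<and>
     (\<forall>a\<in>P. \<forall>b\<in>P. a \<sqinter>\<^bsub>L\<^esub> b \<in> P) \<and>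
     (\<forall>a\<in>carrier L. \<forall>b\<in>carrier L. a \<squnion>\<^bsub>L\<^esub> b \<in> P \<longrightarrow> a \<in> P \<or> b \<in> P)}"

definition spec_obj :: "('a, 'm) nabla_alg_scheme \<Rightarrow> 'a set nabla_space" where
  "spec_obj A =
     \<lparr> Top = topology_generated_by {{P \<in> prime_filters A. a \<in> P} | a. a \<in> carrier A},
       Rel = {(P, Q). P \<in> prime_filters A \<and> Q \<in> prime_filters A \<and> nab A ` P \<subseteq> Q} \<rparr>"

text \<open>For \<open>f : A \<rightarrow> B\<close>, \<open>spec_mor A B f\<close> goes from
  \<open>spec_obj B\<close> to \<open>spec_obj A\<close>; likewise for \<open>alg_mor\<close> below.\<close>

definition spec_mor ::
  "('a, 'm) nabla_alg_scheme \<Rightarrow> ('b, 'n) nabla_alg_scheme \<Rightarrow> ('a \<Rightarrow> 'b) \<Rightarrow> 'b set \<Rightarrow> 'a set" where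
  "spec_mor A B f = (\<lambda>Q\<in>prime_filters B. {a \<in> carrier A. f a \<in> Q})"

definition alg_obj :: "'x nabla_space \<Rightarrow> 'x set nabla_alg" where
  "alg_obj S = \<lparr> carrier = CO (Top S), eq = (=), le = (\<subseteq>),
     nab = nabla_rel (Rel S), arr = arrow_rel S \<rparr>"

definition algH_obj :: "'x nabla_space \<Rightarrow> 'x set heyting_nabla_alg" where
  "algH_obj S = \<lparr> carrier = CO (Top S), eq = (=), le = (\<subseteq>),
     nab = nabla_rel (Rel S), arr = arrow_rel S, himp = heyting_imp (alg_obj S) \<rparr>"

definition alg_mor ::
  "'x nabla_space \<Rightarrow> 'y nabla_space \<Rightarrow> ('x \<Rightarrow> 'y) \<Rightarrow> 'y set \<Rightarrow> 'x set" where
  "alg_mor S T f = (\<lambda>V\<in>CO (Top T). {x \<in> pts S. f x \<in> V})"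

definition alpha :: "('a, 'm) nabla_alg_scheme \<Rightarrow> 'a \<Rightarrow> 'a set set" where
  "alpha A = (\<lambda>a\<in>carrier A. {P \<in> prime_filters A. a \<in> P})"

definition beta :: "'x nabla_space \<Rightarrow> 'x \<Rightarrow> 'x set set" where
  "beta S = (\<lambda>x\<in>pts S. {U \<in> CO (Top S). x \<in> U})"

text \<open>\<open>f\<close> has a two-sided inverse, where \<open>F\<close> is the hom-set from an object with
  underlying set \<open>A\<close> to one with underlying set \<open>B\<close>, and \<open>G\<close> the hom-set
  in the opposite direction.\<close>

definition iso_arrow ::
  "('a \<Rightarrow> 'b) set \<Rightarrow> ('b \<Rightarrow> 'a) set \<Rightarrow> 'a set \<Rightarrow> 'b set \<Rightarrow> ('a \<Rightarrow> 'b) \<Rightarrow> bool" where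
  "iso_arrow F G A B f \<longleftrightarrow> f \<in> F \<and>
     (\<exists>g\<in>G. compose A g f = (\<lambda>x\<in>A. x) \<and> compose B f g = (\<lambda>y\<in>B. y))"

end

theory Submission
  imports Defs "HOL-Algebra.Galois_Connection"
begin

text \<open>Everything rests on two uses of the prime filter theorem. First, it makes the patch topology
  of a spectral space (generated by the compact opens and their complements) compact Hausdorff; hence
  the spectral subsets are the patch-closed ones, the doubly spectral subsets are the finite unions of
  differences of compact opens, and a doubly spectral set that is closed under generalization is
  compact open. Since \<open>U \<rightarrow> V\<close> is the complement of
  \<open>\<lozenge>(U - V)\<close> and the Heyting implication is the complement of the closure of
  \<open>U - V\<close>, the conditions on doubly spectral sets say exactly that these operations preserve
  compact opens. Second, it produces the prime filters that the relational conditions ask for: the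
  filter is generated by what the new prime filter has to contain, the ideal consists of what it has
  to avoid, and the adjunction between \<open>\<nabla>\<close> and \<open>\<rightarrow>\<close> shows that
  they are disjoint. The relation of a nabla-spectral space is recovered from its compact opens
  because \<open>R[x]\<close> is compact saturated: if \<open>y\<close> is not in \<open>R[x]\<close>, some
  compact open \<open>W\<close> contains \<open>R[x]\<close> but not \<open>y\<close>, and then
  \<open>x \<in> \<box>W\<close> while \<open>y \<notin> \<nabla>\<box>W\<close>.\<close>

section \<open>Prime filters of distributive lattices\<close>

definition down_directed :: "('a, 'm) gorder_scheme \<Rightarrow> 'a set \<Rightarrow> bool" where
  "down_directed L K \<longleftrightarrow> K \<subseteq> carrier L \<and> K \<noteq> {} \<and>
     (\<forall>x\<in>K. \<forall>y\<in>K. \<exists>z\<in>K. z \<sqsubseteq>\<^bsub>L\<^esub> x \<and> z \<sqsubseteq>\<^bsub>L\<^esub> y)"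

definition up_directed :: "('a, 'm) gorder_scheme \<Rightarrow> 'a set \<Rightarrow> bool" where
  "up_directed L I \<longleftrightarrow> I \<subseteq> carrier L \<and> I \<noteq> {} \<and>
     (\<forall>x\<in>I. \<forall>y\<in>I. \<exists>z\<in>I. x \<sqsubseteq>\<^bsub>L\<^esub> z \<and> y \<sqsubseteq>\<^bsub>L\<^esub> z)"

definition lattice_filter :: "('a, 'm) gorder_scheme \<Rightarrow> 'a set \<Rightarrow> bool" where
  "lattice_filter L F \<longleftrightarrow> F \<subseteq> carrier L \<and> F \<noteq> {} \<and>
     (\<forall>a\<in>F. \<forall>b\<in>carrier L. a \<sqsubseteq>\<^bsub>L\<^esub> b \<longrightarrow> b \<in> F) \<and> (\<forall>a\<in>F. \<forall>b\<in>F. a \<sqinter>\<^bsub>L\<^esub> b \<in> F)"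

definition filter_generated :: "('a, 'm) gorder_scheme \<Rightarrow> 'a set \<Rightarrow> 'a set" where
  "filter_generated L K = {x \<in> carrier L. \<exists>k\<in>K. k \<sqsubseteq>\<^bsub>L\<^esub> x}"

lemma down_directed_lower_bound:
  assumes "down_directed L K" "x \<in> K" "y \<in> K"
  obtains z where "z \<in> K" "z \<sqsubseteq>\<^bsub>L\<^esub> x" "z \<sqsubseteq>\<^bsub>L\<^esub> y"
  using assms unfolding down_directed_def by meson

lemma up_directed_iff_down_directed_inv_gorder:
  "up_directed L I \<longleftrightarrow> down_directed (inv_gorder L) I"
  by (simp add: up_directed_def down_directed_def)

lemma up_directed_upper_bound:
  assumes "up_directed L I" "x \<in> I" "y \<in> I"
  obtains z where "z \<in> I" "x \<sqsubseteq>\<^bsub>L\<^esub> z" "y \<sqsubseteq>\<^bsub>L\<^esub> z"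
  using assms unfolding up_directed_def by meson

lemma down_directed_image:
  assumes K: "down_directed L K" and isotone: "isotone L M h" and closed: "h \<in> carrier L \<rightarrow> carrier M"
  shows "down_directed M (h ` K)"
  unfolding down_directed_def
proof (intro conjI ballI)
  show "h ` K \<subseteq> carrier M" "h ` K \<noteq> {}"
    using K closed by (auto simp: down_directed_def)
  fix u v assume "u \<in> h ` K" "v \<in> h ` K"
  then obtain x y where xy: "x \<in> K" "u = h x" "y \<in> K" "v = h y" by blast
  obtain z where "z \<in> K" "z \<sqsubseteq>\<^bsub>L\<^esub> x" "z \<sqsubseteq>\<^bsub>L\<^esub> y"
    using down_directed_lower_bound[OF K xy(1,3)] .
  then show "\<exists>w\<in>h ` K. w \<sqsubseteq>\<^bsub>M\<^esub> u \<and> w \<sqsubseteq>\<^bsub>M\<^esub> v"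
    using xy K use_iso2[OF isotone] by (intro bexI[of _ "h z"]) (auto simp: down_directed_def subset_iff)
qed

lemma up_directed_image:
  assumes I: "up_directed L I" and isotone: "isotone L M h" and closed: "h \<in> carrier L \<rightarrow> carrier M"
  shows "up_directed M (h ` I)"
proof -
  have "isotone (inv_gorder L) (inv_gorder M) h"
    using isotone by (simp add: isotone_def dual_weak_order_iff)
  then show ?thesis
    using down_directed_image[of "inv_gorder L" I "inv_gorder M" h] I closed
    by (simp add: up_directed_iff_down_directed_inv_gorder)
qed

context Lattice.bounded_lattice
begin

text \<open>As introduction rules these send the classical reasoner into endless transitivity chains.\<close>

declare le_antisym [rule del] weak_refl [rule del] le_cong_l [rule del] le_cong_r [rule del]

lemma meet_mono:
  assumes "a \<sqsubseteq> a'" "b \<sqsubseteq> b'"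
    and "a \<in> carrier L" "a' \<in> carrier L" "b \<in> carrier L" "b' \<in> carrier L"
  shows "a \<sqinter> b \<sqsubseteq> a' \<sqinter> b'"
proof (rule meet_le)
  show "a \<sqinter> b \<sqsubseteq> a'"
    by (rule le_trans[OF meet_left]) (use assms in auto)
  show "a \<sqinter> b \<sqsubseteq> b'"
    by (rule le_trans[OF meet_right]) (use assms in auto)
qed (use assms in auto)

lemma meet_top: "a \<in> carrier L \<Longrightarrow> a \<sqinter> \<top> = a"
  using le_iff_join[of a \<top>] by simp

lemma down_directed_singleton: "a \<in> carrier L \<Longrightarrow> down_directed L {a}"
  and up_directed_singleton: "a \<in> carrier L \<Longrightarrow> up_directed L {a}"
  by (simp_all add: down_directed_def up_directed_def)

lemma down_directed_meets:
  assumes K: "down_directed L K" and M: "down_directed L M"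
  shows "down_directed L {x \<sqinter> y | x y. x \<in> K \<and> y \<in> M}"
proof -
  have carrier: "K \<subseteq> carrier L" "M \<subseteq> carrier L"
    using K M by (auto simp: down_directed_def)
  show ?thesis
    unfolding down_directed_def
  proof (intro conjI ballI)
    show "{x \<sqinter> y | x y. x \<in> K \<and> y \<in> M} \<subseteq> carrier L" "{x \<sqinter> y | x y. x \<in> K \<and> y \<in> M} \<noteq> {}"
      using K M carrier by (auto simp: down_directed_def intro!: meet_closed)
    fix u v assume "u \<in> {x \<sqinter> y | x y. x \<in> K \<and> y \<in> M}" "v \<in> {x \<sqinter> y | x y. x \<in> K \<and> y \<in> M}"
    then obtain x y x' y' where u: "u = x \<sqinter> y" "x \<in> K" "y \<in> M" and v: "v = x' \<sqinter> y'" "x' \<in> K" "y' \<in> M"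
      by blast
    obtain x'' where x'': "x'' \<in> K" "x'' \<sqsubseteq> x" "x'' \<sqsubseteq> x'"
      using down_directed_lower_bound[OF K u(2) v(2)] .
    obtain y'' where y'': "y'' \<in> M" "y'' \<sqsubseteq> y" "y'' \<sqsubseteq> y'"
      using down_directed_lower_bound[OF M u(3) v(3)] .
    have "x'' \<sqinter> y'' \<sqsubseteq> u" "x'' \<sqinter> y'' \<sqsubseteq> v"
      unfolding u(1) v(1) by (rule meet_mono; use u v x'' y'' carrier in blast)+
    then show "\<exists>w\<in>{x \<sqinter> y | x y. x \<in> K \<and> y \<in> M}. w \<sqsubseteq> u \<and> w \<sqsubseteq> v"
      using x''(1) y''(1) by blast
  qed
qed

lemma lattice_filter_down_directed:
  assumes F: "lattice_filter L F"
  shows "down_directed L F"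
  unfolding down_directed_def
proof (intro conjI ballI)
  fix a b assume ab: "a \<in> F" "b \<in> F"
  then have "a \<in> carrier L" "b \<in> carrier L" "a \<sqinter> b \<in> F"
    using F by (auto simp: lattice_filter_def)
  then show "\<exists>c\<in>F. c \<sqsubseteq> a \<and> c \<sqsubseteq> b"
    using meet_left meet_right by blast
qed (use F in \<open>auto simp: lattice_filter_def\<close>)

lemma subset_filter_generated: "K \<subseteq> carrier L \<Longrightarrow> K \<subseteq> filter_generated L K"
  using le_refl by (auto simp: filter_generated_def)

lemma lattice_filter_generated:
  assumes K: "down_directed L K"
  shows "lattice_filter L (filter_generated L K)"
  unfolding lattice_filter_def
proof (intro conjI ballI impI)
  have carrier: "K \<subseteq> carrier L" using K by (simp add: down_directed_def)
  show "filter_generated L K \<subseteq> carrier L" by (auto simp: filter_generated_def)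
  show "filter_generated L K \<noteq> {}"
    using K subset_filter_generated[OF carrier] by (auto simp: down_directed_def)
  fix a assume "a \<in> filter_generated L K"
  then obtain k where k: "a \<in> carrier L" "k \<in> K" "k \<sqsubseteq> a" by (auto simp: filter_generated_def)
  show "b \<in> filter_generated L K" if "b \<in> carrier L" "a \<sqsubseteq> b" for b
    using that k carrier le_trans[of k a b] by (auto simp: filter_generated_def)
  fix b assume "b \<in> filter_generated L K"
  then obtain k' where k': "b \<in> carrier L" "k' \<in> K" "k' \<sqsubseteq> b" by (auto simp: filter_generated_def)
  obtain l where l: "l \<in> K" "l \<sqsubseteq> k" "l \<sqsubseteq> k'"
    using down_directed_lower_bound[OF K k(2) k'(2)] .
  have "l \<sqsubseteq> a" "l \<sqsubseteq> b"
    using le_trans[OF l(2) k(3)] le_trans[OF l(3) k'(3)] l(1) k k' carrier by auto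
  then have "l \<sqsubseteq> a \<sqinter> b" using meet_le l(1) k(1) k'(1) carrier by blast
  then show "a \<sqinter> b \<in> filter_generated L K"
    using l(1) k(1) k'(1) by (auto simp: filter_generated_def)
qed

lemma lattice_filter_Union_chain:
  assumes "\<C> \<noteq> {}" and chain: "subset.chain {F. lattice_filter L F} \<C>"
  shows "lattice_filter L (\<Union>\<C>)"
  unfolding lattice_filter_def
proof (intro conjI ballI impI)
  have filter: "lattice_filter L F" if "F \<in> \<C>" for F
    using chain that by (auto simp: subset_chain_def)
  show "\<Union>\<C> \<subseteq> carrier L" "\<Union>\<C> \<noteq> {}"
    using filter \<open>\<C> \<noteq> {}\<close> unfolding lattice_filter_def by blast+
  show "b \<in> \<Union>\<C>" if "a \<in> \<Union>\<C>" "b \<in> carrier L" "a \<sqsubseteq> b" for a b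
    using filter that unfolding lattice_filter_def by blast
  fix a b assume "a \<in> \<Union>\<C>" "b \<in> \<Union>\<C>"
  then obtain F G where FG: "F \<in> \<C>" "a \<in> F" "G \<in> \<C>" "b \<in> G" by blast
  then have "F \<subseteq> G \<or> G \<subseteq> F" using chain by (auto simp: subset_chain_def)
  then obtain E where "E \<in> \<C>" "a \<in> E" "b \<in> E" using FG by blast
  then show "a \<sqinter> b \<in> \<Union>\<C>" using filter unfolding lattice_filter_def by blast
qed

lemma lattice_filter_adjoin:
  assumes F: "lattice_filter L F" and a: "a \<in> carrier L"
  defines "G \<equiv> filter_generated L {p \<sqinter> a | p. p \<in> F}"
  shows "lattice_filter L G" "F \<subseteq> G" "a \<in> G"
proof -
  have "{p \<sqinter> q | p q. p \<in> F \<and> q \<in> {a}} = {p \<sqinter> a | p. p \<in> F}" by blast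
  then have "down_directed L {p \<sqinter> a | p. p \<in> F}"
    using down_directed_meets[OF lattice_filter_down_directed[OF F] down_directed_singleton[OF a]]
    by simp
  then show "lattice_filter L G" unfolding G_def by (rule lattice_filter_generated)
  have carrier: "F \<subseteq> carrier L" and "F \<noteq> {}" using F by (auto simp: lattice_filter_def)
  show "F \<subseteq> G"
    using carrier a meet_left unfolding G_def filter_generated_def by blast
  show "a \<in> G"
    using carrier \<open>F \<noteq> {}\<close> a meet_right unfolding G_def filter_generated_def by blast
qed

lemma prime_filterI:
  assumes F: "lattice_filter L P" and "\<bottom> \<notin> P"
    and "\<And>a b. a \<in> carrier L \<Longrightarrow> b \<in> carrier L \<Longrightarrow> a \<squnion> b \<in> P \<Longrightarrow> a \<in> P \<or> b \<in> P"
  shows "P \<in> prime_filters L"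
proof -
  have "\<top> \<in> P" using F top_higher unfolding lattice_filter_def by blast
  then show ?thesis using assms unfolding prime_filters_def lattice_filter_def by blast
qed

context
  fixes P assumes P: "P \<in> prime_filters L"
begin

lemma prime_filter_carrier: "a \<in> P \<Longrightarrow> a \<in> carrier L"
  using P by (auto simp: prime_filters_def)

lemma prime_filter_top: "\<top> \<in> P" and prime_filter_bottom: "\<bottom> \<notin> P"
  using P by (auto simp: prime_filters_def)

lemma prime_filter_upward: "a \<in> P \<Longrightarrow> a \<sqsubseteq> b \<Longrightarrow> b \<in> carrier L \<Longrightarrow> b \<in> P"
  using P by (auto simp: prime_filters_def)

lemma prime_filter_lattice_filter: "lattice_filter L P"
  using P unfolding prime_filters_def lattice_filter_def by blast

lemma prime_filter_down_directed: "down_directed L P"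
  by (rule lattice_filter_down_directed[OF prime_filter_lattice_filter])

lemma prime_filter_meet_iff:
  assumes "a \<in> carrier L" "b \<in> carrier L"
  shows "a \<sqinter> b \<in> P \<longleftrightarrow> a \<in> P \<and> b \<in> P"
proof
  show "a \<in> P \<and> b \<in> P" if "a \<sqinter> b \<in> P"
    using prime_filter_upward[OF that meet_left] prime_filter_upward[OF that meet_right] assms by simp
  show "a \<sqinter> b \<in> P" if "a \<in> P \<and> b \<in> P"
    using prime_filter_lattice_filter that by (simp add: lattice_filter_def)
qed

lemma prime_filter_join_iff:
  assumes "a \<in> carrier L" "b \<in> carrier L"
  shows "a \<squnion> b \<in> P \<longleftrightarrow> a \<in> P \<or> b \<in> P"
proof
  show "a \<in> P \<or> b \<in> P" if "a \<squnion> b \<in> P"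
    using P that assms by (auto simp: prime_filters_def)
  show "a \<squnion> b \<in> P" if "a \<in> P \<or> b \<in> P"
    using that prime_filter_upward[OF _ join_left] prime_filter_upward[OF _ join_right] assms by auto
qed

lemma prime_filter_Compl_up_directed: "up_directed L (carrier L - P)"
  unfolding up_directed_def
proof (intro conjI ballI)
  show "carrier L - P \<noteq> {}" using prime_filter_bottom by blast
  fix a b assume "a \<in> carrier L - P" "b \<in> carrier L - P"
  then show "\<exists>c\<in>carrier L - P. a \<sqsubseteq> c \<and> b \<sqsubseteq> c"
    by (intro bexI[of _ "a \<squnion> b"]) (auto simp: prime_filter_join_iff join_left join_right)
qed blast

end

end

locale distrib_bounded_lattice = Lattice.bounded_lattice L for L (structure) +
  assumes distributive: "distributive L"
begin

lemma meet_join_distrib: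
  assumes "a \<in> carrier L" "b \<in> carrier L" "c \<in> carrier L"
  shows "a \<sqinter> (b \<squnion> c) = (a \<sqinter> b) \<squnion> (a \<sqinter> c)"
  using distributive assms unfolding distributive_def by blast

lemma meet_join_le:
  assumes "p \<sqinter> a \<sqsubseteq> l" "q \<sqinter> b \<sqsubseteq> l"
    and closed: "p \<in> carrier L" "q \<in> carrier L" "a \<in> carrier L" "b \<in> carrier L" "l \<in> carrier L"
  shows "(p \<sqinter> q) \<sqinter> (a \<squnion> b) \<sqsubseteq> l"
proof -
  have "(p \<sqinter> q) \<sqinter> a \<sqsubseteq> l"
    by (rule le_trans[OF meet_mono[OF meet_left] assms(1)]) (use closed in auto)
  moreover have "(p \<sqinter> q) \<sqinter> b \<sqsubseteq> l"
    by (rule le_trans[OF meet_mono[OF meet_right] assms(2)]) (use closed in auto)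
  ultimately show ?thesis
    using closed by (simp add: meet_join_distrib join_le)
qed

lemma maximal_filter_prime:
  assumes F: "lattice_filter L F" "F \<inter> I = {}" and I: "up_directed L I"
    and maximal: "\<And>G. lattice_filter L G \<Longrightarrow> F \<subseteq> G \<Longrightarrow> G \<inter> I = {} \<Longrightarrow> G = F"
  shows "F \<in> prime_filters L"
proof (rule prime_filterI[OF F(1)])
  have F_carrier: "F \<subseteq> carrier L" and I_carrier: "I \<subseteq> carrier L"
    using F I by (auto simp: lattice_filter_def up_directed_def)
  have upward: "b \<in> F" if "a \<in> F" "a \<sqsubseteq> b" "b \<in> carrier L" for a b
    using F(1) that unfolding lattice_filter_def by blast
  show "\<bottom> \<notin> F"
    using upward I_carrier I F(2) bottom_lower unfolding up_directed_def by blast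
  have meets_ideal: "\<exists>p\<in>F. \<exists>i\<in>I. p \<sqinter> a \<sqsubseteq> i" if "a \<in> carrier L" "a \<notin> F" for a
  proof (rule ccontr)
    let ?G = "filter_generated L {p \<sqinter> a | p. p \<in> F}"
    assume "\<not> ?thesis"
    then have "?G \<inter> I = {}" by (auto simp: filter_generated_def)
    then have "?G = F" using maximal lattice_filter_adjoin[OF F(1) that(1)] by blast
    then show False using lattice_filter_adjoin(3)[OF F(1) that(1)] that(2) by simp
  qed
  fix a b assume ab: "a \<in> carrier L" "b \<in> carrier L" "a \<squnion> b \<in> F"
  show "a \<in> F \<or> b \<in> F"
  proof (rule ccontr)
    assume "\<not> ?thesis"
    then obtain p i q j where pi: "p \<in> F" "i \<in> I" "p \<sqinter> a \<sqsubseteq> i" and qj: "q \<in> F" "j \<in> I" "q \<sqinter> b \<sqsubseteq> j"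
      using meets_ideal ab by meson
    obtain l where l: "l \<in> I" "i \<sqsubseteq> l" "j \<sqsubseteq> l"
      using up_directed_upper_bound[OF I pi(2) qj(2)] .
    have carrier: "p \<in> carrier L" "q \<in> carrier L" "i \<in> carrier L" "j \<in> carrier L" "l \<in> carrier L"
      using pi qj l F_carrier I_carrier by auto
    have "p \<sqinter> a \<sqsubseteq> l" "q \<sqinter> b \<sqsubseteq> l"
      using carrier ab le_trans[OF pi(3) l(2)] le_trans[OF qj(3) l(3)] by auto
    then have "(p \<sqinter> q) \<sqinter> (a \<squnion> b) \<sqsubseteq> l"
      using carrier ab by (intro meet_join_le)
    moreover have "(p \<sqinter> q) \<sqinter> (a \<squnion> b) \<in> F"
      using F(1) pi qj ab unfolding lattice_filter_def by blast
    ultimately have "l \<in> F" using upward carrier by blast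
    then show False using F(2) l by blast
  qed
qed

theorem prime_filter_separation:
  assumes K: "down_directed L K" and I: "up_directed L I"
    and separated: "\<And>k i. k \<in> K \<Longrightarrow> i \<in> I \<Longrightarrow> \<not> k \<sqsubseteq> i"
  obtains P where "P \<in> prime_filters L" "K \<subseteq> P" "P \<inter> I = {}"
proof -
  define \<F> where "\<F> = {F. lattice_filter L F \<and> K \<subseteq> F \<and> F \<inter> I = {}}"
  have "filter_generated L K \<in> \<F>"
    using lattice_filter_generated[OF K] subset_filter_generated K separated
    by (auto simp: \<F>_def down_directed_def filter_generated_def)
  then have "\<exists>P\<in>\<F>. \<forall>G\<in>\<F>. P \<subseteq> G \<longrightarrow> G = P"
  proof (intro subset_Zorn_nonempty)
    fix \<C> assume "\<C> \<noteq> {}" and chain: "subset.chain \<F> \<C>"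
    then have "subset.chain {F. lattice_filter L F} \<C>"
      by (auto simp: subset_chain_def \<F>_def)
    then have "lattice_filter L (\<Union>\<C>)" using \<open>\<C> \<noteq> {}\<close> by (intro lattice_filter_Union_chain)
    moreover have "K \<subseteq> F \<and> F \<inter> I = {}" if "F \<in> \<C>" for F
      using chain that by (auto simp: subset_chain_def \<F>_def)
    then have "K \<subseteq> \<Union>\<C>" "\<Union>\<C> \<inter> I = {}"
      using \<open>\<C> \<noteq> {}\<close> by blast+
    ultimately show "\<Union>\<C> \<in> \<F>" by (simp add: \<F>_def)
  qed blast
  then obtain P where P: "P \<in> \<F>" and maximal: "\<And>G. G \<in> \<F> \<Longrightarrow> P \<subseteq> G \<Longrightarrow> G = P" by blast
  have "P \<in> prime_filters L"
  proof (rule maximal_filter_prime[OF _ _ I])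
    show "G = P" if "lattice_filter L G" "P \<subseteq> G" "G \<inter> I = {}" for G
      using that P by (intro maximal) (auto simp: \<F>_def)
  qed (use P in \<open>auto simp: \<F>_def\<close>)
  then show thesis using that P by (simp add: \<F>_def)
qed

corollary prime_filter_extension:
  assumes K: "down_directed L K" and M: "down_directed L M" and I: "up_directed L I"
    and separated: "\<And>k m i. k \<in> K \<Longrightarrow> m \<in> M \<Longrightarrow> i \<in> I \<Longrightarrow> \<not> k \<sqinter> m \<sqsubseteq> i"
  obtains P where "P \<in> prime_filters L" "K \<subseteq> P" "M \<subseteq> P" "P \<inter> I = {}"
proof -
  obtain P where P: "P \<in> prime_filters L" "{k \<sqinter> m | k m. k \<in> K \<and> m \<in> M} \<subseteq> P" "P \<inter> I = {}"
    by (rule prime_filter_separation[OF down_directed_meets[OF K M] I]) (use separated in auto)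
  have "k \<in> P \<and> m \<in> P" if "k \<in> K" "m \<in> M" for k m
  proof -
    have "k \<in> carrier L" "m \<in> carrier L"
      using K M that by (auto simp: down_directed_def)
    moreover have "k \<sqinter> m \<in> P" using P(2) that by blast
    ultimately show ?thesis by (simp add: prime_filter_meet_iff[OF P(1)])
  qed
  then show thesis using that[OF P(1) _ _ P(3)] K M by (auto simp: down_directed_def)
qed

end

section \<open>Spectral spaces and their lattices of compact opens\<close>

no_notation eq_closure_of ("closure'_of\<index>")

lemma CO_openin: "U \<in> CO X \<Longrightarrow> openin X U"
  and CO_compactin: "U \<in> CO X \<Longrightarrow> compactin X U"
  and CO_subset: "U \<in> CO X \<Longrightarrow> U \<subseteq> topspace X"
  by (auto simp: CO_def dest: openin_subset)

lemma CO_empty: "{} \<in> CO X"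
  by (simp add: CO_def)

lemma CO_Un: "U \<in> CO X \<Longrightarrow> V \<in> CO X \<Longrightarrow> U \<union> V \<in> CO X"
  by (simp add: CO_def compactin_Un openin_Un)

lemma CO_Union: "finite \<F> \<Longrightarrow> \<F> \<subseteq> CO X \<Longrightarrow> \<Union>\<F> \<in> CO X"
  by (induction rule: finite_induct) (auto simp: CO_empty CO_Un)

lemma compactin_base_cover:
  assumes "compactin X K" "K \<subseteq> U"
    and base: "\<And>x. x \<in> U \<Longrightarrow> \<exists>V\<in>\<B>. x \<in> V \<and> V \<subseteq> U" and openin: "\<And>V. V \<in> \<B> \<Longrightarrow> openin X V"
  obtains \<F> where "finite \<F>" "\<F> \<subseteq> \<B>" "K \<subseteq> \<Union>\<F>" "\<Union>\<F> \<subseteq> U"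
proof -
  have "K \<subseteq> \<Union>{V \<in> \<B>. V \<subseteq> U}" using assms(2) base by fastforce
  moreover have "\<forall>V\<in>{V \<in> \<B>. V \<subseteq> U}. openin X V" using openin by simp
  ultimately obtain \<F> where "finite \<F>" "\<F> \<subseteq> {V \<in> \<B>. V \<subseteq> U}" "K \<subseteq> \<Union>\<F>"
    using assms(1) unfolding compactin_def by meson
  then show thesis using that[of \<F>] by blast
qed

lemma in_closure_of_point_openin:
  "y \<in> X closure_of {x} \<Longrightarrow> openin X U \<Longrightarrow> y \<in> U \<Longrightarrow> x \<in> U"
  by (auto simp: in_closure_of)

lemma point_in_closure_of: "x \<in> topspace X \<Longrightarrow> x \<in> X closure_of {x}"
  by (simp add: in_closure_of)

lemma in_closure_of_point_trans:
  assumes "x \<in> X closure_of {y}" "y \<in> X closure_of {z}"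
  shows "x \<in> X closure_of {z}"
  using assms by (auto simp: in_closure_of)

lemma continuous_map_in_closure_of_point:
  assumes "continuous_map X Y f" "x \<in> X closure_of {y}"
  shows "f x \<in> Y closure_of {f y}"
  using continuous_map_image_closure_subset[OF assms(1), of "{y}"] assms(2) by auto

lemma in_Sat_iff:
  assumes "x \<in> topspace X"
  shows "y \<in> Sat X x \<longleftrightarrow> y \<in> topspace X \<and> x \<in> X closure_of {y}"
  using assms openin_topspace[of X] by (auto simp: Sat_def in_closure_of)

lemma co_saturated_in_iff:
  "co_saturated_in X S \<longleftrightarrow> S \<subseteq> topspace X \<and> (\<forall>x\<in>S. X closure_of {x} \<subseteq> S)"
proof
  assume "co_saturated_in X S"
  then obtain \<F> where \<F>: "\<forall>F\<in>\<F>. closedin X F" "S = \<Union>\<F>" by (auto simp: co_saturated_in_def)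
  have "X closure_of {x} \<subseteq> F" if "F \<in> \<F>" "x \<in> F" for x F
    using \<F>(1) that by (intro closure_of_minimal) auto
  then show "S \<subseteq> topspace X \<and> (\<forall>x\<in>S. X closure_of {x} \<subseteq> S)"
    using \<F> closedin_subset by blast
next
  assume S: "S \<subseteq> topspace X \<and> (\<forall>x\<in>S. X closure_of {x} \<subseteq> S)"
  then have "S = \<Union>((\<lambda>x. X closure_of {x}) ` S)" using point_in_closure_of[of _ X] by blast
  then show "co_saturated_in X S"
    unfolding co_saturated_in_def by (intro exI[of _ "(\<lambda>x. X closure_of {x}) ` S"]) auto
qed

lemma irreducible_closedin_meets_finite_Inter:
  assumes F: "irreducible_closedin X F" and "finite \<G>"
    and "\<And>U. U \<in> \<G> \<Longrightarrow> openin X U \<and> U \<inter> F \<noteq> {}"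
  shows "F \<inter> \<Inter>\<G> \<noteq> {}"
proof -
  \<comment> \<open>Otherwise the irreducible set is a finite union of proper closed subsets.\<close>
  have "\<exists>U\<in>\<G>. F = F - U" if "F \<subseteq> \<Union>((\<lambda>U. F - U) ` \<G>)" "finite \<G>" "\<And>U. U \<in> \<G> \<Longrightarrow> openin X U" for \<G>
    using that(2,1,3)
  proof (induction \<G> rule: finite_induct)
    case empty
    then show ?case using F by (simp add: irreducible_closedin_def)
  next
    case (insert U \<G>)
    let ?H = "\<Union>((\<lambda>U. F - U) ` \<G>)"
    have "closedin X F" using F by (simp add: irreducible_closedin_def)
    then have "closedin X (F - U)" using insert.prems(2) by (intro closedin_diff) auto
    moreover have "closedin X ?H"
      using \<open>closedin X F\<close> insert.hyps(1) insert.prems(2)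
      by (intro closedin_Union) auto
    moreover have "F = (F - U) \<union> ?H" using insert.prems(1) by blast
    ultimately have "F = F - U \<or> F = ?H" using F unfolding irreducible_closedin_def by blast
    then show ?case using insert.IH insert.prems(2) by auto
  qed
  from this[of \<G>] show ?thesis using assms(2,3) by blast
qed

lemma sober_spaceI:
  assumes T0: "\<And>x y. x \<in> topspace X \<Longrightarrow> y \<in> topspace X \<Longrightarrow>
      (\<And>U. openin X U \<Longrightarrow> x \<in> U \<longleftrightarrow> y \<in> U) \<Longrightarrow> x = y"
    and generic: "\<And>F. irreducible_closedin X F \<Longrightarrow>
      \<exists>x\<in>F. \<forall>U. openin X U \<longrightarrow> U \<inter> F \<noteq> {} \<longrightarrow> x \<in> U"
  shows "sober_space X"
  unfolding sober_space_def
proof (intro allI impI)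
  fix F assume F: "irreducible_closedin X F"
  then have closed: "closedin X F" by (simp add: irreducible_closedin_def)
  obtain x where x: "x \<in> F" "\<And>U. openin X U \<Longrightarrow> U \<inter> F \<noteq> {} \<Longrightarrow> x \<in> U"
    using generic[OF F] by blast
  have x_topspace: "x \<in> topspace X" using x(1) closedin_subset[OF closed] by blast
  have "F = X closure_of {x}"
  proof
    show "F \<subseteq> X closure_of {x}"
      using closedin_subset[OF closed] x(2) unfolding subset_iff in_closure_of by blast
    show "X closure_of {x} \<subseteq> F" using x(1) closed by (simp add: closure_of_minimal)
  qed
  moreover have "y = x" if y: "y \<in> topspace X" "F = X closure_of {y}" for y
  proof (rule T0)
    show "y \<in> U \<longleftrightarrow> x \<in> U" if "openin X U" for U
      using that x y point_in_closure_of[OF y(1)] in_closure_of_point_openin[of x X y U] by auto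
  qed (use x_topspace y in simp_all)
  ultimately show "\<exists>!x. x \<in> topspace X \<and> F = X closure_of {x}"
    using x_topspace by blast
qed

lemma spectral_spaceI:
  assumes topspace: "topspace X \<in> CO X"
    and Int: "\<And>U V. U \<in> CO X \<Longrightarrow> V \<in> CO X \<Longrightarrow> U \<inter> V \<in> CO X"
    and base: "\<And>U x. openin X U \<Longrightarrow> x \<in> U \<Longrightarrow> \<exists>V\<in>CO X. x \<in> V \<and> V \<subseteq> U"
    and T0: "\<And>x y. x \<in> topspace X \<Longrightarrow> y \<in> topspace X \<Longrightarrow> (\<And>U. U \<in> CO X \<Longrightarrow> x \<in> U \<longleftrightarrow> y \<in> U) \<Longrightarrow> x = y"
    and generic: "\<And>F. irreducible_closedin X F \<Longrightarrow> \<exists>x\<in>F. \<forall>U\<in>CO X. U \<inter> F \<noteq> {} \<longrightarrow> x \<in> U"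
  shows "spectral_space X"
  unfolding spectral_space_def
proof (intro conjI allI impI ballI)
  show "sober_space X"
  proof (rule sober_spaceI)
    fix F assume "irreducible_closedin X F"
    then obtain x where x: "x \<in> F" "\<And>V. V \<in> CO X \<Longrightarrow> V \<inter> F \<noteq> {} \<Longrightarrow> x \<in> V"
      using generic by meson
    have "x \<in> U" if U: "openin X U" "U \<inter> F \<noteq> {}" for U
    proof -
      obtain y where "y \<in> U" "y \<in> F" using U(2) by blast
      then obtain V where "V \<in> CO X" "y \<in> V" "V \<subseteq> U" using base[OF U(1)] by blast
      then show ?thesis using x(2)[of V] \<open>y \<in> F\<close> by blast
    qed
    then show "\<exists>x\<in>F. \<forall>U. openin X U \<longrightarrow> U \<inter> F \<noteq> {} \<longrightarrow> x \<in> U" using x(1) by blast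
  qed (rule T0; simp add: CO_openin)
  show "compact_space X" using topspace by (simp add: CO_def compact_space_def)
  show "\<exists>\<V>\<subseteq>CO X. U = \<Union>\<V>" if "openin X U" for U
    by (rule exI[of _ "{V \<in> CO X. V \<subseteq> U}"]) (use base[OF that] in blast)
qed (rule Int)

locale spectral =
  fixes X :: "'x topology"
  assumes spectral_space: "spectral_space X"
begin

lemma CO_Int: "U \<in> CO X \<Longrightarrow> V \<in> CO X \<Longrightarrow> U \<inter> V \<in> CO X"
  using spectral_space by (simp add: spectral_space_def)

lemma CO_topspace: "topspace X \<in> CO X"
  using spectral_space by (simp add: spectral_space_def CO_def compact_space_def)

lemma CO_finite_Inter: "finite \<F> \<Longrightarrow> \<F> \<subseteq> CO X \<Longrightarrow> topspace X \<inter> \<Inter>\<F> \<in> CO X"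
proof (induction rule: finite_induct)
  case (insert U \<F>)
  have "topspace X \<inter> \<Inter>(insert U \<F>) = U \<inter> (topspace X \<inter> \<Inter>\<F>)" by blast
  then show ?case using insert CO_Int by simp
qed (simp add: CO_topspace)

lemma CO_base:
  assumes "openin X U" "x \<in> U"
  shows "\<exists>V\<in>CO X. x \<in> V \<and> V \<subseteq> U"
proof -
  obtain \<V> where "\<V> \<subseteq> CO X" "U = \<Union>\<V>"
    using spectral_space assms(1) unfolding spectral_space_def by meson
  then show ?thesis using assms(2) by blast
qed

lemma openin_iff_CO_base: "openin X U \<longleftrightarrow> (\<forall>x\<in>U. \<exists>V\<in>CO X. x \<in> V \<and> V \<subseteq> U)"
proof
  show "openin X U" if "\<forall>x\<in>U. \<exists>V\<in>CO X. x \<in> V \<and> V \<subseteq> U"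
    using that CO_openin by (subst openin_subopen) blast
qed (use CO_base[of U] in blast)

lemma compactin_CO_interpolation:
  assumes "compactin X K" "K \<subseteq> U" "openin X U"
  obtains W where "W \<in> CO X" "K \<subseteq> W" "W \<subseteq> U"
proof -
  obtain \<F> where "finite \<F>" "\<F> \<subseteq> CO X" "K \<subseteq> \<Union>\<F>" "\<Union>\<F> \<subseteq> U"
    by (rule compactin_base_cover[OF assms(1,2) CO_base[OF assms(3)] CO_openin])
  then show thesis using that[of "\<Union>\<F>"] CO_Union[of \<F> X] by blast
qed

lemma in_closure_of_point_iff_CO:
  "x \<in> X closure_of {y} \<longleftrightarrow> x \<in> topspace X \<and> (\<forall>U\<in>CO X. x \<in> U \<longrightarrow> y \<in> U)"
proof
  show "x \<in> topspace X \<and> (\<forall>U\<in>CO X. x \<in> U \<longrightarrow> y \<in> U)" if "x \<in> X closure_of {y}"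
    using that CO_openin by (auto simp: in_closure_of)
  show "x \<in> X closure_of {y}" if x: "x \<in> topspace X \<and> (\<forall>U\<in>CO X. x \<in> U \<longrightarrow> y \<in> U)"
  proof -
    have "y \<in> T" if "x \<in> T" "openin X T" for T
      using CO_base[OF that(2,1)] x by blast
    then show ?thesis using x by (auto simp: in_closure_of)
  qed
qed

lemma CO_separates_points:
  assumes "x \<in> topspace X" "y \<in> topspace X" "\<And>U. U \<in> CO X \<Longrightarrow> x \<in> U \<longleftrightarrow> y \<in> U"
  shows "x = y"
proof -
  have closure_of_eq: "X closure_of {x} = X closure_of {y}"
    using assms by (auto simp: in_closure_of_point_iff_CO)
  have "irreducible_closedin X (X closure_of {x})"
    unfolding irreducible_closedin_def
  proof (intro conjI allI impI)
    fix G H assume GH: "closedin X G \<and> closedin X H \<and> X closure_of {x} = G \<union> H"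
    have "x \<in> G \<or> x \<in> H" using GH point_in_closure_of[OF assms(1)] by blast
    then have "X closure_of {x} \<subseteq> G \<or> X closure_of {x} \<subseteq> H"
      using GH closure_of_minimal[of "{x}" _ X] by auto
    then show "X closure_of {x} = G \<or> X closure_of {x} = H" using GH by blast
  qed (use point_in_closure_of[OF assms(1)] in auto)
  then have "\<exists>!z. z \<in> topspace X \<and> X closure_of {x} = X closure_of {z}"
    using spectral_space unfolding spectral_space_def sober_space_def by simp
  then show ?thesis using assms(1,2) closure_of_eq by metis
qed

lemma irreducible_closedinI:
  assumes closed: "closedin X F" and "F \<noteq> {}"
    and meets: "\<And>U V. U \<in> CO X \<Longrightarrow> V \<in> CO X \<Longrightarrow> U \<inter> F \<noteq> {} \<Longrightarrow> V \<inter> F \<noteq> {} \<Longrightarrow> U \<inter> V \<inter> F \<noteq> {}"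
  shows "irreducible_closedin X F"
  unfolding irreducible_closedin_def
proof (intro conjI allI impI)
  fix G H assume GH: "closedin X G \<and> closedin X H \<and> F = G \<union> H"
  have outside: "\<exists>U\<in>CO X. U \<inter> F \<noteq> {} \<and> U \<inter> G = {}" if G: "closedin X G" "\<not> F \<subseteq> G" for G
  proof -
    obtain x where "x \<in> F" "x \<in> topspace X - G"
      using G(2) closedin_subset[OF closed] by blast
    moreover have "openin X (topspace X - G)" using G(1) by blast
    ultimately show ?thesis using CO_base[of "topspace X - G" x] by blast
  qed
  show "F = G \<or> F = H"
  proof (rule ccontr)
    assume "\<not> ?thesis"
    then have "\<not> F \<subseteq> G" "\<not> F \<subseteq> H" using GH by blast+
    then obtain U V where "U \<in> CO X" "U \<inter> F \<noteq> {}" "U \<inter> G = {}" "V \<in> CO X" "V \<inter> F \<noteq> {}" "V \<inter> H = {}"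
      using outside GH by meson
    then show False using meets[of U V] GH by blast
  qed
qed (use assms in auto)

end

lemma spectral_mapI:
  assumes X: "spectral_space X" and Y: "spectral_space Y" and f: "f \<in> topspace X \<rightarrow> topspace Y"
    and CO: "\<And>V. V \<in> CO Y \<Longrightarrow> {x \<in> topspace X. f x \<in> V} \<in> CO X"
  shows "spectral_map X Y f"
proof -
  interpret X: spectral X by unfold_locales (rule X)
  interpret Y: spectral Y by unfold_locales (rule Y)
  have "openin X {x \<in> topspace X. f x \<in> U}" if U: "openin Y U" for U
    unfolding X.openin_iff_CO_base
  proof
    fix x assume x: "x \<in> {x \<in> topspace X. f x \<in> U}"
    then obtain V where V: "V \<in> CO Y" "f x \<in> V" "V \<subseteq> U" using Y.CO_base[OF U, of "f x"] by blast
    show "\<exists>W\<in>CO X. x \<in> W \<and> W \<subseteq> {x \<in> topspace X. f x \<in> U}"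
      by (rule bexI[OF _ CO[OF V(1)]]) (use x V in auto)
  qed
  then have "continuous_map X Y f" using f by (simp add: continuous_map_def)
  then show ?thesis using X Y CO by (simp add: spectral_map_def)
qed

lemma spectral_map_CO: "spectral_map X Y f \<Longrightarrow> V \<in> CO Y \<Longrightarrow> {x \<in> topspace X. f x \<in> V} \<in> CO X"
  and spectral_map_continuous_map: "spectral_map X Y f \<Longrightarrow> continuous_map X Y f"
  and spectral_map_closed: "spectral_map X Y f \<Longrightarrow> x \<in> topspace X \<Longrightarrow> f x \<in> topspace Y"
  by (auto simp: spectral_map_def continuous_map_def)

lemma spectral_map_id:
  assumes X: "spectral_space X"
  shows "spectral_map X X (\<lambda>x\<in>topspace X. x)"
proof (rule spectral_mapI[OF X X])
  fix V assume "V \<in> CO X"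
  moreover from this have "{x \<in> topspace X. (\<lambda>x\<in>topspace X. x) x \<in> V} = V" using CO_subset by auto
  ultimately show "{x \<in> topspace X. (\<lambda>x\<in>topspace X. x) x \<in> V} \<in> CO X" by simp
qed simp

lemma spectral_map_compose:
  assumes f: "spectral_map X Y f" and g: "spectral_map Y Z g"
  shows "spectral_map X Z (compose (topspace X) g f)"
proof (rule spectral_mapI)
  show "spectral_space X" "spectral_space Z" using f g by (simp_all add: spectral_map_def)
  show "compose (topspace X) g f \<in> topspace X \<rightarrow> topspace Z"
    using spectral_map_closed[OF f] spectral_map_closed[OF g] by (simp add: compose_def)
  fix V assume "V \<in> CO Z"
  then have "{x \<in> topspace X. f x \<in> {y \<in> topspace Y. g y \<in> V}} \<in> CO X"
    by (intro spectral_map_CO[OF f] spectral_map_CO[OF g])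
  moreover have "{x \<in> topspace X. f x \<in> {y \<in> topspace Y. g y \<in> V}} =
      {x \<in> topspace X. compose (topspace X) g f x \<in> V}"
    using spectral_map_closed[OF f] by (auto simp: compose_def)
  ultimately show "{x \<in> topspace X. compose (topspace X) g f x \<in> V} \<in> CO X" by simp
qed

locale compact_open_lattice = spectral X for X :: "'x topology" +
  fixes L :: "('x set, 'm) gorder_scheme"
  assumes carrier_CO: "carrier L = CO X" and eq_CO: "eq L = (=)" and le_CO: "le L = (\<subseteq>)"
begin

lemma partial_order_CO: "partial_order L"
  by unfold_locales (auto simp: eq_CO le_CO)

lemma least_Un: "U \<in> CO X \<Longrightarrow> V \<in> CO X \<Longrightarrow> least L (U \<union> V) (Upper L {U, V})"
  by (auto simp: least_def Upper_def carrier_CO le_CO CO_Un)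

lemma greatest_Int: "U \<in> CO X \<Longrightarrow> V \<in> CO X \<Longrightarrow> greatest L (U \<inter> V) (Lower L {U, V})"
  by (auto simp: greatest_def Lower_def carrier_CO le_CO CO_Int)

lemma greatest_topspace: "greatest L (topspace X) (carrier L)"
  using CO_subset by (auto simp: greatest_def carrier_CO le_CO CO_topspace)

lemma least_empty: "least L {} (carrier L)"
  by (auto simp: least_def carrier_CO le_CO CO_empty)

lemma bounded_lattice_CO: "Lattice.bounded_lattice L"
proof -
  interpret partial_order L by (rule partial_order_CO)
  show ?thesis
  proof unfold_locales
    show "\<exists>W. least L W (Upper L {U, V})" if "U \<in> carrier L" "V \<in> carrier L" for U V
      using least_Un that carrier_CO by blast
    show "\<exists>W. greatest L W (Lower L {U, V})" if "U \<in> carrier L" "V \<in> carrier L" for U V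
      using greatest_Int that carrier_CO by blast
    show "\<exists>U. least L U (carrier L)" using least_empty by blast
    show "\<exists>U. greatest L U (carrier L)" using greatest_topspace by blast
  qed
qed

sublocale Lattice.bounded_lattice L
  by (rule bounded_lattice_CO)

lemma meet_CO: "U \<in> CO X \<Longrightarrow> V \<in> CO X \<Longrightarrow> U \<sqinter>\<^bsub>L\<^esub> V = U \<inter> V"
  using greatest_unique[OF greatest_Int] inf_of_two_greatest[of U V]
  by (simp add: meet_def carrier_CO)

lemma join_CO: "U \<in> CO X \<Longrightarrow> V \<in> CO X \<Longrightarrow> U \<squnion>\<^bsub>L\<^esub> V = U \<union> V"
  using least_unique[OF least_Un] sup_of_two_least[of U V]
  by (simp add: join_def carrier_CO)

lemma top_CO: "\<top>\<^bsub>L\<^esub> = topspace X"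
  using greatest_unique[OF greatest_topspace top_greatest] by simp

lemma bottom_CO: "\<bottom>\<^bsub>L\<^esub> = {}"
  using least_unique[OF least_empty bottom_least] by simp

sublocale distrib_bounded_lattice L
  by unfold_locales (auto simp: distributive_def carrier_CO meet_CO join_CO CO_Un CO_Int)

lemma prime_filter_of_point:
  assumes "x \<in> topspace X"
  shows "{U \<in> CO X. x \<in> U} \<in> prime_filters L"
  using assms unfolding prime_filters_def
  by (auto simp: carrier_CO le_CO meet_CO join_CO top_CO bottom_CO CO_Int CO_topspace)

lemma prime_filter_finite_Union:
  assumes P: "P \<in> prime_filters L" and "finite \<F>" "\<F> \<subseteq> CO X" "\<Union>\<F> \<in> P"
  shows "\<exists>U\<in>\<F>. U \<in> P"
  using assms(2-)
proof (induction rule: finite_induct)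
  case empty
  then show ?case using prime_filter_bottom[OF P] by (simp add: bottom_CO)
next
  case (insert U \<F>)
  then have "U \<squnion>\<^bsub>L\<^esub> \<Union>\<F> \<in> P" by (simp add: join_CO CO_Union)
  then have "U \<in> P \<or> \<Union>\<F> \<in> P"
    using prime_filter_join_iff[OF P] insert by (simp add: carrier_CO CO_Union)
  then show ?case using insert by auto
qed

lemma prime_filter_cover:
  assumes P: "P \<in> prime_filters L" and "U \<in> P" "U \<subseteq> \<Union>\<V>" "\<V> \<subseteq> CO X"
  shows "\<exists>V\<in>\<V>. V \<in> P"
proof -
  have "compactin X U" using prime_filter_carrier[OF P assms(2)] by (simp add: carrier_CO CO_compactin)
  moreover have "\<forall>V\<in>\<V>. openin X V" using assms(4) CO_openin by blast
  ultimately obtain \<F> where \<F>: "finite \<F>" "\<F> \<subseteq> \<V>" "U \<subseteq> \<Union>\<F>"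
    using assms(3) unfolding compactin_def by meson
  then have "\<Union>\<F> \<in> CO X" using assms(4) by (intro CO_Union) auto
  then have "\<Union>\<F> \<in> P"
    using prime_filter_upward[OF P assms(2)] \<F>(3) by (simp add: carrier_CO le_CO)
  then show ?thesis using prime_filter_finite_Union[OF P \<F>(1)] \<F>(2) assms(4) by blast
qed

lemma prime_filter_point:
  assumes P: "P \<in> prime_filters L"
  obtains x where "x \<in> topspace X" "P = {U \<in> CO X. x \<in> U}"
proof -
  have P_CO: "P \<subseteq> CO X" using prime_filter_carrier[OF P] carrier_CO by blast
  \<comment> \<open>\<open>P\<close> is the trace on the compact opens of the neighbourhoods of the generic point of \<open>F\<close>.\<close>
  define F where "F = topspace X - \<Union>(CO X - P)"
  have P_iff: "U \<in> P \<longleftrightarrow> U \<inter> F \<noteq> {}" if U: "U \<in> CO X" for U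
  proof
    show "U \<inter> F \<noteq> {}" if "U \<in> P"
      using prime_filter_cover[OF P that, of "CO X - P"] CO_subset[OF U] unfolding F_def by blast
    show "U \<in> P" if "U \<inter> F \<noteq> {}" using that U unfolding F_def by blast
  qed
  have "irreducible_closedin X F"
  proof (rule irreducible_closedinI)
    show "closedin X F"
      unfolding F_def by (intro closedin_diff openin_Union) (auto intro: CO_openin)
    show "F \<noteq> {}" using P_iff[OF CO_topspace] prime_filter_top[OF P] by (auto simp: top_CO)
    show "U \<inter> V \<inter> F \<noteq> {}" if "U \<in> CO X" "V \<in> CO X" "U \<inter> F \<noteq> {}" "V \<inter> F \<noteq> {}" for U V
      using that prime_filter_meet_iff[OF P, of U V] P_iff CO_Int
      by (simp add: carrier_CO meet_CO)
  qed
  then obtain x where x: "x \<in> topspace X" "F = X closure_of {x}"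
    using spectral_space unfolding spectral_space_def sober_space_def by meson
  have "U \<in> P \<longleftrightarrow> x \<in> U" if U: "U \<in> CO X" for U
    unfolding P_iff[OF U] x(2)
    using openin_Int_closure_of_eq_empty[OF CO_openin[OF U], of "{x}"] by blast
  then show thesis using that[OF x(1)] P_CO by blast
qed

lemma down_directed_finite_Inter:
  assumes "\<M> \<subseteq> CO X"
  shows "down_directed L {topspace X \<inter> \<Inter>\<F> |\<F>. finite \<F> \<and> \<F> \<subseteq> \<M>}" (is "down_directed L ?K")
  unfolding down_directed_def
proof (intro conjI ballI)
  show "?K \<subseteq> carrier L" using assms CO_finite_Inter by (auto simp: carrier_CO)
  show "?K \<noteq> {}" by blast
  fix U V assume "U \<in> ?K" "V \<in> ?K"
  then obtain \<F> \<G> where "finite \<F>" "\<F> \<subseteq> \<M>" "U = topspace X \<inter> \<Inter>\<F>"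
    "finite \<G>" "\<G> \<subseteq> \<M>" "V = topspace X \<inter> \<Inter>\<G>" by blast
  then show "\<exists>W\<in>?K. W \<sqsubseteq>\<^bsub>L\<^esub> U \<and> W \<sqsubseteq>\<^bsub>L\<^esub> V"
    by (intro bexI[of _ "topspace X \<inter> \<Inter>(\<F> \<union> \<G>)"] CollectI exI[of _ "\<F> \<union> \<G>"]) (auto simp: le_CO)
qed

lemma up_directed_finite_Union:
  assumes "\<N> \<subseteq> CO X"
  shows "up_directed L {\<Union>\<G> |\<G>. finite \<G> \<and> \<G> \<subseteq> \<N>}" (is "up_directed L ?I")
  unfolding up_directed_def
proof (intro conjI ballI)
  show "?I \<subseteq> carrier L" using assms CO_Union[of _ X] by (auto simp: carrier_CO)
  show "?I \<noteq> {}" by blast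
  fix U V assume "U \<in> ?I" "V \<in> ?I"
  then obtain \<F> \<G> where "finite \<F>" "\<F> \<subseteq> \<N>" "U = \<Union>\<F>" "finite \<G>" "\<G> \<subseteq> \<N>" "V = \<Union>\<G>" by blast
  then show "\<exists>W\<in>?I. U \<sqsubseteq>\<^bsub>L\<^esub> W \<and> V \<sqsubseteq>\<^bsub>L\<^esub> W"
    by (intro bexI[of _ "\<Union>(\<F> \<union> \<G>)"] CollectI exI[of _ "\<F> \<union> \<G>"]) (auto simp: le_CO)
qed

end

text \<open>For sets of compact opens, the prime filter theorem is a compactness statement.\<close>

lemma (in spectral) CO_point_separation:
  assumes M: "\<M> \<subseteq> CO X" and N: "\<N> \<subseteq> CO X"
    and separated: "\<And>\<F> \<G>. finite \<F> \<Longrightarrow> \<F> \<subseteq> \<M> \<Longrightarrow> finite \<G> \<Longrightarrow> \<G> \<subseteq> \<N> \<Longrightarrow> \<not> topspace X \<inter> \<Inter>\<F> \<subseteq> \<Union>\<G>"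
  obtains x where "x \<in> topspace X" "x \<in> \<Inter>\<M>" "x \<notin> \<Union>\<N>"
proof -
  define L :: "'x set gorder" where "L = \<lparr>carrier = CO X, eq = (=), le = (\<subseteq>)\<rparr>"
  interpret compact_open_lattice X L by unfold_locales (simp_all add: L_def)
  let ?K = "{topspace X \<inter> \<Inter>\<F> |\<F>. finite \<F> \<and> \<F> \<subseteq> \<M>}" and ?I = "{\<Union>\<G> |\<G>. finite \<G> \<and> \<G> \<subseteq> \<N>}"
  obtain P where P: "P \<in> prime_filters L" "?K \<subseteq> P" "P \<inter> ?I = {}"
    by (rule prime_filter_separation[OF down_directed_finite_Inter[OF M] up_directed_finite_Union[OF N]])
      (use separated in \<open>auto simp: le_CO\<close>)
  obtain x where x: "x \<in> topspace X" "P = {U \<in> CO X. x \<in> U}"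
    using prime_filter_point[OF P(1)] .
  have "topspace X \<inter> \<Inter>{U} \<in> ?K" if "U \<in> \<M>" for U
    by (intro CollectI exI[of _ "{U}"]) (use that in simp)
  then have "x \<in> U" if "U \<in> \<M>" for U using that P(2) x(2) by blast
  moreover have "V \<in> ?I" if "V \<in> \<N>" for V
    by (intro CollectI exI[of _ "{V}"]) (use that in simp)
  then have "x \<notin> V" if "V \<in> \<N>" for V using that P(3) x(2) N by blast
  ultimately show thesis using that[OF x(1)] by blast
qed

section \<open>The patch topology\<close>

definition patch_subbase :: "'x topology \<Rightarrow> 'x set set" where
  "patch_subbase X = CO X \<union> (\<lambda>U. topspace X - U) ` CO X"

definition patch :: "'x topology \<Rightarrow> 'x topology" where
  "patch X = topology (arbitrary union_of
     (finite intersection_of (\<lambda>S. S \<in> patch_subbase X) relative_to topspace X))"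

lemma topspace_patch [simp]: "topspace (patch X) = topspace X"
  by (simp add: patch_def)

lemma openin_patch_subbase:
  assumes "S \<in> patch_subbase X"
  shows "openin (patch X) S"
proof -
  have "S \<subseteq> topspace X" using assms CO_subset by (auto simp: patch_subbase_def)
  moreover have "(finite intersection_of (\<lambda>S. S \<in> patch_subbase X) relative_to topspace X) (topspace X \<inter> S)"
    by (intro relative_to_inc finite_intersection_of_inc assms)
  ultimately show ?thesis
    by (simp add: patch_def openin_subbase arbitrary_union_of_inc Int_absorb1)
qed

lemma openin_patch_CO: "U \<in> CO X \<Longrightarrow> openin (patch X) U"
  by (rule openin_patch_subbase) (simp add: patch_subbase_def)

lemma closedin_patch_CO: "U \<in> CO X \<Longrightarrow> closedin (patch X) U"
  unfolding closedin_def topspace_patch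
  using openin_patch_subbase[of "topspace X - U" X] CO_subset[of U X] by (auto simp: patch_subbase_def)

lemma openin_patch_Diff: "U \<in> CO X \<Longrightarrow> V \<in> CO X \<Longrightarrow> openin (patch X) (U - V)"
  by (intro openin_diff openin_patch_CO closedin_patch_CO)

lemma continuous_map_patch:
  assumes f: "spectral_map X Y f"
  shows "continuous_map (patch X) (patch Y) f"
  unfolding continuous_map_into_topology_subbase_eq[OF patch_def[of Y]] topspace_patch
proof (intro conjI allI impI)
  show "f \<in> topspace X \<rightarrow> topspace Y" using spectral_map_closed[OF f] by blast
  fix S assume "S \<in> patch_subbase Y"
  then consider (CO) "S \<in> CO Y" | (Compl) V where "V \<in> CO Y" "S = topspace Y - V"
    by (auto simp: patch_subbase_def)
  then show "openin (patch X) {x \<in> topspace X. f x \<in> S}"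
  proof cases
    case CO
    then show ?thesis by (intro openin_patch_CO spectral_map_CO[OF f])
  next
    case Compl
    then have "{x \<in> topspace X. f x \<in> S} = topspace X - {x \<in> topspace X. f x \<in> V}"
      using spectral_map_closed[OF f] by blast
    then show ?thesis
      using spectral_map_CO[OF f Compl(1)] by (intro openin_patch_subbase) (simp add: patch_subbase_def)
  qed
qed

context spectral
begin

lemma finite_intersection_of_patch_subbase:
  assumes "finite \<F>" "\<F> \<subseteq> patch_subbase X"
  shows "\<exists>U\<in>CO X. \<exists>V\<in>CO X. topspace X \<inter> \<Inter>\<F> = U - V"
  using assms
proof (induction rule: finite_induct)
  case empty
  then show ?case using CO_topspace CO_empty by (intro bexI[of _ "topspace X"] bexI[of _ "{}"]) auto
next
  case (insert S \<F>)
  then obtain U V where UV: "U \<in> CO X" "V \<in> CO X" "topspace X \<inter> \<Inter>\<F> = U - V" by auto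
  then have Inter_insert: "topspace X \<inter> \<Inter>(insert S \<F>) = S \<inter> (U - V)" by blast
  consider (CO) "S \<in> CO X" | (Compl) W where "W \<in> CO X" "S = topspace X - W"
    using insert.prems by (auto simp: patch_subbase_def)
  then show ?case
  proof cases
    case CO
    have "topspace X \<inter> \<Inter>(insert S \<F>) = (S \<inter> U) - V" unfolding Inter_insert by blast
    then show ?thesis using CO_Int[OF CO UV(1)] UV(2) by blast
  next
    case Compl
    have "topspace X \<inter> \<Inter>(insert S \<F>) = U - (V \<union> W)"
      unfolding Inter_insert using Compl(2) CO_subset[OF UV(1)] by blast
    then show ?thesis using CO_Un[OF UV(2) Compl(1)] UV(1) by blast
  qed
qed

lemma openin_patch_iff:
  "openin (patch X) S \<longleftrightarrow> (\<forall>x\<in>S. \<exists>U\<in>CO X. \<exists>V\<in>CO X. x \<in> U - V \<and> U - V \<subseteq> S)"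
proof
  assume "openin (patch X) S"
  then have base: "\<forall>x\<in>S. \<exists>W. (finite intersection_of (\<lambda>S. S \<in> patch_subbase X) relative_to topspace X) W \<and> x \<in> W \<and> W \<subseteq> S"
    by (simp add: patch_def openin_subbase arbitrary_union_of_alt)
  show "\<forall>x\<in>S. \<exists>U\<in>CO X. \<exists>V\<in>CO X. x \<in> U - V \<and> U - V \<subseteq> S"
  proof
    fix x assume "x \<in> S"
    then obtain W where W: "x \<in> W" "W \<subseteq> S"
      and "(finite intersection_of (\<lambda>S. S \<in> patch_subbase X) relative_to topspace X) W"
      using base by meson
    then obtain \<F> where \<F>: "finite \<F>" "\<F> \<subseteq> patch_subbase X" "W = topspace X \<inter> \<Inter>\<F>"
      unfolding relative_to_def intersection_of_def by auto
    show "\<exists>U\<in>CO X. \<exists>V\<in>CO X. x \<in> U - V \<and> U - V \<subseteq> S"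
      using finite_intersection_of_patch_subbase[OF \<F>(1,2)] W unfolding \<F>(3) by metis
  qed
next
  assume base: "\<forall>x\<in>S. \<exists>U\<in>CO X. \<exists>V\<in>CO X. x \<in> U - V \<and> U - V \<subseteq> S"
  show "openin (patch X) S"
  proof (subst openin_subopen, intro ballI)
    fix x assume "x \<in> S"
    then obtain U V where "U \<in> CO X" "V \<in> CO X" "x \<in> U - V" "U - V \<subseteq> S"
      using base by meson
    then show "\<exists>T. openin (patch X) T \<and> x \<in> T \<and> T \<subseteq> S" using openin_patch_Diff by metis
  qed
qed

lemma openin_imp_openin_patch: "openin X S \<Longrightarrow> openin (patch X) S"
  using CO_base[of S] openin_patch_CO[of _ X] by (subst openin_subopen) blast

lemma closedin_imp_closedin_patch: "closedin X S \<Longrightarrow> closedin (patch X) S"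
  using openin_imp_openin_patch by (simp add: closedin_def)

theorem compact_space_patch: "compact_space (patch X)"
proof (rule Alexander_subbase_alt[OF _ _ patch_def[symmetric]])
  show "topspace X \<subseteq> \<Union>(patch_subbase X)" using CO_topspace by (auto simp: patch_subbase_def)
  fix \<C> assume \<C>: "\<C> \<subseteq> patch_subbase X" "topspace X \<subseteq> \<Union>\<C>"
  let ?M = "{U \<in> CO X. topspace X - U \<in> \<C>}" and ?N = "\<C> \<inter> CO X"
  show "\<exists>\<C>'. finite \<C>' \<and> \<C>' \<subseteq> \<C> \<and> topspace X \<subseteq> \<Union>\<C>'"
  proof (rule ccontr)
    assume "\<not> ?thesis"
    then have no_subcover: "\<not> topspace X \<subseteq> \<Union>\<C>'" if "finite \<C>'" "\<C>' \<subseteq> \<C>" for \<C>'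
      using that by blast
    obtain x where x: "x \<in> topspace X" "x \<in> \<Inter>?M" "x \<notin> \<Union>?N"
    proof (rule CO_point_separation[of ?M ?N])
      fix \<F> \<G> assume \<F>: "finite \<F>" "\<F> \<subseteq> ?M" and \<G>: "finite \<G>" "\<G> \<subseteq> ?N"
      show "\<not> topspace X \<inter> \<Inter>\<F> \<subseteq> \<Union>\<G>"
      proof
        let ?\<C> = "(\<lambda>U. topspace X - U) ` \<F> \<union> \<G>"
        assume "topspace X \<inter> \<Inter>\<F> \<subseteq> \<Union>\<G>"
        then have "topspace X \<subseteq> \<Union>?\<C>" by blast
        moreover have "finite ?\<C>" "?\<C> \<subseteq> \<C>" using \<F> \<G> by auto
        ultimately show False using no_subcover[of ?\<C>] by simp
      qed
    qed blast+
    obtain S where "S \<in> \<C>" "x \<in> S" using \<C>(2) x(1) by blast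
    then show False using \<C>(1) x by (auto simp: patch_subbase_def)
  qed
qed

lemma Hausdorff_space_patch: "Hausdorff_space (patch X)"
  unfolding Hausdorff_space_def topspace_patch
proof (intro allI impI)
  fix x y assume xy: "x \<in> topspace X \<and> y \<in> topspace X \<and> x \<noteq> y"
  then obtain U where U: "U \<in> CO X" "x \<in> U \<longleftrightarrow> y \<notin> U" using CO_separates_points[of x y] by blast
  have "openin (patch X) U" "openin (patch X) (topspace X - U)" "disjnt U (topspace X - U)"
    using openin_patch_CO[OF U(1)] openin_patch_Diff[OF CO_topspace U(1)] by (auto simp: disjnt_def)
  then show "\<exists>U V. openin (patch X) U \<and> openin (patch X) V \<and> x \<in> U \<and> y \<in> V \<and> disjnt U V"
    using U(2) xy disjnt_sym by (cases "x \<in> U") blast+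
qed

lemma closedin_patch_imp_compactin_patch: "closedin (patch X) K \<Longrightarrow> compactin (patch X) K"
  by (rule closedin_compact_space[OF compact_space_patch])

lemma closedin_patch_imp_compactin: "closedin (patch X) K \<Longrightarrow> compactin X K"
  using closedin_patch_imp_compactin_patch openin_imp_openin_patch by (simp add: compactin_def)

lemma closedin_patch_Inter_CO_nonempty:
  assumes Y: "closedin (patch X) Y" and "\<K> \<subseteq> CO X"
    and "\<And>\<G>. finite \<G> \<Longrightarrow> \<G> \<subseteq> \<K> \<Longrightarrow> Y \<inter> \<Inter>\<G> \<noteq> {}"
  shows "Y \<inter> \<Inter>\<K> \<noteq> {}"
proof -
  have "\<forall>U\<in>\<K>. closedin (patch X) U" using assms(2) closedin_patch_CO by blast
  then show ?thesis
    using closedin_patch_imp_compactin_patch[OF Y] assms(3) unfolding compactin_fip by meson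
qed

lemma closure_of_closedin_patch:
  assumes Y: "closedin (patch X) Y"
  shows "X closure_of Y = (\<Union>y\<in>Y. X closure_of {y})"
proof
  show "(\<Union>y\<in>Y. X closure_of {y}) \<subseteq> X closure_of Y"
    using closure_of_mono[of "{_}" Y X] by blast
  show "X closure_of Y \<subseteq> (\<Union>y\<in>Y. X closure_of {y})"
  proof
    fix x assume x: "x \<in> X closure_of Y"
    then have x_topspace: "x \<in> topspace X" by (simp add: in_closure_of)
    let ?K = "{U \<in> CO X. x \<in> U}"
    have "Y \<inter> \<Inter>?K \<noteq> {}"
    proof (rule closedin_patch_Inter_CO_nonempty[OF Y])
      fix \<G> assume \<G>: "finite \<G>" "\<G> \<subseteq> ?K"
      then have "topspace X \<inter> \<Inter>\<G> \<in> CO X" by (intro CO_finite_Inter) auto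
      moreover have "x \<in> topspace X \<inter> \<Inter>\<G>" using \<G>(2) x_topspace by blast
      ultimately have "\<exists>y\<in>Y. y \<in> topspace X \<inter> \<Inter>\<G>"
        using x CO_openin[of "topspace X \<inter> \<Inter>\<G>"] unfolding in_closure_of by metis
      then show "Y \<inter> \<Inter>\<G> \<noteq> {}" by blast
    qed blast
    then show "x \<in> (\<Union>y\<in>Y. X closure_of {y})"
      using x_topspace by (auto simp: in_closure_of_point_iff_CO)
  qed
qed

lemma CO_subtopology_closedin_patch:
  assumes Y: "closedin (patch X) Y"
  shows "CO (subtopology X Y) = (\<lambda>U. U \<inter> Y) ` CO X"
proof
  show "(\<lambda>U. U \<inter> Y) ` CO X \<subseteq> CO (subtopology X Y)"
  proof
    fix W assume "W \<in> (\<lambda>U. U \<inter> Y) ` CO X"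
    then obtain U where U: "U \<in> CO X" "W = U \<inter> Y" by blast
    have "closedin (patch X) W" using Y closedin_patch_CO[OF U(1)] U(2) by (simp add: closedin_Int)
    then have "compactin X W" by (rule closedin_patch_imp_compactin)
    then show "W \<in> CO (subtopology X Y)"
      using U CO_openin[OF U(1)] by (auto simp: CO_def compactin_subtopology openin_subtopology)
  qed
  show "CO (subtopology X Y) \<subseteq> (\<lambda>U. U \<inter> Y) ` CO X"
  proof
    fix W assume W: "W \<in> CO (subtopology X Y)"
    then obtain T where T: "openin X T" "W = T \<inter> Y" by (auto simp: CO_def openin_subtopology)
    have "compactin X W" using W by (auto simp: CO_def compactin_subtopology)
    then obtain U where "U \<in> CO X" "W \<subseteq> U" "U \<subseteq> T"
      using T by (elim compactin_CO_interpolation[of W T]) auto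
    then show "W \<in> (\<lambda>U. U \<inter> Y) ` CO X" using T by blast
  qed
qed

lemma irreducible_closedin_subtopology_generic:
  assumes Y: "closedin (patch X) Y" and F: "irreducible_closedin (subtopology X Y) F"
  shows "\<exists>x\<in>F. \<forall>U\<in>CO X. U \<inter> F \<noteq> {} \<longrightarrow> x \<in> U"
proof -
  obtain G where G: "closedin X G" "F = G \<inter> Y"
    using F by (auto simp: irreducible_closedin_def closedin_subtopology)
  then have F_closed: "closedin (patch X) F"
    using Y closedin_imp_closedin_patch by (simp add: closedin_Int)
  let ?K = "{U \<in> CO X. U \<inter> F \<noteq> {}}"
  have "F \<inter> \<Inter>?K \<noteq> {}"
  proof (rule closedin_patch_Inter_CO_nonempty[OF F_closed])
    fix \<G> assume \<G>: "finite \<G>" "\<G> \<subseteq> ?K"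
    have "F \<inter> \<Inter>((\<lambda>U. U \<inter> Y) ` \<G>) \<noteq> {}"
    proof (rule irreducible_closedin_meets_finite_Inter[OF F])
      fix W assume "W \<in> (\<lambda>U. U \<inter> Y) ` \<G>"
      then obtain U where "U \<in> CO X" "U \<inter> F \<noteq> {}" "W = U \<inter> Y" using \<G>(2) by blast
      then show "openin (subtopology X Y) W \<and> W \<inter> F \<noteq> {}"
        using G(2) CO_openin by (auto simp: openin_subtopology)
    qed (use \<G> in simp)
    then show "F \<inter> \<Inter>\<G> \<noteq> {}" by blast
  qed blast
  then show ?thesis by blast
qed

lemma spectral_space_closedin_patch:
  assumes Y: "closedin (patch X) Y"
  shows "spectral_space (subtopology X Y)"
proof (rule spectral_spaceI)
  have topspace: "topspace (subtopology X Y) = Y" using closedin_subset[OF Y] by auto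
  note CO_eq = CO_subtopology_closedin_patch[OF Y]
  show "topspace (subtopology X Y) \<in> CO (subtopology X Y)"
    using closedin_subset[OF Y] CO_topspace unfolding topspace CO_eq by auto
  show "U \<inter> V \<in> CO (subtopology X Y)" if "U \<in> CO (subtopology X Y)" "V \<in> CO (subtopology X Y)" for U V
  proof -
    obtain U' V' where "U' \<in> CO X" "U = U' \<inter> Y" "V' \<in> CO X" "V = V' \<inter> Y"
      using \<open>U \<in> _\<close> \<open>V \<in> _\<close> unfolding CO_eq by blast
    then have "U \<inter> V = (U' \<inter> V') \<inter> Y" "U' \<inter> V' \<in> CO X" using CO_Int by auto
    then show ?thesis unfolding CO_eq by blast
  qed
  show "\<exists>V\<in>CO (subtopology X Y). x \<in> V \<and> V \<subseteq> U" if U: "openin (subtopology X Y) U" "x \<in> U" for U x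
  proof -
    obtain T where T: "openin X T" "U = T \<inter> Y" using U(1) by (auto simp: openin_subtopology)
    obtain V where "V \<in> CO X" "x \<in> V" "V \<subseteq> T" using CO_base[OF T(1), of x] U(2) T(2) by blast
    then show ?thesis using U(2) T(2) by (intro bexI[of _ "V \<inter> Y"]) (auto simp: CO_eq)
  qed
  show "x = y" if "x \<in> topspace (subtopology X Y)" "y \<in> topspace (subtopology X Y)"
    "\<And>U. U \<in> CO (subtopology X Y) \<Longrightarrow> x \<in> U \<longleftrightarrow> y \<in> U" for x y
    by (rule CO_separates_points) (use that topspace in \<open>auto simp: CO_eq\<close>)
  show "\<exists>x\<in>F. \<forall>U\<in>CO (subtopology X Y). U \<inter> F \<noteq> {} \<longrightarrow> x \<in> U"
    if F: "irreducible_closedin (subtopology X Y) F" for F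
  proof -
    have "F \<subseteq> Y" using F closedin_subset topspace by (fastforce simp: irreducible_closedin_def)
    then show ?thesis
      using irreducible_closedin_subtopology_generic[OF Y F] unfolding CO_eq by blast
  qed
qed

theorem spectral_subset_iff_closedin_patch: "spectral_subset X Y \<longleftrightarrow> closedin (patch X) Y"
proof
  assume Y: "closedin (patch X) Y"
  then have topspace: "Y \<subseteq> topspace X" "topspace (subtopology X Y) = Y"
    using closedin_subset by force+
  have "spectral_map (subtopology X Y) X id"
  proof (rule spectral_mapI[OF spectral_space_closedin_patch[OF Y] spectral_space])
    fix V assume "V \<in> CO X"
    moreover have "{x \<in> topspace (subtopology X Y). id x \<in> V} = V \<inter> Y" using topspace(2) by auto
    ultimately show "{x \<in> topspace (subtopology X Y). id x \<in> V} \<in> CO (subtopology X Y)"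
      by (simp add: CO_subtopology_closedin_patch[OF Y])
  qed simp
  then show "spectral_subset X Y" using topspace(1) by (simp add: spectral_subset_def)
next
  assume "spectral_subset X Y"
  then have Y: "Y \<subseteq> topspace X" and incl: "spectral_map (subtopology X Y) X id"
    by (auto simp: spectral_subset_def)
  interpret Y: spectral "subtopology X Y"
    by unfold_locales (use incl in \<open>simp add: spectral_map_def\<close>)
  have "compactin (patch X) (id ` topspace (subtopology X Y))"
    using image_compactin[OF _ continuous_map_patch[OF incl]] Y.compact_space_patch
    by (simp add: compact_space_def)
  then show "closedin (patch X) Y"
    using compactin_imp_closedin[OF Hausdorff_space_patch] Y by (simp add: Int_absorb1)
qed

corollary doubly_spectral_iff_patch_clopen:
  "doubly_spectral X Y \<longleftrightarrow> closedin (patch X) Y \<and> openin (patch X) Y"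
proof -
  have "closedin (patch X) (topspace X - Y) \<longleftrightarrow> openin (patch X) Y" if "Y \<subseteq> topspace X"
    using that by (simp add: openin_closedin_eq)
  moreover have "Y \<subseteq> topspace X" if "closedin (patch X) Y" using closedin_subset[OF that] by simp
  ultimately show ?thesis
    unfolding doubly_spectral_def spectral_subset_iff_closedin_patch by blast
qed

lemma doubly_spectral_subset: "doubly_spectral X Y \<Longrightarrow> Y \<subseteq> topspace X"
  by (simp add: doubly_spectral_def spectral_subset_def)

lemma doubly_spectral_CO: "U \<in> CO X \<Longrightarrow> doubly_spectral X U"
  by (simp add: doubly_spectral_iff_patch_clopen openin_patch_CO closedin_patch_CO)

lemma doubly_spectral_Compl: "doubly_spectral X Y \<Longrightarrow> doubly_spectral X (topspace X - Y)"
  using doubly_spectral_subset[of Y] by (auto simp: doubly_spectral_def double_diff)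

lemma doubly_spectral_Diff: "doubly_spectral X Y \<Longrightarrow> doubly_spectral X Z \<Longrightarrow> doubly_spectral X (Y - Z)"
  by (simp add: doubly_spectral_iff_patch_clopen closedin_diff openin_diff)

lemma doubly_spectral_Union:
  "finite \<F> \<Longrightarrow> (\<And>Y. Y \<in> \<F> \<Longrightarrow> doubly_spectral X Y) \<Longrightarrow> doubly_spectral X (\<Union>\<F>)"
  unfolding doubly_spectral_iff_patch_clopen by (auto intro: closedin_Union)

lemma doubly_spectral_eq_finite_Union_Diff:
  assumes "doubly_spectral X Y"
  obtains I where "finite I" "I \<subseteq> CO X \<times> CO X" "Y = (\<Union>(U, V)\<in>I. U - V)"
proof -
  have Y: "closedin (patch X) Y" "openin (patch X) Y"
    using assms by (auto simp: doubly_spectral_iff_patch_clopen)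
  let ?B = "(\<lambda>(U, V). U - V) ` (CO X \<times> CO X)"
  have base: "\<exists>W\<in>?B. x \<in> W \<and> W \<subseteq> Y" if x: "x \<in> Y" for x
  proof -
    obtain U V where "U \<in> CO X" "V \<in> CO X" "x \<in> U - V" "U - V \<subseteq> Y"
      using Y(2) x unfolding openin_patch_iff by meson
    then show ?thesis by (intro bexI[of _ "U - V"]) auto
  qed
  obtain \<F> where \<F>: "finite \<F>" "\<F> \<subseteq> ?B" "Y \<subseteq> \<Union>\<F>" "\<Union>\<F> \<subseteq> Y"
  proof (rule compactin_base_cover[OF closedin_patch_imp_compactin_patch[OF Y(1)] subset_refl base])
    show "openin (patch X) W" if "W \<in> ?B" for W using that openin_patch_Diff by auto
  qed
  then obtain I where "finite I" "I \<subseteq> CO X \<times> CO X" "\<F> = (\<lambda>(U, V). U - V) ` I"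
    using finite_subset_image[of \<F>] by metis
  then show thesis using \<F> that[of I] by auto
qed

lemma doubly_spectral_additive_operator:
  assumes Y: "doubly_spectral X Y"
    and additive: "\<And>\<F>. finite \<F> \<Longrightarrow> h (\<Union>\<F>) = \<Union>(h ` \<F>)"
    and Diff: "\<And>U V. U \<in> CO X \<Longrightarrow> V \<in> CO X \<Longrightarrow> doubly_spectral X (h (U - V))"
  shows "doubly_spectral X (h Y)"
proof -
  obtain I where I: "finite I" "I \<subseteq> CO X \<times> CO X" "Y = (\<Union>(U, V)\<in>I. U - V)"
    using doubly_spectral_eq_finite_Union_Diff[OF Y] .
  have "h Y = \<Union>(h ` (\<lambda>(U, V). U - V) ` I)" using additive[of "(\<lambda>(U, V). U - V) ` I"] I by simp
  moreover have "doubly_spectral X (\<Union>(h ` (\<lambda>(U, V). U - V) ` I))"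
    using I by (intro doubly_spectral_Union) (auto intro: Diff)
  ultimately show ?thesis by simp
qed

lemma doubly_spectral_generalization_closed_imp_CO:
  assumes Y: "doubly_spectral X Y"
    and generalization_closed: "\<And>x y. x \<in> Y \<Longrightarrow> y \<in> topspace X \<Longrightarrow> x \<in> X closure_of {y} \<Longrightarrow> y \<in> Y"
  shows "Y \<in> CO X"
proof -
  let ?Z = "topspace X - Y"
  have "closedin (patch X) ?Z"
    using doubly_spectral_Compl[OF Y] by (simp add: doubly_spectral_iff_patch_clopen)
  then have "X closure_of ?Z \<subseteq> ?Z"
    using generalization_closed by (auto simp: closure_of_closedin_patch in_closure_of)
  then have "closedin X ?Z" using closure_of_subset_eq[of ?Z X] by blast
  then have "openin X Y" using doubly_spectral_subset[OF Y] by (simp add: openin_closedin_eq)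
  moreover have "compactin X Y"
    using Y closedin_patch_imp_compactin by (simp add: doubly_spectral_iff_patch_clopen)
  ultimately show ?thesis by (simp add: CO_def)
qed

lemma doubly_spectral_openin_imp_CO: "doubly_spectral X Y \<Longrightarrow> openin X Y \<Longrightarrow> Y \<in> CO X"
  by (rule doubly_spectral_generalization_closed_imp_CO) (auto dest: in_closure_of_point_openin)

end

section \<open>The spectrum of a distributive lattice\<close>

definition stone :: "('a, 'm) gorder_scheme \<Rightarrow> 'a \<Rightarrow> 'a set set" where
  "stone L a = {P \<in> prime_filters L. a \<in> P}"

definition spectrum :: "('a, 'm) gorder_scheme \<Rightarrow> 'a set topology" where
  "spectrum L = topology_generated_by (stone L ` carrier L)"

lemma in_stone_iff: "P \<in> stone L a \<longleftrightarrow> P \<in> prime_filters L \<and> a \<in> P"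
  by (simp add: stone_def)

context distrib_bounded_lattice
begin

lemma stone_top: "stone L \<top> = prime_filters L"
  using prime_filter_top by (auto simp: stone_def)

lemma stone_bottom: "stone L \<bottom> = {}"
  using prime_filter_bottom by (auto simp: stone_def)

lemma stone_meet: "a \<in> carrier L \<Longrightarrow> b \<in> carrier L \<Longrightarrow> stone L (a \<sqinter> b) = stone L a \<inter> stone L b"
  using prime_filter_meet_iff by (auto simp: stone_def)

lemma stone_join: "a \<in> carrier L \<Longrightarrow> b \<in> carrier L \<Longrightarrow> stone L (a \<squnion> b) = stone L a \<union> stone L b"
  using prime_filter_join_iff by (auto simp: stone_def)

lemma stone_subset_iff:
  assumes "a \<in> carrier L" "b \<in> carrier L"
  shows "stone L a \<subseteq> stone L b \<longleftrightarrow> a \<sqsubseteq> b"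
proof
  assume subset: "stone L a \<subseteq> stone L b"
  show "a \<sqsubseteq> b"
  proof (rule ccontr)
    assume "\<not> a \<sqsubseteq> b"
    then obtain P where "P \<in> prime_filters L" "{a} \<subseteq> P" "P \<inter> {b} = {}"
      using prime_filter_separation[OF down_directed_singleton up_directed_singleton] assms by blast
    then show False using subset by (auto simp: stone_def)
  qed
next
  show "stone L a \<subseteq> stone L b" if "a \<sqsubseteq> b"
    using that assms prime_filter_upward by (auto simp: stone_def)
qed

lemma inj_on_stone: "inj_on (stone L) (carrier L)"
proof (rule inj_onI)
  fix a b assume "a \<in> carrier L" "b \<in> carrier L" "stone L a = stone L b"
  then show "a = b" using stone_subset_iff[of a b] stone_subset_iff[of b a] by (intro le_antisym) auto
qed

lemma stone_finite_Union:
  assumes "finite \<F>" "\<F> \<subseteq> stone L ` carrier L"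
  shows "\<Union>\<F> \<in> stone L ` carrier L"
  using assms
proof (induction rule: finite_induct)
  case empty
  then show ?case using stone_bottom bottom_closed by (metis Union_empty imageI)
next
  case (insert F \<F>)
  then obtain a b where ab: "a \<in> carrier L" "F = stone L a" "b \<in> carrier L" "\<Union>\<F> = stone L b" by auto
  then have "\<Union>(insert F \<F>) = stone L (a \<squnion> b)" by (simp add: stone_join)
  then show ?case using join_closed[of a b] ab by (metis imageI)
qed

lemma openin_stone: "a \<in> carrier L \<Longrightarrow> openin (spectrum L) (stone L a)"
  unfolding spectrum_def by (rule topology_generated_by_Basis) simp

lemma openin_spectrum_iff:
  "openin (spectrum L) S \<longleftrightarrow> (\<forall>P\<in>S. \<exists>a\<in>carrier L. P \<in> stone L a \<and> stone L a \<subseteq> S)"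
proof
  assume "openin (spectrum L) S"
  then have "generate_topology_on (stone L ` carrier L) S"
    by (simp add: spectrum_def openin_topology_generated_by_iff)
  then show "\<forall>P\<in>S. \<exists>a\<in>carrier L. P \<in> stone L a \<and> stone L a \<subseteq> S"
  proof induction
    case (Int S T)
    show ?case
    proof
      fix P assume P: "P \<in> S \<inter> T"
      then obtain a b where "a \<in> carrier L" "P \<in> stone L a" "stone L a \<subseteq> S"
        "b \<in> carrier L" "P \<in> stone L b" "stone L b \<subseteq> T" using Int.IH by (meson IntD1 IntD2)
      then show "\<exists>a\<in>carrier L. P \<in> stone L a \<and> stone L a \<subseteq> S \<inter> T"
        by (intro bexI[of _ "a \<sqinter> b"]) (auto simp: stone_meet)
    qed
  next
    case (UN \<K>)
    then show ?case by (meson Union_iff Union_upper subset_trans)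
  qed auto
next
  assume "\<forall>P\<in>S. \<exists>a\<in>carrier L. P \<in> stone L a \<and> stone L a \<subseteq> S"
  then show "openin (spectrum L) S" using openin_stone by (subst openin_subopen) meson
qed

lemma topspace_spectrum [simp]: "topspace (spectrum L) = prime_filters L"
proof
  show "topspace (spectrum L) \<subseteq> prime_filters L"
    by (auto simp: spectrum_def stone_def)
  show "prime_filters L \<subseteq> topspace (spectrum L)"
    using openin_subset[OF openin_stone[OF top_closed]] by (simp add: stone_top)
qed

lemma up_directed_finitely_covered:
  "up_directed L {b \<in> carrier L. \<exists>\<F>. finite \<F> \<and> \<F> \<subseteq> \<U> \<and> stone L b \<subseteq> \<Union>\<F>}" (is "up_directed L ?I")
  unfolding up_directed_def
proof (intro conjI ballI)
  show "?I \<subseteq> carrier L" by blast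
  have "\<bottom> \<in> ?I" using stone_bottom by (auto intro: exI[of _ "{}"])
  then show "?I \<noteq> {}" by blast
  fix b c assume "b \<in> ?I" "c \<in> ?I"
  then obtain \<F> \<G> where "finite \<F>" "\<F> \<subseteq> \<U>" "stone L b \<subseteq> \<Union>\<F>" "b \<in> carrier L" "c \<in> carrier L"
    "finite \<G>" "\<G> \<subseteq> \<U>" "stone L c \<subseteq> \<Union>\<G>" by blast
  then have "b \<squnion> c \<in> ?I" "b \<sqsubseteq> b \<squnion> c" "c \<sqsubseteq> b \<squnion> c"
    by (auto simp: stone_join join_left join_right intro!: exI[of _ "\<F> \<union> \<G>"])
  then show "\<exists>d\<in>?I. b \<sqsubseteq> d \<and> c \<sqsubseteq> d" by blast
qed

lemma compactin_stone:
  assumes a: "a \<in> carrier L"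
  shows "compactin (spectrum L) (stone L a)"
  unfolding compactin_def
proof (intro conjI allI impI)
  show "stone L a \<subseteq> topspace (spectrum L)" by (auto simp: stone_def)
  fix \<U> assume \<U>: "(\<forall>U\<in>\<U>. openin (spectrum L) U) \<and> stone L a \<subseteq> \<Union>\<U>"
  define I where "I = {b \<in> carrier L. \<exists>\<F>. finite \<F> \<and> \<F> \<subseteq> \<U> \<and> stone L b \<subseteq> \<Union>\<F>}"
  have I: "up_directed L I" unfolding I_def by (rule up_directed_finitely_covered)
  have downward: "a \<in> I" if "a \<sqsubseteq> b" "b \<in> I" for b
    using that a stone_subset_iff[of a b] unfolding I_def by blast
  have meets_I: "\<exists>b\<in>I. b \<in> P" if P: "P \<in> stone L a" for P
  proof -
    obtain U where "U \<in> \<U>" "P \<in> U" using \<U> P by blast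
    then obtain b where "b \<in> carrier L" "P \<in> stone L b" "stone L b \<subseteq> U"
      using \<U> unfolding openin_spectrum_iff by meson
    then show ?thesis
      unfolding I_def using \<open>U \<in> \<U>\<close> by (intro bexI[of _ b]) (auto simp: stone_def intro!: exI[of _ "{U}"])
  qed
  have "a \<in> I"
  proof (rule ccontr)
    assume "a \<notin> I"
    then obtain P where "P \<in> prime_filters L" "{a} \<subseteq> P" "P \<inter> I = {}"
      using prime_filter_separation[OF down_directed_singleton[OF a] I] downward by blast
    then show False using meets_I[of P] by (auto simp: in_stone_iff)
  qed
  then show "\<exists>\<F>. finite \<F> \<and> \<F> \<subseteq> \<U> \<and> stone L a \<subseteq> \<Union>\<F>" by (simp add: I_def)
qed

lemma CO_spectrum: "CO (spectrum L) = stone L ` carrier L"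
proof
  show "stone L ` carrier L \<subseteq> CO (spectrum L)"
    by (auto simp: CO_def openin_stone compactin_stone)
  show "CO (spectrum L) \<subseteq> stone L ` carrier L"
  proof
    fix W assume W: "W \<in> CO (spectrum L)"
    have "\<exists>V\<in>stone L ` carrier L. P \<in> V \<and> V \<subseteq> W" if "P \<in> W" for P
      using CO_openin[OF W] that unfolding openin_spectrum_iff by (metis imageI)
    moreover have "openin (spectrum L) V" if "V \<in> stone L ` carrier L" for V
      using that openin_stone by blast
    ultimately obtain \<F> where \<F>: "finite \<F>" "\<F> \<subseteq> stone L ` carrier L" "W \<subseteq> \<Union>\<F>" "\<Union>\<F> \<subseteq> W"
      by (rule compactin_base_cover[OF CO_compactin[OF W] subset_refl])
    then have "W = \<Union>\<F>" by (intro equalityI)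
    then show "W \<in> stone L ` carrier L" using stone_finite_Union[OF \<F>(1,2)] by simp
  qed
qed

lemma irreducible_closedin_spectrum_generic:
  assumes F: "irreducible_closedin (spectrum L) F"
  shows "\<exists>P\<in>F. \<forall>U\<in>CO (spectrum L). U \<inter> F \<noteq> {} \<longrightarrow> P \<in> U"
proof
  have closed: "closedin (spectrum L) F" and "F \<noteq> {}" using F by (auto simp: irreducible_closedin_def)
  have F_prime: "F \<subseteq> prime_filters L" using closedin_subset[OF closed] by simp
  define P where "P = {a \<in> carrier L. stone L a \<inter> F \<noteq> {}}"
  have P_prime: "P \<in> prime_filters L"
  proof (rule prime_filterI)
    show "lattice_filter L P"
      unfolding lattice_filter_def
    proof (intro conjI ballI impI)
      show "P \<subseteq> carrier L" by (auto simp: P_def)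
      have "\<top> \<in> P" using \<open>F \<noteq> {}\<close> F_prime by (auto simp: P_def stone_top)
      then show "P \<noteq> {}" by blast
      show "b \<in> P" if "a \<in> P" "b \<in> carrier L" "a \<sqsubseteq> b" for a b
        using that stone_subset_iff[of a b] unfolding P_def by blast
      fix a b assume ab: "a \<in> P" "b \<in> P"
      then have "F \<inter> \<Inter>{stone L a, stone L b} \<noteq> {}"
        by (intro irreducible_closedin_meets_finite_Inter[OF F]) (auto simp: P_def openin_stone)
      then show "a \<sqinter> b \<in> P" using ab by (auto simp: P_def stone_meet)
    qed
    show "\<bottom> \<notin> P" by (auto simp: P_def stone_bottom)
    show "a \<in> P \<or> b \<in> P" if "a \<in> carrier L" "b \<in> carrier L" "a \<squnion> b \<in> P" for a b
      using that by (auto simp: P_def stone_join)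
  qed
  show "P \<in> F"
  proof (rule ccontr)
    assume "P \<notin> F"
    moreover have "openin (spectrum L) (prime_filters L - F)" using closed by (simp add: closedin_def)
    ultimately obtain a where "a \<in> carrier L" "P \<in> stone L a" "stone L a \<subseteq> prime_filters L - F"
      using P_prime unfolding openin_spectrum_iff by (meson DiffI)
    then show False by (auto simp: P_def stone_def)
  qed
  show "\<forall>U\<in>CO (spectrum L). U \<inter> F \<noteq> {} \<longrightarrow> P \<in> U"
    using P_prime by (auto simp: CO_spectrum in_stone_iff) (auto simp: P_def stone_def)
qed

theorem spectral_space_spectrum: "spectral_space (spectrum L)"
proof (rule spectral_spaceI)
  show "topspace (spectrum L) \<in> CO (spectrum L)"
    unfolding CO_spectrum topspace_spectrum stone_top[symmetric] by blast
  show "U \<inter> V \<in> CO (spectrum L)" if "U \<in> CO (spectrum L)" "V \<in> CO (spectrum L)" for U V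
  proof -
    obtain a b where "a \<in> carrier L" "U = stone L a" "b \<in> carrier L" "V = stone L b"
      using \<open>U \<in> _\<close> \<open>V \<in> _\<close> by (auto simp: CO_spectrum)
    then have "U \<inter> V = stone L (a \<sqinter> b)" "a \<sqinter> b \<in> carrier L" by (simp_all add: stone_meet)
    then show ?thesis unfolding CO_spectrum by blast
  qed
  show "\<exists>V\<in>CO (spectrum L). P \<in> V \<and> V \<subseteq> U" if "openin (spectrum L) U" "P \<in> U" for U P
    using that unfolding openin_spectrum_iff CO_spectrum by (metis imageI)
  show "P = Q" if PQ: "P \<in> topspace (spectrum L)" "Q \<in> topspace (spectrum L)"
    and "\<And>U. U \<in> CO (spectrum L) \<Longrightarrow> P \<in> U \<longleftrightarrow> Q \<in> U" for P Q
  proof -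
    have "a \<in> P \<longleftrightarrow> a \<in> Q" if "a \<in> carrier L" for a
      using that \<open>\<And>U. U \<in> CO (spectrum L) \<Longrightarrow> P \<in> U \<longleftrightarrow> Q \<in> U\<close>[of "stone L a"] PQ
      by (simp add: CO_spectrum in_stone_iff)
    moreover have "P \<subseteq> carrier L" "Q \<subseteq> carrier L" using PQ prime_filter_carrier by auto
    ultimately show ?thesis by blast
  qed
qed (rule irreducible_closedin_spectrum_generic)

sublocale spectrum: spectral "spectrum L"
  by unfold_locales (rule spectral_space_spectrum)

lemma in_closure_of_prime_filter_iff:
  assumes "Q \<in> prime_filters L"
  shows "P \<in> spectrum L closure_of {Q} \<longleftrightarrow> P \<in> prime_filters L \<and> P \<subseteq> Q"
  unfolding spectrum.in_closure_of_point_iff_CO CO_spectrum topspace_spectrum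
  using assms prime_filter_carrier by (auto simp: stone_def)

lemma Sat_spectrum:
  assumes "P \<in> prime_filters L"
  shows "Sat (spectrum L) P = {Q \<in> prime_filters L. P \<subseteq> Q}"
proof (rule Set.set_eqI)
  show "Q \<in> Sat (spectrum L) P \<longleftrightarrow> Q \<in> {Q \<in> prime_filters L. P \<subseteq> Q}" for Q
    using assms by (cases "Q \<in> prime_filters L") (simp_all add: in_Sat_iff in_closure_of_prime_filter_iff)
qed

lemma doubly_spectral_stone: "a \<in> carrier L \<Longrightarrow> doubly_spectral (spectrum L) (stone L a)"
  by (rule spectrum.doubly_spectral_CO) (simp add: CO_spectrum)

lemma doubly_spectral_Compl_stone:
  "a \<in> carrier L \<Longrightarrow> doubly_spectral (spectrum L) (prime_filters L - stone L a)"
  using spectrum.doubly_spectral_Compl[OF doubly_spectral_stone] by simp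

lemma closure_of_stone_Diff:
  assumes a: "a \<in> carrier L" and b: "b \<in> carrier L" and heyting_imp: "is_heyting_imp L a b c"
  shows "spectrum L closure_of (stone L a - stone L b) = prime_filters L - stone L c"
    (is "?cl = ?compl")
proof
  have c_closed: "c \<in> carrier L" and imp: "\<And>x. x \<in> carrier L \<Longrightarrow> x \<sqinter> a \<sqsubseteq> b \<longleftrightarrow> x \<sqsubseteq> c"
    using heyting_imp by (auto simp: is_heyting_imp_def)
  have "stone L (c \<sqinter> a) \<subseteq> stone L b"
    using imp[OF c_closed] stone_subset_iff[of "c \<sqinter> a" b] a b c_closed by simp
  then have "stone L a - stone L b \<subseteq> ?compl"
    unfolding stone_meet[OF c_closed a] by (auto simp: in_stone_iff)
  moreover have "closedin (spectrum L) ?compl"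
    using closedin_diff[OF closedin_topspace openin_stone[OF c_closed]] by simp
  ultimately show "?cl \<subseteq> ?compl"
    by (rule closure_of_minimal)
  show "?compl \<subseteq> ?cl"
  proof
    fix P assume "P \<in> ?compl"
    then have P: "P \<in> prime_filters L" "c \<notin> P" by (auto simp: stone_def)
    have "\<not> p \<sqinter> a \<sqsubseteq> b" if "p \<in> P" for p
      using that imp prime_filter_carrier[OF P(1)] prime_filter_upward[OF P(1) _ _ c_closed] P(2) by blast
    then obtain Q where Q: "Q \<in> prime_filters L" "P \<subseteq> Q" "{a} \<subseteq> Q" "Q \<inter> {b} = {}"
      using prime_filter_extension[OF prime_filter_down_directed[OF P(1)]
          down_directed_singleton[OF a] up_directed_singleton[OF b]] by auto
    then have "P \<in> spectrum L closure_of {Q}" "{Q} \<subseteq> stone L a - stone L b"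
      using P by (auto simp: in_closure_of_prime_filter_iff in_stone_iff)
    then show "P \<in> ?cl" using closure_of_mono by blast
  qed
qed

theorem heyting_spectral_space_spectrum:
  assumes "heyting_algebra L"
  shows "heyting_spectral_space (spectrum L)"
  unfolding heyting_spectral_space_def
proof (intro conjI allI impI)
  fix Y assume "doubly_spectral (spectrum L) Y"
  then show "doubly_spectral (spectrum L) (spectrum L closure_of Y)"
  proof (rule spectrum.doubly_spectral_additive_operator[OF _ closure_of_Union])
    fix U V assume "U \<in> CO (spectrum L)" "V \<in> CO (spectrum L)"
    then obtain a b where ab: "a \<in> carrier L" "U = stone L a" "b \<in> carrier L" "V = stone L b"
      by (auto simp: CO_spectrum)
    then obtain c where heyting_imp: "is_heyting_imp L a b c"
      using assms unfolding heyting_algebra_def by meson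
    then have "c \<in> carrier L" by (simp add: is_heyting_imp_def)
    then show "doubly_spectral (spectrum L) (spectrum L closure_of (U - V))"
      unfolding ab(2,4) closure_of_stone_Diff[OF ab(1,3) heyting_imp] by (rule doubly_spectral_Compl_stone)
  qed
qed (rule spectral_space_spectrum)

end

section \<open>The spectral map of a lattice homomorphism\<close>

lemma is_heyting_imp_unique:
  assumes "partial_order L" and heyting_imp: "is_heyting_imp L a b c" "is_heyting_imp L a b d"
  shows "c = d"
proof -
  interpret partial_order L by (rule assms(1))
  have closed: "c \<in> carrier L" "d \<in> carrier L" using heyting_imp by (auto simp: is_heyting_imp_def)
  moreover have "c \<sqsubseteq>\<^bsub>L\<^esub> d" "d \<sqsubseteq>\<^bsub>L\<^esub> c"
    using heyting_imp closed le_refl unfolding is_heyting_imp_def by metis+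
  ultimately show ?thesis by (intro le_antisym)
qed

definition spectrum_map ::
  "('a, 'm) gorder_scheme \<Rightarrow> ('b, 'n) gorder_scheme \<Rightarrow> ('a \<Rightarrow> 'b) \<Rightarrow> 'b set \<Rightarrow> 'a set" where
  "spectrum_map L M f = (\<lambda>Q\<in>prime_filters M. {a \<in> carrier L. f a \<in> Q})"

locale bounded_lattice_hom = L: distrib_bounded_lattice L + M: distrib_bounded_lattice M
  for L :: "('a, 'm) gorder_scheme" and M :: "('b, 'n) gorder_scheme" +
  fixes f :: "'a \<Rightarrow> 'b"
  assumes hom_closed [simp]: "a \<in> carrier L \<Longrightarrow> f a \<in> carrier M"
    and hom_top: "f \<top>\<^bsub>L\<^esub> = \<top>\<^bsub>M\<^esub>" and hom_bottom: "f \<bottom>\<^bsub>L\<^esub> = \<bottom>\<^bsub>M\<^esub>"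
    and hom_meet: "a \<in> carrier L \<Longrightarrow> b \<in> carrier L \<Longrightarrow> f (a \<sqinter>\<^bsub>L\<^esub> b) = f a \<sqinter>\<^bsub>M\<^esub> f b"
    and hom_join: "a \<in> carrier L \<Longrightarrow> b \<in> carrier L \<Longrightarrow> f (a \<squnion>\<^bsub>L\<^esub> b) = f a \<squnion>\<^bsub>M\<^esub> f b"
begin

lemma hom_mono:
  assumes "a \<in> carrier L" "b \<in> carrier L" "a \<sqsubseteq>\<^bsub>L\<^esub> b"
  shows "f a \<sqsubseteq>\<^bsub>M\<^esub> f b"
proof -
  have "a = a \<sqinter>\<^bsub>L\<^esub> b" using assms L.le_iff_join by simp
  then have "f a = f a \<sqinter>\<^bsub>M\<^esub> f b" using hom_meet[OF assms(1,2)] by simp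
  then show ?thesis using M.le_iff_join assms by simp
qed

lemma hom_isotone: "isotone L M f"
  by (intro isotoneI) (auto intro: hom_mono L.weak_partial_order_axioms M.weak_partial_order_axioms)

lemma spectrum_map_apply: "Q \<in> prime_filters M \<Longrightarrow> spectrum_map L M f Q = {a \<in> carrier L. f a \<in> Q}"
  by (simp add: spectrum_map_def)

lemma spectrum_map_closed:
  assumes Q: "Q \<in> prime_filters M"
  shows "spectrum_map L M f Q \<in> prime_filters L"
  unfolding spectrum_map_apply[OF Q]
proof (rule L.prime_filterI)
  show "lattice_filter L {a \<in> carrier L. f a \<in> Q}"
    unfolding lattice_filter_def
    using M.prime_filter_top[OF Q] M.prime_filter_meet_iff[OF Q] M.prime_filter_upward[OF Q] hom_mono
    by (auto simp: hom_meet hom_top[symmetric])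
qed (use M.prime_filter_bottom[OF Q] M.prime_filter_join_iff[OF Q] in \<open>auto simp: hom_bottom hom_join\<close>)

lemma spectrum_map_vimage_stone:
  "a \<in> carrier L \<Longrightarrow> {Q \<in> prime_filters M. spectrum_map L M f Q \<in> stone L a} = stone M (f a)"
  using spectrum_map_closed by (auto simp: stone_def spectrum_map_apply)

theorem spectral_map_spectrum_map: "spectral_map (spectrum M) (spectrum L) (spectrum_map L M f)"
proof (rule spectral_mapI[OF M.spectral_space_spectrum L.spectral_space_spectrum])
  show "spectrum_map L M f \<in> topspace (spectrum M) \<rightarrow> topspace (spectrum L)"
    using spectrum_map_closed by simp
  fix V assume "V \<in> CO (spectrum L)"
  then obtain a where "a \<in> carrier L" "V = stone L a" by (auto simp: L.CO_spectrum)
  then show "{Q \<in> topspace (spectrum M). spectrum_map L M f Q \<in> V} \<in> CO (spectrum M)"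
    by (simp add: spectrum_map_vimage_stone M.CO_spectrum)
qed

lemma prime_filter_lift:
  assumes K: "down_directed M K" and Q: "Q \<in> prime_filters L"
    and separated: "\<And>k q c. k \<in> K \<Longrightarrow> q \<in> Q \<Longrightarrow> c \<in> carrier L \<Longrightarrow> k \<sqinter>\<^bsub>M\<^esub> f q \<sqsubseteq>\<^bsub>M\<^esub> f c \<Longrightarrow> c \<in> Q"
  obtains P where "P \<in> prime_filters M" "K \<subseteq> P" "spectrum_map L M f P = Q"
proof -
  have f: "f \<in> carrier L \<rightarrow> carrier M" by simp
  obtain P where P: "P \<in> prime_filters M" "K \<subseteq> P" "f ` Q \<subseteq> P" "P \<inter> f ` (carrier L - Q) = {}"
  proof (rule M.prime_filter_extension[OF K])
    show "down_directed M (f ` Q)"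
      by (rule down_directed_image[OF L.prime_filter_down_directed[OF Q] hom_isotone f])
    show "up_directed M (f ` (carrier L - Q))"
      by (rule up_directed_image[OF L.prime_filter_Compl_up_directed[OF Q] hom_isotone f])
  qed (use separated in auto)
  have "spectrum_map L M f P = Q"
    unfolding spectrum_map_apply[OF P(1)] using P(3,4) L.prime_filter_carrier[OF Q] by blast
  then show thesis using that P(1,2) by blast
qed

lemma spectrum_map_image_Sat:
  assumes L: "heyting_algebra L"
    and preserves: "\<And>a b c. a \<in> carrier L \<Longrightarrow> b \<in> carrier L \<Longrightarrow> is_heyting_imp L a b c \<Longrightarrow>
      is_heyting_imp M (f a) (f b) (f c)"
    and P: "P \<in> prime_filters M"
  shows "spectrum_map L M f ` Sat (spectrum M) P = Sat (spectrum L) (spectrum_map L M f P)"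
  unfolding M.Sat_spectrum[OF P] L.Sat_spectrum[OF spectrum_map_closed[OF P]]
proof
  show "spectrum_map L M f ` {Q \<in> prime_filters M. P \<subseteq> Q} \<subseteq> {Q \<in> prime_filters L. spectrum_map L M f P \<subseteq> Q}"
    using P spectrum_map_closed by (auto simp: spectrum_map_apply)
  show "{Q \<in> prime_filters L. spectrum_map L M f P \<subseteq> Q} \<subseteq> spectrum_map L M f ` {Q \<in> prime_filters M. P \<subseteq> Q}"
  proof
    fix Q assume "Q \<in> {Q \<in> prime_filters L. spectrum_map L M f P \<subseteq> Q}"
    then have Q: "Q \<in> prime_filters L" and subset: "\<And>a. a \<in> carrier L \<Longrightarrow> f a \<in> P \<Longrightarrow> a \<in> Q"
      using P by (auto simp: spectrum_map_apply)
    obtain Q' where "Q' \<in> prime_filters M" "P \<subseteq> Q'" "spectrum_map L M f Q' = Q"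
    proof (rule prime_filter_lift[OF M.prime_filter_down_directed[OF P] Q])
      fix p q c assume p: "p \<in> P" and q: "q \<in> Q" and c: "c \<in> carrier L"
        and below: "p \<sqinter>\<^bsub>M\<^esub> f q \<sqsubseteq>\<^bsub>M\<^esub> f c"
      have q_closed: "q \<in> carrier L" using L.prime_filter_carrier[OF Q q] .
      obtain d where heyting_imp: "is_heyting_imp L q c d" "is_heyting_imp M (f q) (f c) (f d)"
        using L q_closed c preserves unfolding heyting_algebra_def by meson
      have d_closed: "d \<in> carrier L" using heyting_imp(1) by (simp add: is_heyting_imp_def)
      have "p \<sqsubseteq>\<^bsub>M\<^esub> f d" using heyting_imp(2) below M.prime_filter_carrier[OF P p] by (simp add: is_heyting_imp_def)
      then have "f d \<in> P" using M.prime_filter_upward[OF P p] d_closed by simp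
      then have "d \<sqinter>\<^bsub>L\<^esub> q \<in> Q"
        using L.prime_filter_meet_iff[OF Q d_closed q_closed] subset[OF d_closed] q by simp
      moreover have "d \<sqinter>\<^bsub>L\<^esub> q \<sqsubseteq>\<^bsub>L\<^esub> c" using heyting_imp(1) d_closed by (simp add: is_heyting_imp_def)
      ultimately show "c \<in> Q" using L.prime_filter_upward[OF Q _ _ c] by blast
    qed
    then show "Q \<in> spectrum_map L M f ` {Q \<in> prime_filters M. P \<subseteq> Q}" by blast
  qed
qed

theorem heyting_spectral_map_spectrum_map:
  assumes "heyting_algebra L" "heyting_algebra M"
    and "\<And>a b c. a \<in> carrier L \<Longrightarrow> b \<in> carrier L \<Longrightarrow> is_heyting_imp L a b c \<Longrightarrow>
      is_heyting_imp M (f a) (f b) (f c)"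
  shows "heyting_spectral_map (spectrum M) (spectrum L) (spectrum_map L M f)"
  unfolding heyting_spectral_map_def
  using assms L.heyting_spectral_space_spectrum M.heyting_spectral_space_spectrum
    spectral_map_spectrum_map spectrum_map_image_Sat by simp

lemma hom_le_iff:
  assumes inj: "inj_on f (carrier L)" and a: "a \<in> carrier L" and b: "b \<in> carrier L"
  shows "f a \<sqsubseteq>\<^bsub>M\<^esub> f b \<longleftrightarrow> a \<sqsubseteq>\<^bsub>L\<^esub> b"
proof
  assume "f a \<sqsubseteq>\<^bsub>M\<^esub> f b"
  then have "f a = f (a \<sqinter>\<^bsub>L\<^esub> b)" using M.le_iff_join a b by (simp add: hom_meet)
  then have "a = a \<sqinter>\<^bsub>L\<^esub> b" using inj a b by (simp add: inj_on_eq_iff)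
  then show "a \<sqsubseteq>\<^bsub>L\<^esub> b" using L.le_iff_join a b by simp
qed (rule hom_mono[OF a b])

lemma bij_betw_hom_is_heyting_imp:
  assumes bij: "bij_betw f (carrier L) (carrier M)"
    and a: "a \<in> carrier L" and b: "b \<in> carrier L" and heyting_imp: "is_heyting_imp L a b c"
  shows "is_heyting_imp M (f a) (f b) (f c)"
  unfolding is_heyting_imp_def
proof (intro conjI ballI)
  have c_closed: "c \<in> carrier L" using heyting_imp by (simp add: is_heyting_imp_def)
  then show "f c \<in> carrier M" by simp
  fix y assume "y \<in> carrier M"
  then obtain x where x: "x \<in> carrier L" "y = f x" using bij by (auto simp: bij_betw_def)
  have "x \<sqinter>\<^bsub>L\<^esub> a \<sqsubseteq>\<^bsub>L\<^esub> b \<longleftrightarrow> x \<sqsubseteq>\<^bsub>L\<^esub> c" using heyting_imp x(1) by (simp add: is_heyting_imp_def)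
  then show "y \<sqinter>\<^bsub>M\<^esub> f a \<sqsubseteq>\<^bsub>M\<^esub> f b \<longleftrightarrow> y \<sqsubseteq>\<^bsub>M\<^esub> f c"
    using x a b c_closed hom_le_iff[OF bij_betw_imp_inj_on[OF bij]] by (simp flip: hom_meet)
qed

end

section \<open>The space of a nabla-algebra\<close>

locale nabla_lattice = distrib_bounded_lattice A for A :: "('a, 'm) nabla_alg_scheme" (structure) +
  assumes nabla_algebra: "nabla_algebra A"
begin

lemma nab_closed [simp]: "a \<in> carrier A \<Longrightarrow> nab A a \<in> carrier A"
  and arr_closed [simp]: "a \<in> carrier A \<Longrightarrow> b \<in> carrier A \<Longrightarrow> arr A a b \<in> carrier A"
  using nabla_algebra by (simp_all add: nabla_algebra_def)

lemma nab_meet_le_iff: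
  "a \<in> carrier A \<Longrightarrow> b \<in> carrier A \<Longrightarrow> c \<in> carrier A \<Longrightarrow> nab A c \<sqinter> a \<sqsubseteq> b \<longleftrightarrow> c \<sqsubseteq> arr A a b"
  using nabla_algebra by (simp add: nabla_algebra_def)

lemma nab_arr_meet_le: "a \<in> carrier A \<Longrightarrow> b \<in> carrier A \<Longrightarrow> nab A (arr A a b) \<sqinter> a \<sqsubseteq> b"
  by (simp add: nab_meet_le_iff)

lemma box_closed [simp]: "a \<in> carrier A \<Longrightarrow> box A a \<in> carrier A"
  by (simp add: box_def)

lemma nab_le_iff: "b \<in> carrier A \<Longrightarrow> c \<in> carrier A \<Longrightarrow> nab A c \<sqsubseteq> b \<longleftrightarrow> c \<sqsubseteq> box A b"
  using nab_meet_le_iff[of \<top> b c] by (simp add: meet_top box_def)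

lemma galois_connection_nab_box:
  "galois_connection \<lparr>orderA = A, orderB = A, lower = nab A, upper = box A\<rparr>"
  by (intro galois_connection.intro connection.intro galois_connection_axioms.intro)
    (simp_all add: nab_le_iff partial_order_axioms)

lemma nab_isotone: "isotone A A (nab A)"
  using galois_connection.lower_iso[OF galois_connection_nab_box] by simp

lemma box_isotone: "isotone A A (box A)"
  using galois_connection.upper_iso[OF galois_connection_nab_box] by simp

lemma nab_box_le: "b \<in> carrier A \<Longrightarrow> nab A (box A b) \<sqsubseteq> b"
  by (simp add: nab_le_iff)

lemma le_box_nab: "c \<in> carrier A \<Longrightarrow> c \<sqsubseteq> box A (nab A c)"
  by (simp flip: nab_le_iff)

lemma nab_box_eq:
  assumes "nab A ` carrier A = carrier A" "a \<in> carrier A"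
  shows "nab A (box A a) = a"
proof -
  obtain c where "c \<in> carrier A" "a = nab A c" using assms by blast
  then show ?thesis using galois_connection.lower_comp[OF galois_connection_nab_box] by simp
qed

lemma box_nab_eq:
  assumes "box A ` carrier A = carrier A" "a \<in> carrier A"
  shows "box A (nab A a) = a"
proof -
  obtain c where "c \<in> carrier A" "a = box A c" using assms by blast
  then show ?thesis using galois_connection.upper_comp[OF galois_connection_nab_box] by simp
qed

lemma nab_bottom: "nab A \<bottom> = \<bottom>"
proof (rule le_antisym)
  show "nab A \<bottom> \<sqsubseteq> \<bottom>" by (simp add: nab_le_iff)
qed auto

lemma nab_join:
  assumes a: "a \<in> carrier A" and b: "b \<in> carrier A"
  shows "nab A (a \<squnion> b) = nab A a \<squnion> nab A b"
proof (rule le_antisym)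
  have "a \<sqsubseteq> box A (nab A a \<squnion> nab A b)" "b \<sqsubseteq> box A (nab A a \<squnion> nab A b)"
    using assms join_left join_right by (simp_all flip: nab_le_iff)
  then have "a \<squnion> b \<sqsubseteq> box A (nab A a \<squnion> nab A b)"
    using assms by (intro join_le) auto
  then show "nab A (a \<squnion> b) \<sqsubseteq> nab A a \<squnion> nab A b" using assms by (simp add: nab_le_iff)
  show "nab A a \<squnion> nab A b \<sqsubseteq> nab A (a \<squnion> b)"
    using assms join_left join_right by (intro join_le use_iso2[OF nab_isotone]) auto
qed (use assms in auto)

lemma prime_filter_nab_preimage:
  assumes Q: "Q \<in> prime_filters A" and K: "down_directed A K" "nab A ` K \<subseteq> Q"
  obtains P where "P \<in> prime_filters A" "K \<subseteq> P" "nab A ` P \<subseteq> Q"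
proof -
  define I where "I = {b \<in> carrier A. nab A b \<notin> Q}"
  have "up_directed A I"
    unfolding up_directed_def
  proof (intro conjI ballI)
    show "I \<subseteq> carrier A" by (auto simp: I_def)
    have "\<bottom> \<in> I" using prime_filter_bottom[OF Q] by (simp add: I_def nab_bottom)
    then show "I \<noteq> {}" by blast
    show "\<exists>d\<in>I. b \<sqsubseteq> d \<and> c \<sqsubseteq> d" if "b \<in> I" "c \<in> I" for b c
      using that prime_filter_join_iff[OF Q] join_left join_right
      by (intro bexI[of _ "b \<squnion> c"]) (auto simp: I_def nab_join)
  qed
  moreover have "\<not> k \<sqsubseteq> b" if "k \<in> K" "b \<in> I" for k b
  proof
    assume "k \<sqsubseteq> b"
    moreover have "k \<in> carrier A" "b \<in> carrier A" using K that by (auto simp: I_def down_directed_def)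
    ultimately have "nab A k \<sqsubseteq> nab A b" by (intro use_iso2[OF nab_isotone])
    then have "nab A b \<in> Q"
      using prime_filter_upward[OF Q, of "nab A k" "nab A b"] K(2) that(1) \<open>b \<in> carrier A\<close> by auto
    then show False using that(2) by (simp add: I_def)
  qed
  ultimately obtain P where P: "P \<in> prime_filters A" "K \<subseteq> P" "P \<inter> I = {}"
    by (rule prime_filter_separation[OF K(1)])
  have "nab A ` P \<subseteq> Q" using P(3) prime_filter_carrier[OF P(1)] by (auto simp: I_def)
  then show thesis using that P by blast
qed

lemma nab_image_prime_filter_down_directed:
  "P \<in> prime_filters A \<Longrightarrow> down_directed A (nab A ` P)"
  by (intro down_directed_image[OF prime_filter_down_directed nab_isotone]) auto

lemma prime_filter_nab_extension:
  assumes P: "P \<in> prime_filters A" and K: "down_directed A K" and I: "up_directed A I"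
    and separated: "\<And>k i. k \<in> K \<Longrightarrow> i \<in> I \<Longrightarrow> arr A k i \<notin> P"
  obtains Q where "Q \<in> prime_filters A" "nab A ` P \<subseteq> Q" "K \<subseteq> Q" "Q \<inter> I = {}"
proof (rule prime_filter_extension[OF nab_image_prime_filter_down_directed[OF P] K I])
  fix m k i assume "m \<in> nab A ` P" and ki: "k \<in> K" "i \<in> I"
  then obtain p where p: "p \<in> P" "m = nab A p" by blast
  have closed: "k \<in> carrier A" "i \<in> carrier A"
    using ki K I by (auto simp: down_directed_def up_directed_def)
  show "\<not> m \<sqinter> k \<sqsubseteq> i"
  proof
    assume "m \<sqinter> k \<sqsubseteq> i"
    then have "p \<sqsubseteq> arr A k i" using nab_meet_le_iff closed prime_filter_carrier[OF P p(1)] p(2) by simp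
    then have "arr A k i \<in> P" using prime_filter_upward[OF P p(1)] closed by simp
    then show False using separated ki by blast
  qed
qed (rule that)

lemma Top_spec_obj: "Top (spec_obj A) = spectrum A"
proof -
  have "{{P \<in> prime_filters A. a \<in> P} |a. a \<in> carrier A} = stone A ` carrier A"
    by (auto simp: stone_def)
  then show ?thesis by (simp add: spec_obj_def spectrum_def)
qed

lemma pts_spec_obj: "pts (spec_obj A) = prime_filters A"
  by (simp add: Top_spec_obj)

lemma Rel_spec_obj_iff:
  "(P, Q) \<in> Rel (spec_obj A) \<longleftrightarrow> P \<in> prime_filters A \<and> Q \<in> prime_filters A \<and> nab A ` P \<subseteq> Q"
  by (simp add: spec_obj_def)

lemma alpha_eq_stone: "a \<in> carrier A \<Longrightarrow> alpha A a = stone A a"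
  by (simp add: alpha_def stone_def)

lemma nabla_rel_stone:
  assumes a: "a \<in> carrier A"
  shows "nabla_rel (Rel (spec_obj A)) (stone A a) = stone A (nab A a)"
proof
  show "nabla_rel (Rel (spec_obj A)) (stone A a) \<subseteq> stone A (nab A a)"
    by (auto simp: nabla_rel_def Rel_spec_obj_iff stone_def)
  show "stone A (nab A a) \<subseteq> nabla_rel (Rel (spec_obj A)) (stone A a)"
  proof
    fix Q assume "Q \<in> stone A (nab A a)"
    then have Q: "Q \<in> prime_filters A" "nab A ` {a} \<subseteq> Q" by (auto simp: stone_def)
    obtain P where "P \<in> prime_filters A" "{a} \<subseteq> P" "nab A ` P \<subseteq> Q"
      using prime_filter_nab_preimage[OF Q(1) down_directed_singleton[OF a] Q(2)] .
    then show "Q \<in> nabla_rel (Rel (spec_obj A)) (stone A a)"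
      using Q(1) by (auto simp: nabla_rel_def Rel_spec_obj_iff stone_def)
  qed
qed

lemma lozenge_rel_stone_Diff:
  assumes a: "a \<in> carrier A" and b: "b \<in> carrier A"
  shows "lozenge_rel (Rel (spec_obj A)) (stone A a - stone A b) = prime_filters A - stone A (arr A a b)"
    (is "?lozenge = ?compl")
proof
  show "?lozenge \<subseteq> ?compl"
  proof
    fix P assume "P \<in> ?lozenge"
    then obtain Q where P: "P \<in> prime_filters A"
      and Q: "Q \<in> prime_filters A" "nab A ` P \<subseteq> Q" "a \<in> Q" "b \<notin> Q"
      by (auto simp: lozenge_rel_def Rel_spec_obj_iff stone_def)
    have "arr A a b \<notin> P"
    proof
      assume "arr A a b \<in> P"
      then have "nab A (arr A a b) \<sqinter> a \<in> Q" using prime_filter_meet_iff[OF Q(1)] Q(2,3) a b by auto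
      then show False using prime_filter_upward[OF Q(1) _ nab_arr_meet_le b] Q(4) a b by simp
    qed
    then show "P \<in> ?compl" using P by (simp add: stone_def)
  qed
  show "?compl \<subseteq> ?lozenge"
  proof
    fix P assume "P \<in> ?compl"
    then have P: "P \<in> prime_filters A" "arr A a b \<notin> P" by (auto simp: stone_def)
    obtain Q where "Q \<in> prime_filters A" "nab A ` P \<subseteq> Q" "{a} \<subseteq> Q" "Q \<inter> {b} = {}"
      by (rule prime_filter_nab_extension[OF P(1) down_directed_singleton[OF a] up_directed_singleton[OF b]])
        (use P(2) in auto)
    then show "P \<in> ?lozenge"
      using P(1) by (auto simp: lozenge_rel_def Rel_spec_obj_iff stone_def)
  qed
qed

lemma arrow_rel_stone:
  assumes "a \<in> carrier A" "b \<in> carrier A"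
  shows "arrow_rel (spec_obj A) (stone A a) (stone A b) = stone A (arr A a b)"
proof -
  have "arrow_rel (spec_obj A) (stone A a) (stone A b) =
      prime_filters A - lozenge_rel (Rel (spec_obj A)) (stone A a - stone A b)"
    unfolding arrow_rel_def lozenge_rel_def pts_spec_obj by blast
  then show ?thesis
    unfolding lozenge_rel_stone_Diff[OF assms] by (auto simp: stone_def)
qed

lemma doubly_spectral_lozenge_rel:
  assumes "doubly_spectral (spectrum A) Y"
  shows "doubly_spectral (spectrum A) (lozenge_rel (Rel (spec_obj A)) Y)"
proof (rule spectrum.doubly_spectral_additive_operator[OF assms])
  show "lozenge_rel (Rel (spec_obj A)) (\<Union>\<F>) = \<Union>(lozenge_rel (Rel (spec_obj A)) ` \<F>)" for \<F>
    by (auto simp: lozenge_rel_def)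
  show "doubly_spectral (spectrum A) (lozenge_rel (Rel (spec_obj A)) (U - V))"
    if "U \<in> CO (spectrum A)" "V \<in> CO (spectrum A)" for U V
    using that by (auto simp: CO_spectrum lozenge_rel_stone_Diff doubly_spectral_Compl_stone)
qed

lemma compactin_saturated_in_Rel_spec_obj:
  assumes P: "P \<in> prime_filters A"
  defines "R \<equiv> {Q. (P, Q) \<in> Rel (spec_obj A)}"
  shows "compactin (spectrum A) R" "saturated_in (spectrum A) R"
proof -
  let ?\<U> = "(\<lambda>a. stone A (nab A a)) ` P"
  have R: "R = topspace (spectrum A) \<inter> \<Inter>?\<U>"
    using P by (auto simp: R_def Rel_spec_obj_iff stone_def)
  have CO: "?\<U> \<subseteq> CO (spectrum A)"
    using prime_filter_carrier[OF P] by (auto simp: CO_spectrum)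
  then show "saturated_in (spectrum A) R"
    unfolding saturated_in_def R by (intro exI[of _ ?\<U>]) (auto intro: CO_openin)
  have "closedin (patch (spectrum A)) (\<Inter>(insert (topspace (spectrum A)) ?\<U>))"
    using CO closedin_patch_CO spectrum.CO_topspace by (intro closedin_Inter) auto
  then show "compactin (spectrum A) R"
    unfolding R by (intro spectrum.closedin_patch_imp_compactin) simp
qed

lemma co_saturated_in_Rel_spec_obj: "co_saturated_in (spectrum A) {P. (P, Q) \<in> Rel (spec_obj A)}"
  unfolding co_saturated_in_iff
  by (auto simp: Rel_spec_obj_iff in_closure_of_prime_filter_iff subset_iff)

theorem nabla_spectral_space_spec_obj: "nabla_spectral_space (spec_obj A)"
proof -
  have "Rel (spec_obj A) \<subseteq> prime_filters A \<times> prime_filters A"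
    by (auto simp: Rel_spec_obj_iff)
  moreover have "nabla_rel (Rel (spec_obj A)) V \<in> CO (spectrum A)" if "V \<in> CO (spectrum A)" for V
    using that by (auto simp: CO_spectrum nabla_rel_stone)
  ultimately show ?thesis
    unfolding nabla_spectral_space_def Top_spec_obj topspace_spectrum
    using spectral_space_spectrum compactin_saturated_in_Rel_spec_obj co_saturated_in_Rel_spec_obj
      doubly_spectral_lozenge_rel by simp
qed

lemma space_satisfies_CN_spec_obj:
  assumes CN: "alg_satisfies A CN"
  shows "space_satisfies (spec_obj A) CN"
proof -
  interpret nab: bounded_lattice_hom A A "nab A"
    by unfold_locales (use CN nab_bottom nab_join in auto)
  have "(P, Q) \<in> Rel (spec_obj A) \<longleftrightarrow> P \<in> spectrum A closure_of {spectrum_map A A (nab A) Q}"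
    if "P \<in> prime_filters A" "Q \<in> prime_filters A" for P Q
    using that nab.spectrum_map_closed[OF that(2)] prime_filter_carrier[OF that(1)]
    by (auto simp: Rel_spec_obj_iff in_closure_of_prime_filter_iff nab.spectrum_map_apply)
  then show ?thesis
    using spectral_map_continuous_map[OF nab.spectral_map_spectrum_map]
    unfolding space_satisfies.simps Top_spec_obj topspace_spectrum by blast
qed

lemma space_satisfies_CR_spec_obj:
  assumes CR: "alg_satisfies A CR"
  shows "space_satisfies (spec_obj A) CR"
proof -
  have "(P, P) \<in> Rel (spec_obj A)" if P: "P \<in> prime_filters A" for P
    using P CR prime_filter_upward[OF P] prime_filter_carrier[OF P] by (auto simp: Rel_spec_obj_iff)
  then show ?thesis by (simp add: pts_spec_obj)
qed

lemma space_satisfies_CL_spec_obj: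
  assumes CL: "alg_satisfies A CL"
  shows "space_satisfies (spec_obj A) CL"
proof -
  have "P \<in> spectrum A closure_of {Q}" if "(P, Q) \<in> Rel (spec_obj A)" for P Q
  proof -
    have PQ: "P \<in> prime_filters A" "Q \<in> prime_filters A" "nab A ` P \<subseteq> Q"
      using that by (auto simp: Rel_spec_obj_iff)
    have "a \<in> Q" if "a \<in> P" for a
      using prime_filter_upward[OF PQ(2), of "nab A a" a] prime_filter_carrier[OF PQ(1) that] PQ(3) that CL
      by auto
    then show ?thesis using PQ by (auto simp: in_closure_of_prime_filter_iff)
  qed
  then show ?thesis by (auto simp: Top_spec_obj)
qed

lemma space_satisfies_CFa_spec_obj:
  assumes CFa: "alg_satisfies A CFa"
  shows "space_satisfies (spec_obj A) CFa"
  unfolding space_satisfies.simps Top_spec_obj topspace_spectrum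
proof
  fix P assume P: "P \<in> prime_filters A"
  have nab_box: "nab A (box A a) = a" if "a \<in> P" for a
    using CFa nab_box_eq prime_filter_carrier[OF P that] by simp
  have "down_directed A (box A ` P)"
    by (rule down_directed_image[OF prime_filter_down_directed[OF P] box_isotone]) simp
  then obtain Q where Q: "Q \<in> prime_filters A" "box A ` P \<subseteq> Q" "nab A ` Q \<subseteq> P"
    by (rule prime_filter_nab_preimage[OF P]) (use nab_box in auto)
  have "P \<in> spectrum A closure_of {Z}" if "(Q, Z) \<in> Rel (spec_obj A)" for Z
  proof -
    have Z: "Z \<in> prime_filters A" "nab A ` Q \<subseteq> Z" using that by (auto simp: Rel_spec_obj_iff)
    have "nab A (box A a) \<in> Z" if "a \<in> P" for a using that Q(2) Z(2) by blast
    then have "P \<subseteq> Z" using nab_box by auto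
    then show ?thesis using P Z by (simp add: in_closure_of_prime_filter_iff)
  qed
  then show "\<exists>Q. (Q, P) \<in> Rel (spec_obj A) \<and>
      (\<forall>Z. (Q, Z) \<in> Rel (spec_obj A) \<longrightarrow> P \<in> spectrum A closure_of {Z})"
    using P Q by (intro exI[of _ Q]) (simp add: Rel_spec_obj_iff)
qed

lemma space_satisfies_CFu_spec_obj:
  assumes CFu: "alg_satisfies A CFu"
  shows "space_satisfies (spec_obj A) CFu"
  unfolding space_satisfies.simps Top_spec_obj topspace_spectrum
proof
  fix P assume P: "P \<in> prime_filters A"
  have I: "up_directed A (nab A ` (carrier A - P))"
    by (rule up_directed_image[OF prime_filter_Compl_up_directed[OF P] nab_isotone]) simp
  have "arr A k i \<notin> P" if "k \<in> {\<top>}" "i \<in> nab A ` (carrier A - P)" for k i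
    using that box_nab_eq CFu by (auto simp flip: box_def)
  then obtain Q where Q: "Q \<in> prime_filters A" "nab A ` P \<subseteq> Q" "Q \<inter> nab A ` (carrier A - P) = {}"
    using prime_filter_nab_extension[OF P down_directed_singleton[OF top_closed] I] by metis
  have "Z \<in> spectrum A closure_of {P}" if "(Z, Q) \<in> Rel (spec_obj A)" for Z
  proof -
    have Z: "Z \<in> prime_filters A" "nab A ` Z \<subseteq> Q" using that by (auto simp: Rel_spec_obj_iff)
    have "Z \<subseteq> P" using Z(2) Q(3) prime_filter_carrier[OF Z(1)] by blast
    then show ?thesis using P Z by (simp add: in_closure_of_prime_filter_iff)
  qed
  then show "\<exists>Q. (P, Q) \<in> Rel (spec_obj A) \<and>
      (\<forall>Z. (Z, Q) \<in> Rel (spec_obj A) \<longrightarrow> Z \<in> spectrum A closure_of {P})"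
    using P Q by (intro exI[of _ Q]) (simp add: Rel_spec_obj_iff)
qed

theorem space_satisfies_spec_obj: "alg_satisfies A c \<Longrightarrow> space_satisfies (spec_obj A) c"
  using space_satisfies_CN_spec_obj space_satisfies_CR_spec_obj space_satisfies_CL_spec_obj
    space_satisfies_CFa_spec_obj space_satisfies_CFu_spec_obj heyting_spectral_space_spectrum
  by (cases c) (simp_all add: Top_spec_obj)

end

section \<open>The algebra of a nabla-spectral space\<close>

locale nabla_spectral =
  fixes S :: "'x nabla_space"
  assumes nabla_spectral_space: "nabla_spectral_space S"
begin

sublocale spectral "Top S"
  by unfold_locales (use nabla_spectral_space in \<open>simp add: nabla_spectral_space_def\<close>)

lemma Rel_closed: "(x, y) \<in> Rel S \<Longrightarrow> x \<in> pts S" "(x, y) \<in> Rel S \<Longrightarrow> y \<in> pts S"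
  using nabla_spectral_space by (auto simp: nabla_spectral_space_def)

lemma compactin_Rel: "x \<in> pts S \<Longrightarrow> compactin (Top S) {y. (x, y) \<in> Rel S}"
  and saturated_in_Rel: "x \<in> pts S \<Longrightarrow> saturated_in (Top S) {y. (x, y) \<in> Rel S}"
  and co_saturated_in_Rel: "y \<in> pts S \<Longrightarrow> co_saturated_in (Top S) {x. (x, y) \<in> Rel S}"
  and doubly_spectral_lozenge_rel:
    "doubly_spectral (Top S) Y \<Longrightarrow> doubly_spectral (Top S) (lozenge_rel (Rel S) Y)"
  and nabla_rel_CO: "V \<in> CO (Top S) \<Longrightarrow> nabla_rel (Rel S) V \<in> CO (Top S)"
  using nabla_spectral_space by (simp_all add: nabla_spectral_space_def)

lemma Rel_in_closure_of_left:
  assumes "(x, y) \<in> Rel S" "x' \<in> Top S closure_of {x}"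
  shows "(x', y) \<in> Rel S"
  using assms co_saturated_in_Rel[OF Rel_closed(2)[OF assms(1)]] unfolding co_saturated_in_iff by blast

lemma arrow_rel_eq_Compl_lozenge_rel: "arrow_rel S U V = pts S - lozenge_rel (Rel S) (U - V)"
  unfolding arrow_rel_def lozenge_rel_def by blast

lemma arrow_rel_CO:
  assumes U: "U \<in> CO (Top S)" and V: "V \<in> CO (Top S)"
  shows "arrow_rel S U V \<in> CO (Top S)"
proof (rule doubly_spectral_generalization_closed_imp_CO)
  show "doubly_spectral (Top S) (arrow_rel S U V)"
    unfolding arrow_rel_eq_Compl_lozenge_rel
    by (intro doubly_spectral_Compl doubly_spectral_lozenge_rel doubly_spectral_Diff doubly_spectral_CO U V)
  fix x y assume x: "x \<in> arrow_rel S U V" and y: "y \<in> pts S" "x \<in> Top S closure_of {y}"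
  have "(x, z) \<in> Rel S" if "(y, z) \<in> Rel S" for z
    by (rule Rel_in_closure_of_left[OF that y(2)])
  then show "y \<in> arrow_rel S U V" using x y(1) by (auto simp: arrow_rel_def)
qed

lemma nabla_rel_Int_subset_iff:
  "W \<subseteq> pts S \<Longrightarrow> nabla_rel (Rel S) W \<inter> U \<subseteq> V \<longleftrightarrow> W \<subseteq> arrow_rel S U V"
  unfolding nabla_rel_def arrow_rel_def by blast

lemma Rel_iff_nabla_rel_CO:
  assumes x: "x \<in> pts S" and y: "y \<in> pts S"
  shows "(x, y) \<in> Rel S \<longleftrightarrow> (\<forall>U\<in>CO (Top S). x \<in> U \<longrightarrow> y \<in> nabla_rel (Rel S) U)"
proof
  show "\<forall>U\<in>CO (Top S). x \<in> U \<longrightarrow> y \<in> nabla_rel (Rel S) U" if "(x, y) \<in> Rel S"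
    using that by (auto simp: nabla_rel_def)
  assume nabla: "\<forall>U\<in>CO (Top S). x \<in> U \<longrightarrow> y \<in> nabla_rel (Rel S) U"
  show "(x, y) \<in> Rel S"
  proof (rule ccontr)
    assume not_Rel: "(x, y) \<notin> Rel S"
    let ?R = "{y. (x, y) \<in> Rel S}"
    obtain \<U> where \<U>: "\<forall>U\<in>\<U>. openin (Top S) U" "?R = pts S \<inter> \<Inter>\<U>"
      using saturated_in_Rel[OF x] unfolding saturated_in_def by meson
    moreover have "y \<notin> ?R" using not_Rel by simp
    ultimately obtain G where "G \<in> \<U>" and y_G: "y \<notin> G" using y by fastforce
    then have G: "openin (Top S) G" "?R \<subseteq> G" using \<U> by auto
    obtain W where W: "W \<in> CO (Top S)" "?R \<subseteq> W" "W \<subseteq> G"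
      using compactin_CO_interpolation[OF compactin_Rel[OF x] G(2,1)] .
    let ?box = "arrow_rel S (pts S) W"
    have box: "?box \<in> CO (Top S)" by (rule arrow_rel_CO[OF CO_topspace W(1)])
    have "x \<in> ?box" using x W(2) by (auto simp: arrow_rel_def)
    then have "y \<in> nabla_rel (Rel S) ?box" using nabla box by blast
    moreover have "nabla_rel (Rel S) ?box \<inter> pts S \<subseteq> W"
      using nabla_rel_Int_subset_iff[OF CO_subset[OF box]] by blast
    ultimately show False using y W(3) y_G by blast
  qed
qed

end

locale compact_open_algebra = nabla_spectral S + compact_open_lattice "Top S" A
  for S :: "'x nabla_space" and A :: "('x set, 'm) nabla_alg_scheme" +
  assumes nab_CO: "nab A = nabla_rel (Rel S)" and arr_CO: "arr A = arrow_rel S"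
begin

lemma nabla_algebra_CO: "nabla_algebra A"
  unfolding nabla_algebra_def carrier_CO nab_CO arr_CO le_CO
proof (intro conjI ballI)
  show "Lattice.bounded_lattice A" by (rule bounded_lattice_CO)
  fix U V W assume "U \<in> CO (Top S)" "V \<in> CO (Top S)" "W \<in> CO (Top S)"
  then show "nabla_rel (Rel S) W \<sqinter>\<^bsub>A\<^esub> U \<subseteq> V \<longleftrightarrow> W \<subseteq> arrow_rel S U V"
    using nabla_rel_Int_subset_iff[of W U V] CO_subset[of W "Top S"] by (simp add: meet_CO nabla_rel_CO)
qed (auto intro: nabla_rel_CO arrow_rel_CO)

sublocale nabla_lattice A
  by unfold_locales (rule nabla_algebra_CO)

lemma box_CO: "box A U = {x \<in> pts S. \<forall>y. (x, y) \<in> Rel S \<longrightarrow> y \<in> U}"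
  using Rel_closed(2) by (auto simp: box_def arr_CO top_CO arrow_rel_def)

lemma is_heyting_imp_CO:
  assumes heyting: "heyting_spectral_space (Top S)" and U: "U \<in> CO (Top S)" and V: "V \<in> CO (Top S)"
  shows "is_heyting_imp A U V (pts S - Top S closure_of (U - V))"
  unfolding is_heyting_imp_def
proof (intro conjI ballI)
  let ?imp = "pts S - Top S closure_of (U - V)"
  have "doubly_spectral (Top S) (Top S closure_of (U - V))"
    using heyting doubly_spectral_Diff[OF doubly_spectral_CO[OF U] doubly_spectral_CO[OF V]]
    unfolding heyting_spectral_space_def by blast
  then have "doubly_spectral (Top S) ?imp" by (rule doubly_spectral_Compl)
  moreover have "openin (Top S) ?imp" by (intro openin_diff) auto
  ultimately show "?imp \<in> carrier A" unfolding carrier_CO by (rule doubly_spectral_openin_imp_CO)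
  fix W assume "W \<in> carrier A"
  then have W: "W \<in> CO (Top S)" by (simp add: carrier_CO)
  have "W \<inter> U \<subseteq> V \<longleftrightarrow> W \<inter> (U - V) = {}" by blast
  also have "\<dots> \<longleftrightarrow> W \<inter> Top S closure_of (U - V) = {}"
    by (rule openin_Int_closure_of_eq_empty[OF CO_openin[OF W], symmetric])
  also have "\<dots> \<longleftrightarrow> W \<subseteq> ?imp" using CO_subset[OF W] by blast
  finally show "W \<sqinter>\<^bsub>A\<^esub> U \<sqsubseteq>\<^bsub>A\<^esub> V \<longleftrightarrow> W \<sqsubseteq>\<^bsub>A\<^esub> ?imp" using W U by (simp add: meet_CO le_CO)
qed

lemma heyting_algebra_CO: "heyting_spectral_space (Top S) \<Longrightarrow> heyting_algebra A"
  unfolding heyting_algebra_def carrier_CO using bounded_lattice_CO is_heyting_imp_CO by blast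

lemma alg_satisfies_CN_CO:
  assumes CN: "space_satisfies S CN"
  shows "alg_satisfies A CN"
proof -
  obtain \<pi> where \<pi>: "continuous_map (Top S) (Top S) \<pi>"
    and Rel: "\<And>x y. x \<in> pts S \<Longrightarrow> y \<in> pts S \<Longrightarrow> (x, y) \<in> Rel S \<longleftrightarrow> x \<in> Top S closure_of {\<pi> y}"
    using CN by auto
  have \<pi>_closed: "\<pi> y \<in> pts S" if "y \<in> pts S" for y
    using \<pi> that by (auto simp: continuous_map_def)
  have nab: "nab A U = {y \<in> pts S. \<pi> y \<in> U}" if U: "U \<in> CO (Top S)" for U
  proof
    show "nab A U \<subseteq> {y \<in> pts S. \<pi> y \<in> U}"
    proof
      fix y assume "y \<in> nab A U"
      then obtain x where x: "x \<in> U" "(x, y) \<in> Rel S" by (auto simp: nab_CO nabla_rel_def)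
      then have "y \<in> pts S" "x \<in> Top S closure_of {\<pi> y}" using Rel[OF Rel_closed[OF x(2)]] Rel_closed(2) by simp_all
      then show "y \<in> {y \<in> pts S. \<pi> y \<in> U}"
        using in_closure_of_point_openin[OF _ CO_openin[OF U] x(1)] by simp
    qed
    have "(\<pi> y, y) \<in> Rel S" if y: "y \<in> pts S" for y
      using Rel[OF \<pi>_closed y] point_in_closure_of[OF \<pi>_closed] y by simp
    then show "{y \<in> pts S. \<pi> y \<in> U} \<subseteq> nab A U" by (auto simp: nab_CO nabla_rel_def)
  qed
  have "nab A (U \<sqinter>\<^bsub>A\<^esub> V) = nab A U \<sqinter>\<^bsub>A\<^esub> nab A V" if UV: "U \<in> CO (Top S)" "V \<in> CO (Top S)" for U V
  proof -
    have "nab A (U \<inter> V) = nab A U \<inter> nab A V"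
      unfolding nab[OF UV(1)] nab[OF UV(2)] nab[OF CO_Int[OF UV]] by blast
    then show ?thesis using UV nab_closed[of U] nab_closed[of V] by (simp add: meet_CO carrier_CO)
  qed
  then show ?thesis using \<pi>_closed by (auto simp: carrier_CO top_CO nab CO_topspace)
qed

lemma alg_satisfies_CR_CO: "space_satisfies S CR \<Longrightarrow> alg_satisfies A CR"
  using CO_subset[of _ "Top S"] by (fastforce simp: carrier_CO le_CO nab_CO nabla_rel_def)

lemma alg_satisfies_CL_CO:
  assumes CL: "space_satisfies S CL"
  shows "alg_satisfies A CL"
proof -
  have "nab A U \<subseteq> U" if U: "U \<in> CO (Top S)" for U
  proof
    fix y assume "y \<in> nab A U"
    then obtain x where x: "x \<in> U" "(x, y) \<in> Rel S" by (auto simp: nab_CO nabla_rel_def)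
    then have "x \<in> Top S closure_of {y}" using CL by auto
    then show "y \<in> U" using in_closure_of_point_openin CO_openin[OF U] x(1) by metis
  qed
  then show ?thesis by (simp add: carrier_CO le_CO)
qed

lemma alg_satisfies_CFa_CO:
  assumes CFa: "space_satisfies S CFa"
  shows "alg_satisfies A CFa"
proof -
  have "U \<subseteq> nab A (box A U)" if U: "U \<in> CO (Top S)" for U
  proof
    fix x assume x: "x \<in> U"
    then have "x \<in> pts S" using CO_subset[OF U] by blast
    then obtain y where y: "(y, x) \<in> Rel S" "\<And>z. (y, z) \<in> Rel S \<Longrightarrow> x \<in> Top S closure_of {z}"
      using CFa unfolding space_satisfies.simps by blast
    have "z \<in> U" if "(y, z) \<in> Rel S" for z
      using in_closure_of_point_openin[OF y(2)[OF that] CO_openin[OF U] x] .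
    then have "y \<in> box A U" using Rel_closed(1)[OF y(1)] by (simp add: box_CO)
    then show "x \<in> nab A (box A U)" using y(1) by (auto simp: nab_CO nabla_rel_def)
  qed
  then have "U = nab A (box A U)" if "U \<in> carrier A" for U
    using nab_box_le[OF that] that by (simp add: carrier_CO le_CO subset_antisym)
  then have "carrier A \<subseteq> nab A ` carrier A" using box_closed by blast
  then show ?thesis by (simp add: image_subset_iff subset_antisym)
qed

lemma alg_satisfies_CFu_CO:
  assumes CFu: "space_satisfies S CFu"
  shows "alg_satisfies A CFu"
proof -
  have "box A (nab A U) \<subseteq> U" if U: "U \<in> CO (Top S)" for U
  proof
    fix x assume x: "x \<in> box A (nab A U)"
    then have "x \<in> pts S" by (simp add: box_CO)
    then obtain y where y: "(x, y) \<in> Rel S" "\<And>z. (z, y) \<in> Rel S \<Longrightarrow> z \<in> Top S closure_of {x}"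
      using CFu unfolding space_satisfies.simps by blast
    then obtain z where z: "z \<in> U" "(z, y) \<in> Rel S" using x by (auto simp: box_CO nab_CO nabla_rel_def)
    show "x \<in> U" using in_closure_of_point_openin[OF y(2)[OF z(2)] CO_openin[OF U] z(1)] .
  qed
  then have "U = box A (nab A U)" if "U \<in> carrier A" for U
    using le_box_nab[OF that] that by (simp add: carrier_CO le_CO subset_antisym)
  then have "carrier A \<subseteq> box A ` carrier A" using nab_closed by blast
  then show ?thesis by (simp add: image_subset_iff subset_antisym)
qed

theorem alg_satisfies_CO: "space_satisfies S c \<Longrightarrow> alg_satisfies A c"
  using alg_satisfies_CN_CO alg_satisfies_CR_CO alg_satisfies_CL_CO alg_satisfies_CFa_CO
    alg_satisfies_CFu_CO heyting_algebra_CO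
  by (cases c) simp_all

lemma beta_prime_filter: "x \<in> pts S \<Longrightarrow> beta S x \<in> prime_filters A"
  using prime_filter_of_point by (simp add: beta_def)

lemma bij_betw_beta: "bij_betw (beta S) (pts S) (prime_filters A)"
proof (rule bij_betw_imageI)
  show "inj_on (beta S) (pts S)"
    by (rule inj_onI, rule CO_separates_points) (auto simp: beta_def)
  show "beta S ` pts S = prime_filters A"
  proof
    show "beta S ` pts S \<subseteq> prime_filters A" using beta_prime_filter by blast
    show "prime_filters A \<subseteq> beta S ` pts S"
    proof
      fix P assume "P \<in> prime_filters A"
      then obtain x where "x \<in> pts S" "P = {U \<in> CO (Top S). x \<in> U}" by (rule prime_filter_point)
      then show "P \<in> beta S ` pts S" by (auto simp: beta_def)
    qed
  qed
qed

lemma beta_vimage_stone: "U \<in> CO (Top S) \<Longrightarrow> {x \<in> pts S. beta S x \<in> stone A U} = U"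
  using beta_prime_filter CO_subset[of U "Top S"] by (auto simp: stone_def beta_def)

lemma beta_image_CO:
  assumes U: "U \<in> CO (Top S)"
  shows "beta S ` U = stone A U"
proof -
  have "stone A U \<subseteq> beta S ` pts S"
    using bij_betw_imp_surj_on[OF bij_betw_beta] by (auto simp: stone_def)
  then have "beta S ` {x \<in> pts S. beta S x \<in> stone A U} = stone A U" by blast
  then show ?thesis by (simp add: beta_vimage_stone[OF U])
qed

theorem homeomorphic_map_beta: "homeomorphic_map (Top S) (spectrum A) (beta S)"
proof (rule bijective_open_imp_homeomorphic_map)
  have "spectral_map (Top S) (spectrum A) (beta S)"
  proof (rule spectral_mapI[OF spectral_space spectral_space_spectrum])
    show "{x \<in> pts S. beta S x \<in> V} \<in> CO (Top S)" if "V \<in> CO (spectrum A)" for V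
      using that beta_vimage_stone by (auto simp: CO_spectrum carrier_CO)
  qed (use beta_prime_filter in simp)
  then show "continuous_map (Top S) (spectrum A) (beta S)" by (rule spectral_map_continuous_map)
  show "open_map (Top S) (spectrum A) (beta S)"
    unfolding open_map_def
  proof (intro allI impI)
    fix U assume "openin (Top S) U"
    then obtain \<V> where \<V>: "\<V> \<subseteq> CO (Top S)" "U = \<Union>\<V>"
      using spectral_space unfolding spectral_space_def by meson
    then have "openin (spectrum A) (beta S ` V)" if "V \<in> \<V>" for V
      using that beta_image_CO[of V] openin_stone[of V] by (auto simp: carrier_CO)
    then show "openin (spectrum A) (beta S ` U)" unfolding \<V>(2) image_Union by blast
  qed
qed (use bij_betw_beta in \<open>auto simp: bij_betw_def\<close>)

lemma Rel_beta_iff: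
  assumes "x \<in> pts S" "y \<in> pts S"
  shows "(beta S x, beta S y) \<in> Rel (spec_obj A) \<longleftrightarrow> (x, y) \<in> Rel S"
  unfolding Rel_spec_obj_iff Rel_iff_nabla_rel_CO[OF assms]
  using assms beta_prime_filter nabla_rel_CO by (auto simp: beta_def nab_CO)

end

section \<open>Morphisms of nabla-algebras\<close>

lemma (in nabla_lattice) alg_hom_id: "(\<lambda>a\<in>carrier A. a) \<in> alg_hom A A"
  by (simp add: alg_hom_def)

locale alg_morphism = A: nabla_lattice A + B: nabla_lattice B
  for A :: "('a, 'm) nabla_alg_scheme" and B :: "('b, 'n) nabla_alg_scheme" +
  fixes f :: "'a \<Rightarrow> 'b"
  assumes alg_hom: "f \<in> alg_hom A B"
begin

sublocale bounded_lattice_hom A B f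
  by unfold_locales (use alg_hom in \<open>auto simp: alg_hom_def\<close>)

lemma hom_nab: "a \<in> carrier A \<Longrightarrow> f (nab A a) = nab B (f a)"
  and hom_arr: "a \<in> carrier A \<Longrightarrow> b \<in> carrier A \<Longrightarrow> f (arr A a b) = arr B (f a) (f b)"
  using alg_hom by (auto simp: alg_hom_def)

lemma alg_hom_compose:
  assumes "g \<in> alg_hom B D"
  shows "compose (carrier A) g f \<in> alg_hom A D"
  using alg_hom assms by (auto simp: alg_hom_def compose_def)

lemma spec_mor_eq_spectrum_map: "spec_mor A B f = spectrum_map A B f"
  by (simp add: spec_mor_def spectrum_map_def)

lemma spec_mor_apply: "Q \<in> prime_filters B \<Longrightarrow> spec_mor A B f Q = {a \<in> carrier A. f a \<in> Q}"
  by (simp add: spec_mor_def)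

lemma spec_mor_closed: "Q \<in> prime_filters B \<Longrightarrow> spec_mor A B f Q \<in> prime_filters A"
  by (simp add: spec_mor_eq_spectrum_map spectrum_map_closed)

lemma spec_mor_Rel:
  assumes "(P, Q) \<in> Rel (spec_obj B)"
  shows "(spec_mor A B f P, spec_mor A B f Q) \<in> Rel (spec_obj A)"
  using assms spec_mor_closed
  by (auto simp: A.Rel_spec_obj_iff B.Rel_spec_obj_iff spec_mor_apply simp flip: hom_nab)

lemma spec_mor_Rel_lift_right:
  assumes P: "P \<in> prime_filters B" and Rel: "(spec_mor A B f P, Q) \<in> Rel (spec_obj A)"
  shows "\<exists>Q'. (P, Q') \<in> Rel (spec_obj B) \<and> spec_mor A B f Q' = Q"
proof -
  have Q: "Q \<in> prime_filters A" and nab: "\<And>a. a \<in> carrier A \<Longrightarrow> f a \<in> P \<Longrightarrow> nab A a \<in> Q"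
    using Rel P by (auto simp: A.Rel_spec_obj_iff spec_mor_apply)
  obtain Q' where Q': "Q' \<in> prime_filters B" "nab B ` P \<subseteq> Q'" "spectrum_map A B f Q' = Q"
  proof (rule prime_filter_lift[OF B.nab_image_prime_filter_down_directed[OF P] Q])
    fix k q c assume k: "k \<in> nab B ` P" and q: "q \<in> Q" and c: "c \<in> carrier A"
      and below: "k \<sqinter>\<^bsub>B\<^esub> f q \<sqsubseteq>\<^bsub>B\<^esub> f c"
    obtain p where p: "p \<in> P" "k = nab B p" using k by blast
    have q_closed: "q \<in> carrier A" using A.prime_filter_carrier[OF Q q] .
    have "p \<sqsubseteq>\<^bsub>B\<^esub> f (arr A q c)"
      using below p q_closed c B.prime_filter_carrier[OF P] by (simp add: B.nab_meet_le_iff hom_arr)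
    then have "f (arr A q c) \<in> P" using B.prime_filter_upward[OF P p(1)] q_closed c by simp
    then have "nab A (arr A q c) \<sqinter>\<^bsub>A\<^esub> q \<in> Q"
      using nab q q_closed c by (simp add: A.prime_filter_meet_iff[OF Q])
    then show "c \<in> Q" using A.prime_filter_upward[OF Q _ A.nab_arr_meet_le] q_closed c by blast
  qed
  then have "(P, Q') \<in> Rel (spec_obj B)" using P by (simp add: B.Rel_spec_obj_iff)
  then show ?thesis using Q'(3) spec_mor_eq_spectrum_map by metis
qed

lemma spec_mor_Rel_lift_left:
  assumes Q: "Q \<in> prime_filters B" and Rel: "(P, spec_mor A B f Q) \<in> Rel (spec_obj A)"
  shows "\<exists>P'. (P', Q) \<in> Rel (spec_obj B) \<and> P \<in> spectrum A closure_of {spec_mor A B f P'}"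
proof -
  have P: "P \<in> prime_filters A" and nab: "\<And>a. a \<in> P \<Longrightarrow> f (nab A a) \<in> Q"
    using Rel Q by (auto simp: A.Rel_spec_obj_iff spec_mor_apply)
  have "down_directed B (f ` P)"
    by (rule down_directed_image[OF A.prime_filter_down_directed[OF P] hom_isotone]) simp
  moreover have "nab B ` f ` P \<subseteq> Q"
    using nab A.prime_filter_carrier[OF P] by (auto simp flip: hom_nab)
  ultimately obtain P' where P': "P' \<in> prime_filters B" "f ` P \<subseteq> P'" "nab B ` P' \<subseteq> Q"
    by (rule B.prime_filter_nab_preimage[OF Q])
  have "P \<subseteq> spec_mor A B f P'" using P' A.prime_filter_carrier[OF P] by (auto simp: spec_mor_apply)
  then show ?thesis
    using P P' Q spec_mor_closed[OF P'(1)]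
    by (intro exI[of _ P']) (simp add: B.Rel_spec_obj_iff A.in_closure_of_prime_filter_iff)
qed

theorem spec_mor_spec_hom: "spec_mor A B f \<in> spec_hom (spec_obj B) (spec_obj A)"
proof -
  have "spec_mor A B f \<in> prime_filters B \<rightarrow>\<^sub>E prime_filters A"
    using spec_mor_closed by (auto simp: spec_mor_def)
  then show ?thesis
    unfolding spec_hom_def A.Top_spec_obj B.Top_spec_obj A.topspace_spectrum B.topspace_spectrum
    using spec_mor_Rel spec_mor_Rel_lift_right spec_mor_Rel_lift_left spectral_map_spectrum_map
    by (simp flip: spec_mor_eq_spectrum_map)
qed

lemma bij_betw_hom_inverse:
  assumes bij: "bij_betw f (carrier A) (carrier B)"
  shows "restrict (inv_into (carrier A) f) (carrier B) \<in> alg_hom B A"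
proof -
  let ?g = "inv_into (carrier A) f"
  have inverse: "?g b \<in> carrier A" "f (?g b) = b" if "b \<in> carrier B" for b
    using bij that by (auto simp: bij_betw_def inv_into_into f_inv_into_f)
  have inverse_hom: "?g (f a) = a" if "a \<in> carrier A" for a
    using bij that by (simp add: bij_betw_def)
  have "?g \<top>\<^bsub>B\<^esub> = \<top>\<^bsub>A\<^esub>" "?g \<bottom>\<^bsub>B\<^esub> = \<bottom>\<^bsub>A\<^esub>"
    using inverse_hom[OF A.top_closed] inverse_hom[OF A.bottom_closed] by (simp_all add: hom_top hom_bottom)
  moreover have "?g (nab B b) = nab A (?g b)" if "b \<in> carrier B" for b
    using inverse_hom[of "nab A (?g b)"] inverse[OF that] by (simp add: hom_nab)
  moreover have "?g (b \<sqinter>\<^bsub>B\<^esub> d) = ?g b \<sqinter>\<^bsub>A\<^esub> ?g d" "?g (b \<squnion>\<^bsub>B\<^esub> d) = ?g b \<squnion>\<^bsub>A\<^esub> ?g d"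
    "?g (arr B b d) = arr A (?g b) (?g d)" if "b \<in> carrier B" "d \<in> carrier B" for b d
    using inverse_hom[of "?g b \<sqinter>\<^bsub>A\<^esub> ?g d"] inverse_hom[of "?g b \<squnion>\<^bsub>A\<^esub> ?g d"] inverse_hom[of "arr A (?g b) (?g d)"]
      inverse[OF that(1)] inverse[OF that(2)] by (simp_all add: hom_meet hom_join hom_arr)
  ultimately show ?thesis using inverse by (simp add: alg_hom_def)
qed

end

section \<open>Morphisms of nabla-spectral spaces\<close>

lemma homeomorphic_map_spectral_map:
  assumes f: "homeomorphic_map X Y f" and X: "spectral_space X" and Y: "spectral_space Y"
  shows "spectral_map X Y f"
proof (rule spectral_mapI[OF X Y])
  have surj: "f ` topspace X = topspace Y" using f by (simp add: homeomorphic_imp_surjective_map)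
  then show "f \<in> topspace X \<rightarrow> topspace Y" by blast
  fix V assume V: "V \<in> CO Y"
  have "V \<subseteq> f ` topspace X" using CO_subset[OF V] surj by simp
  then have "f ` {x \<in> topspace X. f x \<in> V} = V" by blast
  then show "{x \<in> topspace X. f x \<in> V} \<in> CO X"
    using V homeomorphic_map_openness_eq[OF f, of "{x \<in> topspace X. f x \<in> V}"]
      homeomorphic_map_compactness_eq[OF f, of "{x \<in> topspace X. f x \<in> V}"] by (auto simp: CO_def)
qed

lemma homeomorphic_map_image_Sat:
  assumes f: "homeomorphic_map X Y f" and x: "x \<in> topspace X"
  shows "f ` Sat X x = Sat Y (f x)"
proof -
  have inj: "inj_on f (topspace X)" and surj: "f ` topspace X = topspace Y"
    using f by (simp_all add: homeomorphic_eq_everything_map)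
  have "f x \<in> Y closure_of {f y} \<longleftrightarrow> x \<in> X closure_of {y}" if y: "y \<in> topspace X" for y
  proof -
    have "Y closure_of {f y} = f ` (X closure_of {y})"
      using homeomorphic_map_closure_of[OF f, of "{y}"] y by simp
    then show ?thesis using inj_on_image_mem_iff[OF inj x closure_of_subset_topspace] by simp
  qed
  moreover have "f x \<in> topspace Y" using surj x by blast
  ultimately show ?thesis unfolding surj[symmetric] by (auto simp: in_Sat_iff x simp flip: surj)
qed

lemma heyting_spectral_space_imp_spectral_space: "heyting_spectral_space X \<Longrightarrow> spectral_space X"
  by (simp add: heyting_spectral_space_def)

lemma homeomorphic_map_heyting_spectral_map:
  assumes f: "homeomorphic_map X Y f" and X: "heyting_spectral_space X" and Y: "heyting_spectral_space Y"
  shows "heyting_spectral_map X Y f"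
  unfolding heyting_spectral_map_def
  using X Y homeomorphic_map_spectral_map[OF f] homeomorphic_map_image_Sat[OF f]
    heyting_spectral_space_imp_spectral_space[OF X] heyting_spectral_space_imp_spectral_space[OF Y]
  by simp

lemma heyting_spectral_map_compose:
  assumes f: "heyting_spectral_map X Y f" and g: "heyting_spectral_map Y Z g"
  shows "heyting_spectral_map X Z (compose (topspace X) g f)"
  unfolding heyting_spectral_map_def
proof (intro conjI ballI)
  have "spectral_map X Y f" "spectral_map Y Z g" using f g by (simp_all add: heyting_spectral_map_def)
  then show "spectral_map X Z (compose (topspace X) g f)" by (rule spectral_map_compose)
  fix x assume x: "x \<in> topspace X"
  have "compose (topspace X) g f ` Sat X x = g ` f ` Sat X x"
    using in_Sat_iff[OF x] by (force simp: compose_def image_image)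
  also have "\<dots> = Sat Z (compose (topspace X) g f x)"
    using f g x spectral_map_closed[OF \<open>spectral_map X Y f\<close> x]
    by (simp add: heyting_spectral_map_def compose_def)
  finally show "compose (topspace X) g f ` Sat X x = Sat Z (compose (topspace X) g f x)" .
qed (use f g in \<open>simp_all add: heyting_spectral_map_def\<close>)

lemma heyting_spectral_map_vimage_closure_of:
  assumes f: "heyting_spectral_map X Y f" and Z: "closedin (patch Y) Z"
  shows "{x \<in> topspace X. f x \<in> Y closure_of Z} = X closure_of {x \<in> topspace X. f x \<in> Z}"
proof
  have spectral: "spectral_map X Y f" and Sat: "\<And>x. x \<in> topspace X \<Longrightarrow> f ` Sat X x = Sat Y (f x)"
    using f by (auto simp: heyting_spectral_map_def)
  interpret Y: spectral Y
    by unfold_locales (use spectral in \<open>simp add: spectral_map_def\<close>)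
  show "X closure_of {x \<in> topspace X. f x \<in> Z} \<subseteq> {x \<in> topspace X. f x \<in> Y closure_of Z}"
  proof
    fix x assume x: "x \<in> X closure_of {x \<in> topspace X. f x \<in> Z}"
    then have "f x \<in> Y closure_of (f ` {x \<in> topspace X. f x \<in> Z})"
      using continuous_map_image_closure_subset[OF spectral_map_continuous_map[OF spectral]] by blast
    moreover have "f ` {x \<in> topspace X. f x \<in> Z} \<subseteq> Z" by blast
    ultimately have "f x \<in> Y closure_of Z" using closure_of_mono by blast
    then show "x \<in> {x \<in> topspace X. f x \<in> Y closure_of Z}"
      using x closure_of_subset_topspace[of X] by blast
  qed
  show "{x \<in> topspace X. f x \<in> Y closure_of Z} \<subseteq> X closure_of {x \<in> topspace X. f x \<in> Z}"
  proof
    fix x assume "x \<in> {x \<in> topspace X. f x \<in> Y closure_of Z}"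
    then have x: "x \<in> topspace X" "f x \<in> Y closure_of Z" by auto
    then obtain z where z: "z \<in> Z" "f x \<in> Y closure_of {z}"
      by (auto simp: Y.closure_of_closedin_patch[OF Z])
    then have "z \<in> f ` Sat X x"
      using closedin_subset[OF Z] spectral_map_closed[OF spectral x(1)]
      by (auto simp: Sat[OF x(1)] in_Sat_iff)
    then obtain w where w: "w \<in> topspace X" "x \<in> X closure_of {w}" "f w = z"
      by (auto simp: in_Sat_iff[OF x(1)])
    then have "{w} \<subseteq> {x \<in> topspace X. f x \<in> Z}" using z(1) by blast
    then show "x \<in> X closure_of {x \<in> topspace X. f x \<in> Z}" using w(2) closure_of_mono by blast
  qed
qed

locale spec_morphism = S: nabla_spectral S + T: nabla_spectral T
  for S :: "'x nabla_space" and T :: "'y nabla_space" +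
  fixes f :: "'x \<Rightarrow> 'y"
  assumes spec_hom: "f \<in> spec_hom S T"
begin

lemma spectral_map: "spectral_map (Top S) (Top T) f"
  and spec_hom_Rel: "(x, z) \<in> Rel S \<Longrightarrow> (f x, f z) \<in> Rel T"
  using spec_hom by (auto simp: spec_hom_def)

lemma spec_hom_closed [simp]: "x \<in> pts S \<Longrightarrow> f x \<in> pts T"
  by (rule spectral_map_closed[OF spectral_map])

lemma spec_hom_vimage_CO: "V \<in> CO (Top T) \<Longrightarrow> {x \<in> pts S. f x \<in> V} \<in> CO (Top S)"
  by (rule spectral_map_CO[OF spectral_map])

lemma spec_hom_Rel_lift_right:
  assumes "x \<in> pts S" "(f x, y) \<in> Rel T"
  obtains z where "(x, z) \<in> Rel S" "f z = y"
  using spec_hom assms unfolding spec_hom_def by blast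

lemma spec_hom_Rel_lift_left:
  assumes "x \<in> pts S" "(y, f x) \<in> Rel T"
  obtains z where "(z, x) \<in> Rel S" "y \<in> Top T closure_of {f z}"
  using spec_hom assms unfolding spec_hom_def by blast

lemma vimage_nabla_rel:
  assumes V: "openin (Top T) V"
  shows "{x \<in> pts S. f x \<in> nabla_rel (Rel T) V} = nabla_rel (Rel S) {x \<in> pts S. f x \<in> V}"
proof
  show "{x \<in> pts S. f x \<in> nabla_rel (Rel T) V} \<subseteq> nabla_rel (Rel S) {x \<in> pts S. f x \<in> V}"
  proof
    fix x assume "x \<in> {x \<in> pts S. f x \<in> nabla_rel (Rel T) V}"
    then obtain y where x: "x \<in> pts S" and y: "y \<in> V" "(y, f x) \<in> Rel T" by (auto simp: nabla_rel_def)
    obtain z where z: "(z, x) \<in> Rel S" "y \<in> Top T closure_of {f z}"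
      using spec_hom_Rel_lift_left[OF x y(2)] .
    have "f z \<in> V" using in_closure_of_point_openin[OF z(2) V y(1)] .
    then show "x \<in> nabla_rel (Rel S) {x \<in> pts S. f x \<in> V}"
      using z(1) S.Rel_closed(1)[OF z(1)] by (auto simp: nabla_rel_def)
  qed
  show "nabla_rel (Rel S) {x \<in> pts S. f x \<in> V} \<subseteq> {x \<in> pts S. f x \<in> nabla_rel (Rel T) V}"
    using spec_hom_Rel S.Rel_closed(2) by (auto simp: nabla_rel_def)
qed

lemma vimage_arrow_rel:
  "{x \<in> pts S. f x \<in> arrow_rel T U V} = arrow_rel S {x \<in> pts S. f x \<in> U} {x \<in> pts S. f x \<in> V}"
proof
  show "{x \<in> pts S. f x \<in> arrow_rel T U V} \<subseteq> arrow_rel S {x \<in> pts S. f x \<in> U} {x \<in> pts S. f x \<in> V}"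
    using spec_hom_Rel by (auto simp: arrow_rel_def)
  show "arrow_rel S {x \<in> pts S. f x \<in> U} {x \<in> pts S. f x \<in> V} \<subseteq> {x \<in> pts S. f x \<in> arrow_rel T U V}"
  proof
    fix x assume x: "x \<in> arrow_rel S {x \<in> pts S. f x \<in> U} {x \<in> pts S. f x \<in> V}"
    then have x_pts: "x \<in> pts S" by (simp add: arrow_rel_def)
    have "y \<in> V" if y: "(f x, y) \<in> Rel T" "y \<in> U" for y
    proof -
      obtain z where z: "(x, z) \<in> Rel S" "f z = y" using spec_hom_Rel_lift_right[OF x_pts y(1)] .
      then show ?thesis using x S.Rel_closed(2)[OF z(1)] y(2) by (auto simp: arrow_rel_def)
    qed
    then show "x \<in> {x \<in> pts S. f x \<in> arrow_rel T U V}" using x_pts by (auto simp: arrow_rel_def)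
  qed
qed

theorem alg_mor_alg_hom:
  assumes "compact_open_algebra S A" "compact_open_algebra T B"
  shows "alg_mor S T f \<in> alg_hom B A"
proof -
  interpret A: compact_open_algebra S A by fact
  interpret B: compact_open_algebra T B by fact
  have alg_mor_eq: "alg_mor S T f V = {x \<in> pts S. f x \<in> V}" if "V \<in> CO (Top T)" for V
    using that by (simp add: alg_mor_def)
  note CO = spec_hom_vimage_CO
  show ?thesis
    unfolding alg_hom_def mem_Collect_eq A.carrier_CO B.carrier_CO A.top_CO B.top_CO A.bottom_CO B.bottom_CO
      A.nab_CO B.nab_CO A.arr_CO B.arr_CO
  proof (intro conjI ballI)
    show "alg_mor S T f \<in> CO (Top T) \<rightarrow>\<^sub>E CO (Top S)" using CO by (auto simp: alg_mor_def)
    show "alg_mor S T f (pts T) = pts S" "alg_mor S T f {} = {}"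
      by (auto simp: alg_mor_eq T.CO_topspace CO_empty)
    fix U assume U: "U \<in> CO (Top T)"
    show "alg_mor S T f (nabla_rel (Rel T) U) = nabla_rel (Rel S) (alg_mor S T f U)"
      using U vimage_nabla_rel[OF CO_openin[OF U]] by (simp add: alg_mor_eq T.nabla_rel_CO)
    fix V assume V: "V \<in> CO (Top T)"
    show "alg_mor S T f (arrow_rel T U V) = arrow_rel S (alg_mor S T f U) (alg_mor S T f V)"
      using U V by (simp add: alg_mor_eq T.arrow_rel_CO vimage_arrow_rel)
    show "alg_mor S T f (U \<sqinter>\<^bsub>B\<^esub> V) = alg_mor S T f U \<sqinter>\<^bsub>A\<^esub> alg_mor S T f V"
      using U V CO by (auto simp: alg_mor_eq B.meet_CO A.meet_CO T.CO_Int)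
    show "alg_mor S T f (U \<squnion>\<^bsub>B\<^esub> V) = alg_mor S T f U \<squnion>\<^bsub>A\<^esub> alg_mor S T f V"
      using U V CO by (auto simp: alg_mor_eq B.join_CO A.join_CO CO_Un)
  qed
qed

end

lemma (in nabla_spectral) spec_hom_id: "(\<lambda>x\<in>pts S. x) \<in> spec_hom S S"
proof -
  let ?id = "\<lambda>x\<in>pts S. x"
  have "\<exists>z. (x, z) \<in> Rel S \<and> ?id z = y" if "(x, y) \<in> Rel S" for x y
    using that Rel_closed(2) by (intro exI[of _ y]) simp
  moreover have "\<exists>z. (z, x) \<in> Rel S \<and> y \<in> Top S closure_of {?id z}" if "(y, x) \<in> Rel S" for x y
    using that Rel_closed(1) by (intro exI[of _ y]) (simp add: point_in_closure_of)
  ultimately show ?thesis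
    using spectral_map_id[OF spectral_space] Rel_closed by (simp add: spec_hom_def)
qed

lemma spec_hom_compose:
  assumes "spec_morphism S T f" "spec_morphism T W g"
  shows "compose (pts S) g f \<in> spec_hom S W"
proof -
  interpret f: spec_morphism S T f by fact
  interpret g: spec_morphism T W g by fact
  have compose_eq: "compose (pts S) g f x = g (f x)" if "x \<in> pts S" for x
    using that by (simp add: compose_def)
  have right: "\<exists>z. (x, z) \<in> Rel S \<and> compose (pts S) g f z = y"
    if x: "x \<in> pts S" and y: "(compose (pts S) g f x, y) \<in> Rel W" for x y
  proof -
    obtain z where z: "(f x, z) \<in> Rel T" "g z = y"
      using y g.spec_hom_Rel_lift_right[of "f x" y] x by (auto simp: compose_eq)
    obtain w where "(x, w) \<in> Rel S" "f w = z" using f.spec_hom_Rel_lift_right[OF x z(1)] .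
    then show ?thesis using z(2) f.S.Rel_closed(2) by (intro exI[of _ w]) (simp add: compose_eq)
  qed
  have left: "\<exists>z. (z, x) \<in> Rel S \<and> y \<in> Top W closure_of {compose (pts S) g f z}"
    if x: "x \<in> pts S" and y: "(y, compose (pts S) g f x) \<in> Rel W" for x y
  proof -
    obtain z where z: "(z, f x) \<in> Rel T" "y \<in> Top W closure_of {g z}"
      using y g.spec_hom_Rel_lift_left[of "f x" y] x by (auto simp: compose_eq)
    obtain w where w: "(w, x) \<in> Rel S" "z \<in> Top T closure_of {f w}"
      using f.spec_hom_Rel_lift_left[OF x z(1)] .
    have "g z \<in> Top W closure_of {g (f w)}"
      by (rule continuous_map_in_closure_of_point[OF spectral_map_continuous_map[OF g.spectral_map] w(2)])
    then have "y \<in> Top W closure_of {compose (pts S) g f w}"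
      using in_closure_of_point_trans[OF z(2)] f.S.Rel_closed(1)[OF w(1)] by (simp add: compose_eq)
    then show ?thesis using w(1) by blast
  qed
  have "compose (pts S) g f \<in> pts S \<rightarrow>\<^sub>E pts W" by (simp add: compose_eq compose_def)
  moreover have "(compose (pts S) g f x, compose (pts S) g f z) \<in> Rel W" if "(x, z) \<in> Rel S" for x z
    using that g.spec_hom_Rel[OF f.spec_hom_Rel[OF that]] f.S.Rel_closed[OF that] by (simp add: compose_eq)
  ultimately show ?thesis
    using spectral_map_compose[OF f.spectral_map g.spectral_map] right left by (simp add: spec_hom_def)
qed

definition nabla_homeomorphism :: "'x nabla_space \<Rightarrow> 'y nabla_space \<Rightarrow> ('x \<Rightarrow> 'y) \<Rightarrow> bool" where
  "nabla_homeomorphism S T f \<longleftrightarrow> f \<in> pts S \<rightarrow>\<^sub>E pts T \<and> homeomorphic_map (Top S) (Top T) f \<and>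
     (\<forall>x\<in>pts S. \<forall>y\<in>pts S. (f x, f y) \<in> Rel T \<longleftrightarrow> (x, y) \<in> Rel S)"

lemma nabla_homeomorphism_bij_betw: "nabla_homeomorphism S T f \<Longrightarrow> bij_betw f (pts S) (pts T)"
  by (simp add: nabla_homeomorphism_def homeomorphic_eq_everything_map bij_betw_def)

lemma nabla_homeomorphism_inverse:
  assumes f: "nabla_homeomorphism S T f"
  shows "nabla_homeomorphism T S (restrict (inv_into (pts S) f) (pts T))"
proof -
  have homeomorphic: "homeomorphic_map (Top S) (Top T) f"
    and Rel: "\<And>x y. x \<in> pts S \<Longrightarrow> y \<in> pts S \<Longrightarrow> (f x, f y) \<in> Rel T \<longleftrightarrow> (x, y) \<in> Rel S"
    using f by (auto simp: nabla_homeomorphism_def)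
  let ?g = "restrict (inv_into (pts S) f) (pts T)"
  have inverse: "?g y \<in> pts S" "f (?g y) = y" if "y \<in> pts T" for y
    using nabla_homeomorphism_bij_betw[OF f] that
    by (auto simp: bij_betw_def inv_into_into f_inv_into_f)
  obtain h where h: "homeomorphic_maps (Top S) (Top T) f h"
    using homeomorphic unfolding homeomorphic_map_maps by blast
  have "h y = ?g y" if y: "y \<in> pts T" for y
  proof -
    have "h (f (?g y)) = ?g y" using h inverse(1)[OF y] unfolding homeomorphic_maps_map by blast
    then show ?thesis using inverse(2)[OF y] by simp
  qed
  then have "homeomorphic_map (Top T) (Top S) ?g"
    using h homeomorphic_map_eq[of "Top T" "Top S" h ?g] unfolding homeomorphic_maps_map by blast
  moreover have "(?g x, ?g y) \<in> Rel S \<longleftrightarrow> (x, y) \<in> Rel T" if "x \<in> pts T" "y \<in> pts T" for x y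
    using Rel[OF inverse(1)[OF that(1)] inverse(1)[OF that(2)]] inverse(2) that by simp
  moreover have "?g \<in> pts T \<rightarrow>\<^sub>E pts S" using inverse(1) by auto
  ultimately show ?thesis unfolding nabla_homeomorphism_def by blast
qed

lemma nabla_homeomorphism_spec_hom:
  assumes "nabla_spectral S" "nabla_spectral T" and f: "nabla_homeomorphism S T f"
  shows "f \<in> spec_hom S T"
proof -
  interpret S: nabla_spectral S by fact
  interpret T: nabla_spectral T by fact
  have Rel: "\<And>x y. x \<in> pts S \<Longrightarrow> y \<in> pts S \<Longrightarrow> (f x, f y) \<in> Rel T \<longleftrightarrow> (x, y) \<in> Rel S"
    using f by (simp add: nabla_homeomorphism_def)
  have "spectral_map (Top S) (Top T) f"
    using f homeomorphic_map_spectral_map[OF _ S.spectral_space T.spectral_space]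
    by (simp add: nabla_homeomorphism_def)
  moreover have surj: "\<exists>z\<in>pts S. f z = y" if "y \<in> pts T" for y
    using bij_betw_imp_surj_on[OF nabla_homeomorphism_bij_betw[OF f]] that by (metis imageE)
  moreover have "\<exists>z. (x, z) \<in> Rel S \<and> f z = y" if "x \<in> pts S" "(f x, y) \<in> Rel T" for x y
    using surj[OF T.Rel_closed(2)[OF that(2)]] Rel that by blast
  moreover have "\<exists>z. (z, x) \<in> Rel S \<and> y \<in> Top T closure_of {f z}"
    if "x \<in> pts S" "(y, f x) \<in> Rel T" for x y
  proof -
    have y: "y \<in> pts T" by (rule T.Rel_closed(1)[OF that(2)])
    obtain z where "z \<in> pts S" "f z = y" using surj[OF y] by blast
    then show ?thesis using Rel that point_in_closure_of[OF y] by blast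
  qed
  moreover have "(f x, f z) \<in> Rel T" if "(x, z) \<in> Rel S" for x z
    using Rel S.Rel_closed[OF that] that by simp
  ultimately show ?thesis using f unfolding spec_hom_def nabla_homeomorphism_def by blast
qed

lemma nabla_homeomorphism_specH_hom:
  assumes "nabla_spectral S" "nabla_spectral T" and f: "nabla_homeomorphism S T f"
    and "heyting_spectral_space (Top S)" "heyting_spectral_space (Top T)"
  shows "f \<in> specH_hom S T"
  using assms nabla_homeomorphism_spec_hom homeomorphic_map_heyting_spectral_map
  unfolding specH_hom_def nabla_homeomorphism_def by blast

lemma iso_arrowI:
  assumes "f \<in> F" and bij: "bij_betw f A B" and "restrict (inv_into A f) B \<in> G"
  shows "iso_arrow F G A B f"
  unfolding iso_arrow_def
proof (intro conjI bexI)
  show "compose A (restrict (inv_into A f) B) f = (\<lambda>x\<in>A. x)"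
    using bij by (auto simp: compose_def bij_betw_def intro!: restrict_ext)
  show "compose B f (restrict (inv_into A f) B) = (\<lambda>y\<in>B. y)"
    using bij by (auto simp: compose_def bij_betw_def f_inv_into_f intro!: restrict_ext)
qed (use assms in auto)

section \<open>The natural isomorphisms\<close>

context nabla_lattice
begin

lemma nabla_spectral_spec_obj: "nabla_spectral (spec_obj A)"
  by unfold_locales (rule nabla_spectral_space_spec_obj)

lemma spec_mor_id: "spec_mor A A (\<lambda>a\<in>carrier A. a) = (\<lambda>P\<in>pts (spec_obj A). P)"
  unfolding spec_mor_def pts_spec_obj
proof (rule restrict_ext)
  show "{a \<in> carrier A. (\<lambda>a\<in>carrier A. a) a \<in> P} = P" if "P \<in> prime_filters A" for P
    using prime_filter_carrier[OF that] by auto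
qed

lemma alpha_alg_hom:
  assumes "compact_open_algebra (spec_obj A) B"
  shows "alpha A \<in> alg_hom A B"
proof -
  interpret B: compact_open_algebra "spec_obj A" B by fact
  have stone_CO: "stone A a \<in> CO (spectrum A)" if "a \<in> carrier A" for a
    using that by (simp add: CO_spectrum)
  have carrier_B: "carrier B = CO (spectrum A)" by (simp add: B.carrier_CO Top_spec_obj)
  show ?thesis
    unfolding alg_hom_def mem_Collect_eq carrier_B B.nab_CO B.arr_CO
  proof (intro conjI ballI)
    show "alpha A \<in> carrier A \<rightarrow>\<^sub>E CO (spectrum A)"
      using stone_CO by (auto simp: alpha_def stone_def)
    show "alpha A \<top> = \<top>\<^bsub>B\<^esub>" "alpha A \<bottom> = \<bottom>\<^bsub>B\<^esub>"
      by (simp_all add: alpha_eq_stone stone_top stone_bottom B.top_CO B.bottom_CO Top_spec_obj)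
    fix a assume a: "a \<in> carrier A"
    then show "alpha A (nab A a) = nabla_rel (Rel (spec_obj A)) (alpha A a)"
      by (simp add: alpha_eq_stone nabla_rel_stone)
    fix b assume b: "b \<in> carrier A"
    show "alpha A (a \<sqinter> b) = alpha A a \<sqinter>\<^bsub>B\<^esub> alpha A b"
      using a b by (simp add: alpha_eq_stone stone_meet B.meet_CO Top_spec_obj stone_CO)
    show "alpha A (a \<squnion> b) = alpha A a \<squnion>\<^bsub>B\<^esub> alpha A b"
      using a b by (simp add: alpha_eq_stone stone_join B.join_CO Top_spec_obj stone_CO)
    show "alpha A (arr A a b) = arrow_rel (spec_obj A) (alpha A a) (alpha A b)"
      using a b by (simp add: alpha_eq_stone arrow_rel_stone)
  qed
qed

lemma bij_betw_alpha:
  assumes "compact_open_algebra (spec_obj A) B"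
  shows "bij_betw (alpha A) (carrier A) (carrier B)"
proof -
  interpret B: compact_open_algebra "spec_obj A" B by fact
  have "bij_betw (stone A) (carrier A) (carrier B)"
    using inj_on_stone by (simp add: bij_betw_def B.carrier_CO Top_spec_obj CO_spectrum)
  then show ?thesis
    using bij_betw_cong[of "carrier A" "alpha A" "stone A"] alpha_eq_stone by simp
qed

lemma iso_arrow_alpha:
  assumes B: "compact_open_algebra (spec_obj A) B"
  shows "iso_arrow (alg_hom A B) (alg_hom B A) (carrier A) (carrier B) (alpha A)"
proof -
  interpret B: compact_open_algebra "spec_obj A" B by fact
  interpret alg_morphism A B "alpha A" by unfold_locales (rule alpha_alg_hom[OF B])
  show ?thesis by (intro iso_arrowI alg_hom bij_betw_hom_inverse bij_betw_alpha[OF B])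
qed

end

lemma spec_mor_compose:
  assumes "alg_morphism A B f" "alg_morphism B D g"
  shows "spec_mor A D (compose (carrier A) g f) = compose (pts (spec_obj D)) (spec_mor A B f) (spec_mor B D g)"
proof -
  interpret f: alg_morphism A B f by fact
  interpret g: alg_morphism B D g by fact
  show ?thesis
    unfolding spec_mor_def[of A D] g.B.pts_spec_obj compose_def[of "prime_filters D"]
  proof (rule restrict_ext)
    show "{a \<in> carrier A. compose (carrier A) g f a \<in> Q} = spec_mor A B f (spec_mor B D g Q)"
      if Q: "Q \<in> prime_filters D" for Q
      unfolding f.spec_mor_apply[OF g.spec_mor_closed[OF Q]]
      using g.spec_mor_apply[OF Q] by (auto simp: compose_def)
  qed
qed

lemma (in alg_morphism) alpha_natural:
  "compose (carrier A) (alpha B) f =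
   compose (carrier A) (alg_mor (spec_obj B) (spec_obj A) (spec_mor A B f)) (alpha A)"
  unfolding compose_def
proof (rule restrict_ext)
  fix a assume a: "a \<in> carrier A"
  then show "alpha B (f a) = alg_mor (spec_obj B) (spec_obj A) (spec_mor A B f) (alpha A a)"
    by (simp add: A.alpha_eq_stone B.alpha_eq_stone alg_mor_def A.Top_spec_obj B.Top_spec_obj
        A.CO_spectrum spec_mor_eq_spectrum_map spectrum_map_vimage_stone)
qed

context compact_open_algebra
begin

lemma alg_mor_id: "alg_mor S S (\<lambda>x\<in>pts S. x) = (\<lambda>U\<in>carrier A. U)"
  unfolding alg_mor_def carrier_CO
proof (rule restrict_ext)
  show "{x \<in> pts S. (\<lambda>x\<in>pts S. x) x \<in> U} = U" if "U \<in> CO (Top S)" for U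
    using CO_subset[OF that] by auto
qed

lemma nabla_homeomorphism_beta: "nabla_homeomorphism S (spec_obj A) (beta S)"
proof -
  have "beta S \<in> pts S \<rightarrow>\<^sub>E pts (spec_obj A)"
    unfolding pts_spec_obj using beta_prime_filter by (intro PiE_I) (simp_all add: beta_def)
  then show ?thesis
    using homeomorphic_map_beta Rel_beta_iff by (simp add: nabla_homeomorphism_def Top_spec_obj)
qed

lemma iso_arrow_beta:
  "iso_arrow (spec_hom S (spec_obj A)) (spec_hom (spec_obj A) S) (pts S) (pts (spec_obj A)) (beta S)"
  using nabla_homeomorphism_beta nabla_spectral_axioms nabla_spectral_spec_obj
  by (intro iso_arrowI nabla_homeomorphism_spec_hom nabla_homeomorphism_inverse
      nabla_homeomorphism_bij_betw)

lemma iso_arrow_beta_heyting: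
  assumes S: "heyting_spectral_space (Top S)"
  shows "iso_arrow (specH_hom S (spec_obj A)) (specH_hom (spec_obj A) S) (pts S) (pts (spec_obj A)) (beta S)"
proof -
  have "heyting_spectral_space (Top (spec_obj A))"
    using heyting_spectral_space_spectrum[OF heyting_algebra_CO[OF S]] by (simp add: Top_spec_obj)
  then show ?thesis
    using S nabla_homeomorphism_beta nabla_spectral_axioms nabla_spectral_spec_obj
    by (intro iso_arrowI nabla_homeomorphism_specH_hom nabla_homeomorphism_inverse
        nabla_homeomorphism_bij_betw)
qed

end

lemma alg_mor_compose:
  assumes "spec_morphism S T f" "spec_morphism T W g" "compact_open_algebra W B"
  shows "alg_mor S W (compose (pts S) g f) = compose (carrier B) (alg_mor S T f) (alg_mor T W g)"
proof -
  interpret f: spec_morphism S T f by fact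
  interpret g: spec_morphism T W g by fact
  interpret B: compact_open_algebra W B by fact
  show ?thesis
    unfolding B.carrier_CO alg_mor_def[of S W] compose_def[of "CO (Top W)"]
  proof (rule restrict_ext)
    show "{x \<in> pts S. compose (pts S) g f x \<in> V} = alg_mor S T f (alg_mor T W g V)"
      if "V \<in> CO (Top W)" for V
      using that g.spec_hom_vimage_CO[OF that] by (auto simp: alg_mor_def compose_def)
  qed
qed

lemma (in spec_morphism) beta_natural:
  assumes "compact_open_algebra S A" "compact_open_algebra T B"
  shows "compose (pts S) (beta T) f = compose (pts S) (spec_mor B A (alg_mor S T f)) (beta S)"
  unfolding compose_def
proof (rule restrict_ext)
  interpret A: compact_open_algebra S A by fact
  interpret B: compact_open_algebra T B by fact
  show "beta T (f x) = spec_mor B A (alg_mor S T f) (beta S x)" if x: "x \<in> pts S" for x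
    using spec_hom_vimage_CO x A.beta_prime_filter[OF x]
    by (auto simp: spec_mor_def B.carrier_CO beta_def alg_mor_def)
qed

section \<open>Heyting implication\<close>

locale heyting_nabla_lattice = nabla_lattice A for A :: "'a heyting_nabla_alg" +
  assumes is_heyting_imp_himp:
    "a \<in> carrier A \<Longrightarrow> b \<in> carrier A \<Longrightarrow> is_heyting_imp A a b (himp A a b)"
begin

lemma heyting_algebra: "heyting_algebra A"
  unfolding heyting_algebra_def using is_heyting_imp_himp bounded_lattice_axioms by blast

lemma himp_closed [simp]: "a \<in> carrier A \<Longrightarrow> b \<in> carrier A \<Longrightarrow> himp A a b \<in> carrier A"
  using is_heyting_imp_himp by (simp add: is_heyting_imp_def)

lemma himp_eqI: "a \<in> carrier A \<Longrightarrow> b \<in> carrier A \<Longrightarrow> is_heyting_imp A a b c \<Longrightarrow> himp A a b = c"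
  using is_heyting_imp_unique[OF partial_order_axioms is_heyting_imp_himp] .

lemma algH_hom_id: "(\<lambda>a\<in>carrier A. a) \<in> algH_hom A A"
  using alg_hom_id by (simp add: algH_hom_def)

end

locale heyting_alg_morphism = A: heyting_nabla_lattice A + B: heyting_nabla_lattice B
  for A :: "'a heyting_nabla_alg" and B :: "'b heyting_nabla_alg" +
  fixes f :: "'a \<Rightarrow> 'b"
  assumes algH_hom: "f \<in> algH_hom A B"
begin

sublocale alg_morphism A B f
  by unfold_locales (use algH_hom in \<open>simp add: algH_hom_def\<close>)

lemma hom_himp: "a \<in> carrier A \<Longrightarrow> b \<in> carrier A \<Longrightarrow> f (himp A a b) = himp B (f a) (f b)"
  using algH_hom by (simp add: algH_hom_def)

lemma algH_hom_compose:
  assumes "g \<in> algH_hom B D"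
  shows "compose (carrier A) g f \<in> algH_hom A D"
  using assms alg_hom_compose[of g D] by (simp add: algH_hom_def compose_def hom_himp)

lemma spec_mor_specH_hom: "spec_mor A B f \<in> specH_hom (spec_obj B) (spec_obj A)"
proof -
  have "is_heyting_imp B (f a) (f b) (f c)"
    if "a \<in> carrier A" "b \<in> carrier A" "is_heyting_imp A a b c" for a b c
    using B.is_heyting_imp_himp[of "f a" "f b"] A.himp_eqI[OF that] that by (simp flip: hom_himp)
  then have "heyting_spectral_map (spectrum B) (spectrum A) (spec_mor A B f)"
    unfolding spec_mor_eq_spectrum_map
    by (rule heyting_spectral_map_spectrum_map[OF A.heyting_algebra B.heyting_algebra])
  then show ?thesis
    using spec_mor_spec_hom by (simp add: specH_hom_def A.Top_spec_obj B.Top_spec_obj)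
qed

end

lemma bij_betw_alg_hom_imp_algH_hom:
  assumes "heyting_nabla_lattice A" "heyting_nabla_lattice B"
    and f: "f \<in> alg_hom A B" "bij_betw f (carrier A) (carrier B)"
  shows "f \<in> algH_hom A B"
proof -
  interpret A: heyting_nabla_lattice A by fact
  interpret B: heyting_nabla_lattice B by fact
  interpret alg_morphism A B f by unfold_locales (rule f(1))
  have "himp B (f a) (f b) = f (himp A a b)" if ab: "a \<in> carrier A" "b \<in> carrier A" for a b
    using bij_betw_hom_is_heyting_imp[OF f(2) ab A.is_heyting_imp_himp[OF ab]] ab
    by (intro B.himp_eqI) simp_all
  then show ?thesis using f(1) by (simp add: algH_hom_def)
qed

locale heyting_nabla_spectral = nabla_spectral S for S :: "'x nabla_space" +
  assumes heyting_spectral_space: "heyting_spectral_space (Top S)"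

lemma compact_open_algebra_alg_obj: "nabla_spectral S \<Longrightarrow> compact_open_algebra S (alg_obj S)"
  and compact_open_algebra_algH_obj: "nabla_spectral S \<Longrightarrow> compact_open_algebra S (algH_obj S)"
  by (auto simp: compact_open_algebra_def compact_open_algebra_axioms_def compact_open_lattice_def
      compact_open_lattice_axioms_def spectral_def alg_obj_def algH_obj_def
      nabla_spectral_def nabla_spectral_space_def)

context heyting_nabla_spectral
begin

lemma specH_hom_id: "(\<lambda>x\<in>pts S. x) \<in> specH_hom S S"
proof -
  have "homeomorphic_map (Top S) (Top S) (\<lambda>x\<in>pts S. x)"
    using homeomorphic_map_eq[of "Top S" "Top S" id] by simp
  then show ?thesis
    using spec_hom_id heyting_spectral_space homeomorphic_map_heyting_spectral_map
    by (simp add: specH_hom_def)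
qed

lemma himp_algH_obj:
  assumes UV: "U \<in> CO (Top S)" "V \<in> CO (Top S)"
  shows "himp (algH_obj S) U V = pts S - Top S closure_of (U - V)"
proof -
  interpret compact_open_algebra S "alg_obj S"
    by (rule compact_open_algebra_alg_obj) (rule nabla_spectral_axioms)
  have "heyting_imp (alg_obj S) U V = pts S - Top S closure_of (U - V)"
    unfolding heyting_imp_def
    using is_heyting_imp_CO[OF heyting_spectral_space UV] is_heyting_imp_unique[OF partial_order_CO]
    by (intro the_equality)
  then show ?thesis by (simp add: algH_obj_def)
qed

lemma heyting_nabla_lattice_algH_obj: "heyting_nabla_lattice (algH_obj S)"
proof -
  interpret compact_open_algebra S "algH_obj S"
    by (rule compact_open_algebra_algH_obj) (rule nabla_spectral_axioms)
  show ?thesis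
    by unfold_locales (simp add: carrier_CO himp_algH_obj is_heyting_imp_CO[OF heyting_spectral_space])
qed

end

locale heyting_spec_morphism = S: heyting_nabla_spectral S + T: heyting_nabla_spectral T
  for S :: "'x nabla_space" and T :: "'y nabla_space" +
  fixes f :: "'x \<Rightarrow> 'y"
  assumes specH_hom: "f \<in> specH_hom S T"
begin

sublocale spec_morphism S T f
  by unfold_locales (use specH_hom in \<open>simp add: specH_hom_def\<close>)

lemma heyting_spectral_map: "heyting_spectral_map (Top S) (Top T) f"
  using specH_hom by (simp add: specH_hom_def)

lemma alg_mor_algH_hom: "alg_mor S T f \<in> algH_hom (algH_obj T) (algH_obj S)"
proof -
  interpret A: compact_open_algebra S "algH_obj S"
    by (rule compact_open_algebra_algH_obj) (rule S.nabla_spectral_axioms)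
  interpret B: compact_open_algebra T "algH_obj T"
    by (rule compact_open_algebra_algH_obj) (rule T.nabla_spectral_axioms)
  interpret B: heyting_nabla_lattice "algH_obj T" by (rule T.heyting_nabla_lattice_algH_obj)
  have "alg_mor S T f (himp (algH_obj T) U V) = himp (algH_obj S) (alg_mor S T f U) (alg_mor S T f V)"
    if UV: "U \<in> CO (Top T)" "V \<in> CO (Top T)" for U V
  proof -
    have closed: "closedin (patch (Top T)) (U - V)"
      using UV by (intro closedin_diff closedin_patch_CO openin_patch_CO)
    have "{x \<in> pts S. f x \<in> pts T - Top T closure_of (U - V)} =
        pts S - {x \<in> pts S. f x \<in> Top T closure_of (U - V)}" by auto
    also have "\<dots> = pts S - Top S closure_of {x \<in> pts S. f x \<in> U - V}"
      by (simp only: heyting_spectral_map_vimage_closure_of[OF heyting_spectral_map closed])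
    also have "{x \<in> pts S. f x \<in> U - V} = {x \<in> pts S. f x \<in> U} - {x \<in> pts S. f x \<in> V}" by blast
    finally have "{x \<in> pts S. f x \<in> pts T - Top T closure_of (U - V)} =
        pts S - Top S closure_of ({x \<in> pts S. f x \<in> U} - {x \<in> pts S. f x \<in> V})" .
    moreover have "pts T - Top T closure_of (U - V) \<in> CO (Top T)"
      using B.himp_closed UV by (simp add: B.carrier_CO T.himp_algH_obj)
    ultimately show ?thesis
      using UV spec_hom_vimage_CO by (simp add: alg_mor_def S.himp_algH_obj T.himp_algH_obj)
  qed
  then show ?thesis
    using alg_mor_alg_hom[OF A.compact_open_algebra_axioms B.compact_open_algebra_axioms]
    by (simp add: algH_hom_def B.carrier_CO)
qed

end

lemma specH_hom_compose:
  assumes "heyting_spec_morphism S T f" "heyting_spec_morphism T W g"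
  shows "compose (pts S) g f \<in> specH_hom S W"
proof -
  interpret f: heyting_spec_morphism S T f by fact
  interpret g: heyting_spec_morphism T W g by fact
  show ?thesis
    using spec_hom_compose[OF f.spec_morphism_axioms g.spec_morphism_axioms]
      heyting_spectral_map_compose[OF f.heyting_spectral_map g.heyting_spectral_map]
    by (simp add: specH_hom_def)
qed

lemma (in heyting_nabla_lattice) heyting_nabla_spectral_spec_obj: "heyting_nabla_spectral (spec_obj A)"
  using nabla_spectral_spec_obj heyting_spectral_space_spectrum[OF heyting_algebra]
  by (simp add: heyting_nabla_spectral_def heyting_nabla_spectral_axioms_def Top_spec_obj)

lemma (in heyting_nabla_lattice) iso_arrow_alpha_heyting:
  "iso_arrow (algH_hom A (algH_obj (spec_obj A))) (algH_hom (algH_obj (spec_obj A)) A)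
    (carrier A) (carrier (algH_obj (spec_obj A))) (alpha A)"
proof -
  let ?B = "algH_obj (spec_obj A)"
  have A: "heyting_nabla_lattice A" by (rule heyting_nabla_lattice_axioms)
  have B: "heyting_nabla_lattice ?B"
    by (rule heyting_nabla_spectral.heyting_nabla_lattice_algH_obj[OF heyting_nabla_spectral_spec_obj])
  interpret B: compact_open_algebra "spec_obj A" ?B
    by (rule compact_open_algebra_algH_obj[OF nabla_spectral_spec_obj])
  interpret alg_morphism A ?B "alpha A"
    by unfold_locales (rule alpha_alg_hom[OF B.compact_open_algebra_axioms])
  have bij: "bij_betw (alpha A) (carrier A) (carrier ?B)"
    by (rule bij_betw_alpha[OF B.compact_open_algebra_axioms])
  have "bij_betw (restrict (inv_into (carrier A) (alpha A)) (carrier ?B)) (carrier ?B) (carrier A)"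
    using bij_betw_inv_into[OF bij] by simp
  then show ?thesis
    by (intro iso_arrowI bij bij_betw_alg_hom_imp_algH_hom[OF A B alg_hom bij]
        bij_betw_alg_hom_imp_algH_hom[OF B A bij_betw_hom_inverse[OF bij]])
qed

section \<open>The duality\<close>

lemma Alg_iff: "A \<in> Alg C \<longleftrightarrow> nabla_lattice A \<and> (\<forall>c\<in>C. alg_satisfies A c)"
  by (auto simp: Alg_def nabla_algebra_def nabla_lattice_def nabla_lattice_axioms_def
      distrib_bounded_lattice_def distrib_bounded_lattice_axioms_def)

lemma AlgH_iff: "A \<in> AlgH C \<longleftrightarrow> heyting_nabla_lattice A \<and> (\<forall>c\<in>C. alg_satisfies A c)"
  by (auto simp: AlgH_def nabla_algebra_def heyting_nabla_lattice_def heyting_nabla_lattice_axioms_def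
      nabla_lattice_def nabla_lattice_axioms_def
      distrib_bounded_lattice_def distrib_bounded_lattice_axioms_def)

lemma Spec_iff: "S \<in> Spec C \<longleftrightarrow> nabla_spectral S \<and> (\<forall>c\<in>C. space_satisfies S c)"
  by (simp add: Spec_def nabla_spectral_def)

lemma SpecH_iff: "S \<in> SpecH C \<longleftrightarrow> heyting_nabla_spectral S \<and> (\<forall>c\<in>C. space_satisfies S c)"
  by (auto simp: SpecH_def Spec_iff heyting_nabla_spectral_def heyting_nabla_spectral_axioms_def)

lemma spec_obj_Spec: "A \<in> Alg C \<Longrightarrow> spec_obj A \<in> Spec C"
  by (simp add: Alg_iff Spec_iff nabla_lattice.nabla_spectral_spec_obj nabla_lattice.space_satisfies_spec_obj)

lemma spec_obj_SpecH: "A \<in> AlgH C \<Longrightarrow> spec_obj A \<in> SpecH C"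
  by (simp add: AlgH_iff SpecH_iff heyting_nabla_lattice.heyting_nabla_spectral_spec_obj
      heyting_nabla_lattice.axioms(1) nabla_lattice.space_satisfies_spec_obj)

lemma alg_obj_Alg:
  assumes "S \<in> Spec C"
  shows "alg_obj S \<in> Alg C"
proof -
  interpret compact_open_algebra S "alg_obj S"
    using assms by (intro compact_open_algebra_alg_obj) (simp add: Spec_iff)
  show ?thesis
    using assms nabla_lattice_axioms alg_satisfies_CO by (simp add: Alg_iff Spec_iff)
qed

lemma algH_obj_AlgH:
  assumes "S \<in> SpecH C"
  shows "algH_obj S \<in> AlgH C"
proof -
  interpret heyting_nabla_spectral S using assms by (simp add: SpecH_iff)
  interpret compact_open_algebra S "algH_obj S"
    by (rule compact_open_algebra_algH_obj) (rule nabla_spectral_axioms)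
  show ?thesis
    using assms heyting_nabla_lattice_algH_obj alg_satisfies_CO by (simp add: AlgH_iff SpecH_iff)
qed

lemma Alg_nabla_lattice: "A \<in> Alg C \<Longrightarrow> nabla_lattice A"
  and AlgH_heyting_nabla_lattice: "B \<in> AlgH C \<Longrightarrow> heyting_nabla_lattice B"
  and Spec_nabla_spectral: "S \<in> Spec C \<Longrightarrow> nabla_spectral S"
  and SpecH_heyting_nabla_spectral: "T \<in> SpecH C \<Longrightarrow> heyting_nabla_spectral T"
  by (simp_all add: Alg_iff AlgH_iff Spec_iff SpecH_iff)

lemma AlgH_nabla_lattice: "A \<in> AlgH C \<Longrightarrow> nabla_lattice A"
  by (rule heyting_nabla_lattice.axioms(1)[OF AlgH_heyting_nabla_lattice])

lemma SpecH_nabla_spectral: "S \<in> SpecH C \<Longrightarrow> nabla_spectral S"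
  by (rule heyting_nabla_spectral.axioms(1)[OF SpecH_heyting_nabla_spectral])

lemma Alg_alg_morphism:
  "A \<in> Alg C \<Longrightarrow> B \<in> Alg C \<Longrightarrow> f \<in> alg_hom A B \<Longrightarrow> alg_morphism A B f"
  by (simp add: alg_morphism_def alg_morphism_axioms_def Alg_nabla_lattice)

lemma AlgH_heyting_alg_morphism:
  "A \<in> AlgH C \<Longrightarrow> B \<in> AlgH C \<Longrightarrow> f \<in> algH_hom A B \<Longrightarrow> heyting_alg_morphism A B f"
  by (simp add: heyting_alg_morphism_def heyting_alg_morphism_axioms_def AlgH_heyting_nabla_lattice)

lemma AlgH_alg_morphism:
  "A \<in> AlgH C \<Longrightarrow> B \<in> AlgH C \<Longrightarrow> f \<in> algH_hom A B \<Longrightarrow> alg_morphism A B f"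
  by (simp add: alg_morphism_def alg_morphism_axioms_def AlgH_nabla_lattice algH_hom_def)

lemma Spec_spec_morphism:
  "S \<in> Spec C \<Longrightarrow> T \<in> Spec C \<Longrightarrow> f \<in> spec_hom S T \<Longrightarrow> spec_morphism S T f"
  by (simp add: spec_morphism_def spec_morphism_axioms_def Spec_nabla_spectral)

lemma SpecH_heyting_spec_morphism:
  "S \<in> SpecH C \<Longrightarrow> T \<in> SpecH C \<Longrightarrow> f \<in> specH_hom S T \<Longrightarrow> heyting_spec_morphism S T f"
  by (simp add: heyting_spec_morphism_def heyting_spec_morphism_axioms_def SpecH_heyting_nabla_spectral)

lemma SpecH_spec_morphism:
  "S \<in> SpecH C \<Longrightarrow> T \<in> SpecH C \<Longrightarrow> f \<in> specH_hom S T \<Longrightarrow> spec_morphism S T f"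
  by (simp add: spec_morphism_def spec_morphism_axioms_def SpecH_nabla_spectral specH_hom_def)

lemma Spec_alg_obj: "S \<in> Spec C \<Longrightarrow> compact_open_algebra S (alg_obj S)"
  by (rule compact_open_algebra_alg_obj[OF Spec_nabla_spectral])

lemma SpecH_algH_obj: "S \<in> SpecH C \<Longrightarrow> compact_open_algebra S (algH_obj S)"
  by (rule compact_open_algebra_algH_obj[OF SpecH_nabla_spectral])

lemma SpecH_heyting_spectral_space: "S \<in> SpecH C \<Longrightarrow> heyting_spectral_space (Top S)"
  by (simp add: SpecH_def)

lemmas Alg_category =
  nabla_lattice.alg_hom_id[OF Alg_nabla_lattice]
  alg_morphism.alg_hom_compose[OF Alg_alg_morphism]

lemmas AlgH_category =
  heyting_nabla_lattice.algH_hom_id[OF AlgH_heyting_nabla_lattice]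
  heyting_alg_morphism.algH_hom_compose[OF AlgH_heyting_alg_morphism]

lemmas Spec_category =
  nabla_spectral.spec_hom_id[OF Spec_nabla_spectral]
  spec_hom_compose[OF Spec_spec_morphism Spec_spec_morphism]

lemmas SpecH_category =
  heyting_nabla_spectral.specH_hom_id[OF SpecH_heyting_nabla_spectral]
  specH_hom_compose[OF SpecH_heyting_spec_morphism SpecH_heyting_spec_morphism]

lemmas spec_functor =
  spec_obj_Spec
  alg_morphism.spec_mor_spec_hom[OF Alg_alg_morphism]
  nabla_lattice.spec_mor_id[OF Alg_nabla_lattice]
  spec_mor_compose[OF Alg_alg_morphism Alg_alg_morphism]

lemmas specH_functor =
  spec_obj_SpecH
  heyting_alg_morphism.spec_mor_specH_hom[OF AlgH_heyting_alg_morphism]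
  nabla_lattice.spec_mor_id[OF AlgH_nabla_lattice]
  spec_mor_compose[OF AlgH_alg_morphism AlgH_alg_morphism]

lemmas alg_functor =
  alg_obj_Alg
  spec_morphism.alg_mor_alg_hom[OF Spec_spec_morphism Spec_alg_obj Spec_alg_obj]
  compact_open_algebra.alg_mor_id[OF Spec_alg_obj]
  alg_mor_compose[OF Spec_spec_morphism Spec_spec_morphism Spec_alg_obj]

lemmas algH_functor =
  algH_obj_AlgH
  heyting_spec_morphism.alg_mor_algH_hom[OF SpecH_heyting_spec_morphism]
  compact_open_algebra.alg_mor_id[OF SpecH_algH_obj]
  alg_mor_compose[OF SpecH_spec_morphism SpecH_spec_morphism SpecH_algH_obj]

lemmas alpha_natural_isomorphism =
  nabla_lattice.iso_arrow_alpha[OF Alg_nabla_lattice Spec_alg_obj[OF spec_obj_Spec]]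
  alg_morphism.alpha_natural[OF Alg_alg_morphism]

lemmas alpha_heyting_natural_isomorphism =
  heyting_nabla_lattice.iso_arrow_alpha_heyting[OF AlgH_heyting_nabla_lattice]
  alg_morphism.alpha_natural[OF AlgH_alg_morphism]

lemmas beta_natural_isomorphism =
  compact_open_algebra.iso_arrow_beta[OF Spec_alg_obj]
  spec_morphism.beta_natural[OF Spec_spec_morphism Spec_alg_obj Spec_alg_obj]

lemmas beta_heyting_natural_isomorphism =
  compact_open_algebra.iso_arrow_beta_heyting[OF SpecH_algH_obj SpecH_heyting_spectral_space]
  spec_morphism.beta_natural[OF SpecH_spec_morphism SpecH_algH_obj SpecH_algH_obj]

theorem theorem4p11:
  fixes C :: "nabla_cond set"
  shows "(
      \<comment> \<open>the algebras form a category\<close>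
      (\<forall>A\<in>(Alg C :: 'a nabla_alg set). (\<lambda>a\<in>carrier A. a) \<in> alg_hom A A) \<and>
      (\<forall>A\<in>(Alg C :: 'a nabla_alg set). \<forall>B\<in>(Alg C :: 'b nabla_alg set). \<forall>D\<in>(Alg C :: 'c nabla_alg set).
        \<forall>f\<in>alg_hom A B. \<forall>g\<in>alg_hom B D. compose (carrier A) g f \<in> alg_hom A D) \<and>
      \<comment> \<open>the spaces form a category\<close>
      (\<forall>S\<in>(Spec C :: 'x nabla_space set). (\<lambda>x\<in>pts S. x) \<in> spec_hom S S) \<and>
      (\<forall>S\<in>(Spec C :: 'x nabla_space set). \<forall>T\<in>(Spec C :: 'y nabla_space set). \<forall>W\<in>(Spec C :: 'z nabla_space set).
        \<forall>f\<in>spec_hom S T. \<forall>g\<in>spec_hom T W. compose (pts S) g f \<in> spec_hom S W) \<and>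
      \<comment> \<open>contravariant functor from algebras to spaces\<close>
      (\<forall>A\<in>(Alg C :: 'a nabla_alg set). spec_obj A \<in> Spec C) \<and>
      (\<forall>A\<in>(Alg C :: 'a nabla_alg set). \<forall>B\<in>(Alg C :: 'b nabla_alg set).
        \<forall>f\<in>alg_hom A B. spec_mor A B f \<in> spec_hom (spec_obj B) (spec_obj A)) \<and>
      (\<forall>A\<in>(Alg C :: 'a nabla_alg set). spec_mor A A (\<lambda>a\<in>carrier A. a) = (\<lambda>P\<in>pts (spec_obj A). P)) \<and>
      (\<forall>A\<in>(Alg C :: 'a nabla_alg set). \<forall>B\<in>(Alg C :: 'b nabla_alg set). \<forall>D\<in>(Alg C :: 'c nabla_alg set).
        \<forall>f\<in>alg_hom A B. \<forall>g\<in>alg_hom B D.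
          spec_mor A D (compose (carrier A) g f) =
          compose (pts (spec_obj D)) (spec_mor A B f) (spec_mor B D g)) \<and>
      \<comment> \<open>contravariant functor from spaces to algebras\<close>
      (\<forall>S\<in>(Spec C :: 'x nabla_space set). alg_obj S \<in> Alg C) \<and>
      (\<forall>S\<in>(Spec C :: 'x nabla_space set). \<forall>T\<in>(Spec C :: 'y nabla_space set).
        \<forall>f\<in>spec_hom S T. alg_mor S T f \<in> alg_hom (alg_obj T) (alg_obj S)) \<and>
      (\<forall>S\<in>(Spec C :: 'x nabla_space set). alg_mor S S (\<lambda>x\<in>pts S. x) = (\<lambda>U\<in>carrier (alg_obj S). U)) \<and>
      (\<forall>S\<in>(Spec C :: 'x nabla_space set). \<forall>T\<in>(Spec C :: 'y nabla_space set). \<forall>W\<in>(Spec C :: 'z nabla_space set).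
        \<forall>f\<in>spec_hom S T. \<forall>g\<in>spec_hom T W.
          alg_mor S W (compose (pts S) g f) =
          compose (carrier (alg_obj W)) (alg_mor S T f) (alg_mor T W g)) \<and>
      \<comment> \<open>alpha is a natural isomorphism\<close>
      (\<forall>A\<in>(Alg C :: 'a nabla_alg set). iso_arrow (alg_hom A (alg_obj (spec_obj A))) (alg_hom (alg_obj (spec_obj A)) A)
        (carrier A) (carrier (alg_obj (spec_obj A))) (alpha A)) \<and>
      (\<forall>A\<in>(Alg C :: 'a nabla_alg set). \<forall>B\<in>(Alg C :: 'b nabla_alg set).
        \<forall>f\<in>alg_hom A B.
          compose (carrier A) (alpha B) f =
          compose (carrier A) (alg_mor (spec_obj B) (spec_obj A) (spec_mor A B f)) (alpha A)) \<and>
      \<comment> \<open>beta is a natural isomorphism\<close>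
      (\<forall>S\<in>(Spec C :: 'x nabla_space set). iso_arrow (spec_hom S (spec_obj (alg_obj S))) (spec_hom (spec_obj (alg_obj S)) S)
        (pts S) (pts (spec_obj (alg_obj S))) (beta S)) \<and>
      (\<forall>S\<in>(Spec C :: 'x nabla_space set). \<forall>T\<in>(Spec C :: 'y nabla_space set).
        \<forall>f\<in>spec_hom S T.
          compose (pts S) (beta T) f =
          compose (pts S) (spec_mor (alg_obj T) (alg_obj S) (alg_mor S T f)) (beta S)))
    \<and> (
      \<comment> \<open>the algebras form a category\<close>
      (\<forall>A\<in>(AlgH C :: 'a heyting_nabla_alg set). (\<lambda>a\<in>carrier A. a) \<in> algH_hom A A) \<and>
      (\<forall>A\<in>(AlgH C :: 'a heyting_nabla_alg set). \<forall>B\<in>(AlgH C :: 'b heyting_nabla_alg set). \<forall>D\<in>(AlgH C :: 'c heyting_nabla_alg set).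
        \<forall>f\<in>algH_hom A B. \<forall>g\<in>algH_hom B D. compose (carrier A) g f \<in> algH_hom A D) \<and>
      \<comment> \<open>the spaces form a category\<close>
      (\<forall>S\<in>(SpecH C :: 'x nabla_space set). (\<lambda>x\<in>pts S. x) \<in> specH_hom S S) \<and>
      (\<forall>S\<in>(SpecH C :: 'x nabla_space set). \<forall>T\<in>(SpecH C :: 'y nabla_space set). \<forall>W\<in>(SpecH C :: 'z nabla_space set).
        \<forall>f\<in>specH_hom S T. \<forall>g\<in>specH_hom T W. compose (pts S) g f \<in> specH_hom S W) \<and>
      \<comment> \<open>contravariant functor from algebras to spaces\<close>
      (\<forall>A\<in>(AlgH C :: 'a heyting_nabla_alg set). spec_obj A \<in> SpecH C) \<and>
      (\<forall>A\<in>(AlgH C :: 'a heyting_nabla_alg set). \<forall>B\<in>(AlgH C :: 'b heyting_nabla_alg set).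
        \<forall>f\<in>algH_hom A B. spec_mor A B f \<in> specH_hom (spec_obj B) (spec_obj A)) \<and>
      (\<forall>A\<in>(AlgH C :: 'a heyting_nabla_alg set). spec_mor A A (\<lambda>a\<in>carrier A. a) = (\<lambda>P\<in>pts (spec_obj A). P)) \<and>
      (\<forall>A\<in>(AlgH C :: 'a heyting_nabla_alg set). \<forall>B\<in>(AlgH C :: 'b heyting_nabla_alg set). \<forall>D\<in>(AlgH C :: 'c heyting_nabla_alg set).
        \<forall>f\<in>algH_hom A B. \<forall>g\<in>algH_hom B D.
          spec_mor A D (compose (carrier A) g f) =
          compose (pts (spec_obj D)) (spec_mor A B f) (spec_mor B D g)) \<and>
      \<comment> \<open>contravariant functor from spaces to algebras\<close>
      (\<forall>S\<in>(SpecH C :: 'x nabla_space set). algH_obj S \<in> AlgH C) \<and>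
      (\<forall>S\<in>(SpecH C :: 'x nabla_space set). \<forall>T\<in>(SpecH C :: 'y nabla_space set).
        \<forall>f\<in>specH_hom S T. alg_mor S T f \<in> algH_hom (algH_obj T) (algH_obj S)) \<and>
      (\<forall>S\<in>(SpecH C :: 'x nabla_space set). alg_mor S S (\<lambda>x\<in>pts S. x) = (\<lambda>U\<in>carrier (algH_obj S). U)) \<and>
      (\<forall>S\<in>(SpecH C :: 'x nabla_space set). \<forall>T\<in>(SpecH C :: 'y nabla_space set). \<forall>W\<in>(SpecH C :: 'z nabla_space set).
        \<forall>f\<in>specH_hom S T. \<forall>g\<in>specH_hom T W.
          alg_mor S W (compose (pts S) g f) =
          compose (carrier (algH_obj W)) (alg_mor S T f) (alg_mor T W g)) \<and>
      \<comment> \<open>alpha is a natural isomorphism\<close>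
      (\<forall>A\<in>(AlgH C :: 'a heyting_nabla_alg set). iso_arrow (algH_hom A (algH_obj (spec_obj A))) (algH_hom (algH_obj (spec_obj A)) A)
        (carrier A) (carrier (algH_obj (spec_obj A))) (alpha A)) \<and>
      (\<forall>A\<in>(AlgH C :: 'a heyting_nabla_alg set). \<forall>B\<in>(AlgH C :: 'b heyting_nabla_alg set).
        \<forall>f\<in>algH_hom A B.
          compose (carrier A) (alpha B) f =
          compose (carrier A) (alg_mor (spec_obj B) (spec_obj A) (spec_mor A B f)) (alpha A)) \<and>
      \<comment> \<open>beta is a natural isomorphism\<close>
      (\<forall>S\<in>(SpecH C :: 'x nabla_space set). iso_arrow (specH_hom S (spec_obj (algH_obj S))) (specH_hom (spec_obj (algH_obj S)) S)
        (pts S) (pts (spec_obj (algH_obj S))) (beta S)) \<and>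
      (\<forall>S\<in>(SpecH C :: 'x nabla_space set). \<forall>T\<in>(SpecH C :: 'y nabla_space set).
        \<forall>f\<in>specH_hom S T.
          compose (pts S) (beta T) f =
          compose (pts S) (spec_mor (algH_obj T) (algH_obj S) (alg_mor S T f)) (beta S)))"
proof (rule conjI, goal_cases distributive heyting)
  case distributive
  show ?case
    by (intro conjI ballI;
        rule Alg_category Spec_category spec_functor alg_functor
          alpha_natural_isomorphism beta_natural_isomorphism;
        assumption)
next
  case heyting
  show ?case
    by (intro conjI ballI;
        rule AlgH_category SpecH_category specH_functor algH_functor
          alpha_heyting_natural_isomorphism beta_heyting_natural_isomorphism;
        assumption)
qed

end
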